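(* Let $\kappa>0$, let $N\ge1$, $M\ge0$, let $\kappa_I\in\{\kappa,16/\kappa\}$ for $I=1,\dots,N$ and $h_{y_1},\dots,h_{y_M}\in\mathbb{R}$; put $h_{x_I}=\frac{6-\kappa_I}{2\kappa_I}$ and $c(\kappa)=\frac{(6-\kappa)(3\kappa-8)}{2\kappa}$. Let $\mathcal{F}$ carry the Virasoro representation $(\mathcal{L}_n)_{n\in\mathbb{Z}}$ of central charge $c(\kappa)$ given in the context. Let $Z\in C^\infty(S\to\mathbb{R}_+)$ satisfy the null field equations $\mathcal{D}_IZ=0$ for $I=1,\dots,N$, and let $\mathcal{M}=\mathcal{U}(\mathfrak{vir})Z\subset\mathcal{F}$ be the Virasoro submodule of $\mathcal{F}$ generated by $Z$. Then: 1. Both $\mathcal{M}$ and $\bigcap_{I=1}^N\mathrm{Ker}\,\mathcal{A}_I$ are Virasoro submodules of $\mathcal{F}$, and $\mathcal{M}\subset\bigcap_{I}\mathrm{Ker}\,\mathcal{A}_I$. 2. $\mathcal{L}_nZ=0$ for all $n\ge2$, and $\mathcal{M}$ is spanned by the vectors $\mathcal{L}_{-m}^{n_{-m}}\cdots\mathcal{L}_1^{n_1}Z$ with $m\ge-1$ and $n_j\in\mathbb{N}=\{0,1,2,\dots\}$ for all $j=-m,\dots,1$ (indices of the factors increasing from left to right). 3. If $Z$ is translation invariant, i.e. $Z(x_1+\sigma,\dots,y_M+\sigma)=Z(x_1,\dots,y_M)$ for all $\sigma\in\mathbb{R}$, then $\mathcal{L}_1Z=0$. 4. If $Z$ is homogeneous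 of degree $\Delta\in\mathbb{R}$, i.e. $Z(\lambda x_1,\dots,\lambda y_M)=\lambda^\Delta Z(x_1,\dots,y_M)$ for all $\lambda>0$, then $\mathcal{L}_0Z=\big(\Delta+\sum_Ih_{x_I}+\sum_Kh_{y_K}\big)Z$. 5. Consequently, if $Z$ is both translation invariant and homogeneous of degree $\Delta$, then $\mathcal{M}$ is a highest weight module for the Virasoro algebra with highest weight vector $Z$ and highest weight $\Delta+\sum_Ih_{x_I}+\sum_Kh_{y_K}$.
   Context: Function space. Let $S\subset\mathbb{R}^{N+M}$ be the open set of points $(x_1,\dots,x_N,y_1,\dots,y_M)$ with pairwise distinct coordinates that are ordered on the real line in one fixed prescribed order. $\mathcal{F}=C^\infty(S\to\mathbb{C})[f_{-2},f_{-3},\dots]$ is the algebra of polynomials in the indeterminates $f_{-2},f_{-3},\dots$ with coefficients smooth complex functions on $S$. $Z$ is viewed as an element of $\mathcal{F}$ not depending on the $f_m$. Formal series. $f(z)=z+\sum_{m\le -2}f_m z^{1+m}$, regarded as a formal Laurent series at $z=\infty$ with coefficients in $\mathbb{C}[f_{-2},f_{-3},\dots]$; $f',f'',f'''$ are formal derivatives, $Sf=\frac{f'''}{f'}-\frac32\left(\frac{f''}{f'}\right)^2$, and quotients and negative powers are expanded in $z^{-1}$. $\mathrm{Res}_z\sum_m a_mz^m=a_{-1}$. For $j\ge 0$, $$\Big(\frac{1}{(f(z)-r)^{1+j}}\Big)_{|f(z)|>|r|}=\sum_{m\ge 0}\binom{m}{j}f(z)^{-1-m}r^{m-j},$$ where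 $r$ may be a variable or another series such as $f(u)$. Operators. For $n\in\mathbb{Z}$, $\mathcal{L}_n:\mathcal{F}\to\mathcal{F}$ is, with $c=c(\kappa)$, $\delta_{x_I}=h_{x_I}$, $\delta_{y_K}=h_{y_K}$, $$\mathcal{L}_n=\mathrm{Res}_u\,u^{1-n}\Big\{\frac{c}{12}Sf(u)-\sum_{l\le-2}\mathrm{Res}_z\,f'(u)^2z^{-2-l}\Big(\frac{1}{f(z)-f(u)}\Big)_{|f(z)|>|f(u)|}\frac{\partial}{\partial f_l}$$ $$+\sum_{I=1}^N f'(u)^2\Big(\delta_{x_I}\Big(\frac{1}{(f(u)-x_I)^2}\Big)_{|f(u)|>|x_I|}+\Big(\frac{1}{f(u)-x_I}\Big)_{|f(u)|>|x_I|}\frac{\partial}{\partial x_I}\Big)$$ $$+\sum_{K=1}^M f'(u)^2\Big(\delta_{y_K}\Big(\frac{1}{(f(u)-y_K)^2}\Big)_{|f(u)|>|y_K|}+\Big(\frac{1}{f(u)-y_K}\Big)_{|f(u)|>|y_K|}\frac{\partial}{\partial y_K}\Big)\Big\}$$ (all coefficients are polynomials acting by multiplication after the derivative). These satisfy $[\mathcal{L}_n,\mathcal{L}_m]=(n-m)\mathcal{L}_{n+m}+\frac{c}{12}(n^3-n)\delta_{n+m,0}$, i.e. define a representation of the Virasoro algebra $\mathfrak{vir}$ on $\mathcal{F}$ with the central element acting as $c$; $\mathcal{U}(\mathfrak{vir})$ is the universal enveloping algebra. For $I=1,\dots,N$, $\mathcal{A}_I:\mathcal{F}\to\mathcal{F}$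 is $$\mathcal{A}_I=\mathcal{D}_I+2\sum_{m\le-2}p_m(-x_I,f_{-2},f_{-3},\dots)\frac{\partial}{\partial f_m},\qquad p_m(-x_I,f_{-2},\dots)=\mathrm{Res}_v\,v^{-2-m}\Big(\frac{1}{f(v)-x_I}\Big)_{|f(v)|>|x_I|},$$ $$\mathcal{D}_I=\frac{\kappa_I}{2}\frac{\partial^2}{\partial x_I^2}+\sum_{J\ne I}\Big(\frac{2}{x_J-x_I}\frac{\partial}{\partial x_J}+\frac{(\kappa_J-6)/\kappa_J}{(x_J-x_I)^2}\Big)+\sum_{K=1}^M\Big(\frac{2}{y_K-x_I}\frac{\partial}{\partial y_K}-\frac{2h_{y_K}}{(y_K-x_I)^2}\Big).$$ A highest weight module of highest weight $h$ is a module generated by a vector $v$ (highest weight vector) with $L_nv=0$ for $n>0$ and $L_0v=hv$. *)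

theory Defs
  imports
    "HOL-Analysis.Analysis"
    "HOL-Library.Poly_Mapping"
    "HOL-Computational_Algebra.Formal_Laurent_Series"
begin

no_notation fps_nth (infixl \<open>$\<close> 75)

section \<open>Smooth functions on an open set\<close>

primrec higher_differentiable_on ::
  "nat \<Rightarrow> 'a::real_normed_vector set \<Rightarrow> ('a \<Rightarrow> 'b::real_normed_vector) \<Rightarrow> bool" where
  "higher_differentiable_on 0 S g \<longleftrightarrow> continuous_on S g"
| "higher_differentiable_on (Suc n) S g \<longleftrightarrow>
     (\<forall>p\<in>S. g differentiable (at p)) \<and>
     (\<forall>v. higher_differentiable_on n S (\<lambda>p. frechet_derivative g (at p) v))"

definition smooth_on :: "'a::real_normed_vector set \<Rightarrow> ('a \<Rightarrow> 'b::real_normed_vector) \<Rightarrow> bool" where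
  "smooth_on S g \<longleftrightarrow> (\<forall>n. higher_differentiable_on n S g)"

lemma higher_differentiable_on_cong:
  assumes "open S" "\<And>p. p \<in> S \<Longrightarrow> g p = g' p"
  shows "higher_differentiable_on n S g \<longleftrightarrow> higher_differentiable_on n S g'"
  using assms(2)
proof (induction n arbitrary: g g')
  case 0
  then show ?case by (simp cong: continuous_on_cong)
next
  case (Suc n)
  have D: "(g has_derivative d) (at p) \<longleftrightarrow> (g' has_derivative d) (at p)" if "p \<in> S" for p d
    using Suc.prems \<open>open S\<close> that
    by (metis has_derivative_transform_within_open)
  have "frechet_derivative g (at p) = frechet_derivative g' (at p)" if "p \<in> S" for p
    unfolding frechet_derivative_def using D[OF that] by simp
  then have "higher_differentiable_on n S (\<lambda>p. frechet_derivative g (at p) v) \<longleftrightarrow>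
      higher_differentiable_on n S (\<lambda>p. frechet_derivative g' (at p) v)" for v
    by (intro Suc.IH) simp
  moreover have "(\<forall>p\<in>S. g differentiable (at p)) \<longleftrightarrow> (\<forall>p\<in>S. g' differentiable (at p))"
    using D unfolding differentiable_def by blast
  ultimately show ?case by simp
qed

lemma smooth_on_cong:
  "open S \<Longrightarrow> (\<And>p. p \<in> S \<Longrightarrow> g p = g' p) \<Longrightarrow> smooth_on S g \<longleftrightarrow> smooth_on S g'"
  unfolding smooth_on_def using higher_differentiable_on_cong by blast

lemma higher_differentiable_on_imp_continuous_on:
  "higher_differentiable_on n S g \<Longrightarrow> continuous_on S g"
  by (cases n) (auto intro!: differentiable_imp_continuous_on
      simp: differentiable_on_def differentiable_at_withinI)

lemma higher_differentiable_on_SucD: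
  "higher_differentiable_on (Suc n) S g \<Longrightarrow> higher_differentiable_on n S g"
proof (induction n arbitrary: g)
  case 0
  then show ?case using higher_differentiable_on_imp_continuous_on[OF 0] by simp
next
  case (Suc n)
  then show ?case by (metis higher_differentiable_on.simps(2))
qed

lemma higher_differentiable_on_const: "higher_differentiable_on n S (\<lambda>_. c)"
  by (induction n arbitrary: c) (auto simp: frechet_derivative_const)

lemma higher_differentiable_on_bounded_linear:
  assumes "bounded_linear B" shows "higher_differentiable_on n S B"
proof (cases n)
  case 0
  then show ?thesis using assms by (simp add: linear_continuous_on)
next
  case (Suc m)
  have "frechet_derivative B (at p) = B" for p
    using bounded_linear_imp_has_derivative[OF assms] frechet_derivative_at by metis
  then show ?thesis
    using Suc assms
    by (auto simp: higher_differentiable_on_const bounded_linear_imp_differentiable)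
qed

lemma higher_differentiable_on_bounded_linear_comp:
  assumes "bounded_linear B" "open S" "higher_differentiable_on n S g"
  shows "higher_differentiable_on n S (\<lambda>p. B (g p))"
  using assms(3)
proof (induction n arbitrary: g)
  case 0
  then show ?case by (simp add: bounded_linear.continuous_on[OF assms(1)])
next
  case (Suc n)
  have D: "((\<lambda>p. B (g p)) has_derivative (\<lambda>v. B (frechet_derivative g (at p) v))) (at p)"
    if "p \<in> S" for p
    using Suc.prems that
    by (intro bounded_linear.has_derivative[OF assms(1)]) (simp add: frechet_derivative_works)
  then have "frechet_derivative (\<lambda>p. B (g p)) (at p) v = B (frechet_derivative g (at p) v)"
    if "p \<in> S" for p v
    by (simp add: frechet_derivative_at[OF D[OF that], symmetric])
  then have "higher_differentiable_on n S (\<lambda>p. frechet_derivative (\<lambda>p. B (g p)) (at p) v)" for v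
    using Suc by (subst higher_differentiable_on_cong[OF \<open>open S\<close>]) auto
  then show ?case using differentiableI[OF D] by simp
qed

lemma higher_differentiable_on_add:
  assumes "open S" "higher_differentiable_on n S g" "higher_differentiable_on n S k"
  shows "higher_differentiable_on n S (\<lambda>p. g p + k p)"
  using assms(2,3)
proof (induction n arbitrary: g k)
  case 0
  then show ?case by (simp add: continuous_on_add)
next
  case (Suc n)
  have D: "((\<lambda>p. g p + k p) has_derivative
      (\<lambda>v. frechet_derivative g (at p) v + frechet_derivative k (at p) v)) (at p)"
    if "p \<in> S" for p
    using Suc.prems that by (intro has_derivative_add) (simp_all add: frechet_derivative_works)
  then have "frechet_derivative (\<lambda>p. g p + k p) (at p) v =
      frechet_derivative g (at p) v + frechet_derivative k (at p) v"
    if "p \<in> S" for p v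
    by (simp add: frechet_derivative_at[OF D[OF that], symmetric])
  then have "higher_differentiable_on n S (\<lambda>p. frechet_derivative (\<lambda>p. g p + k p) (at p) v)" for v
    using Suc by (subst higher_differentiable_on_cong[OF \<open>open S\<close>]) auto
  then show ?case using differentiableI[OF D] by simp
qed

lemma higher_differentiable_on_mult:
  fixes g k :: "'a::real_normed_vector \<Rightarrow> 'b::real_normed_algebra"
  assumes "open S" "higher_differentiable_on n S g" "higher_differentiable_on n S k"
  shows "higher_differentiable_on n S (\<lambda>p. g p * k p)"
  using assms(2,3)
proof (induction n arbitrary: g k)
  case 0
  then show ?case by (simp add: continuous_on_mult)
next
  case (Suc n)
  have D: "((\<lambda>p. g p * k p) has_derivative
      (\<lambda>v. g p * frechet_derivative k (at p) v + frechet_derivative g (at p) v * k p)) (at p)"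
    if "p \<in> S" for p
    using Suc.prems that by (intro has_derivative_mult) (simp_all add: frechet_derivative_works)
  then have "frechet_derivative (\<lambda>p. g p * k p) (at p) v =
      g p * frechet_derivative k (at p) v + frechet_derivative g (at p) v * k p"
    if "p \<in> S" for p v
    by (simp add: frechet_derivative_at[OF D[OF that], symmetric])
  moreover have "higher_differentiable_on n S
      (\<lambda>p. g p * frechet_derivative k (at p) v + frechet_derivative g (at p) v * k p)" for v
    using Suc.prems
    by (intro higher_differentiable_on_add[OF \<open>open S\<close>]
        Suc.IH[OF Suc.prems(1)[THEN higher_differentiable_on_SucD]]
        Suc.IH[OF _ Suc.prems(2)[THEN higher_differentiable_on_SucD]]) auto
  ultimately have "higher_differentiable_on n S (\<lambda>p. frechet_derivative (\<lambda>p. g p * k p) (at p) v)" for v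
    by (subst higher_differentiable_on_cong[OF \<open>open S\<close>]) auto
  then show ?case using differentiableI[OF D] by simp
qed

lemma higher_differentiable_on_inverse:
  fixes g :: "'a::real_normed_vector \<Rightarrow> complex"
  assumes "open S" "\<And>p. p \<in> S \<Longrightarrow> g p \<noteq> 0" "higher_differentiable_on n S g"
  shows "higher_differentiable_on n S (\<lambda>p. inverse (g p))"
  using assms(3)
proof (induction n)
  case 0
  then show ?case using assms(2) by (simp add: continuous_on_inverse)
next
  case (Suc n)
  have D: "((\<lambda>p. inverse (g p)) has_derivative
      (\<lambda>v. - 1 * (inverse (g p) * frechet_derivative g (at p) v * inverse (g p)))) (at p)"
    if "p \<in> S" for p
    using Suc.prems Deriv.has_derivative_inverse[where f = g and x = p and S = UNIV] assms(2) that
    by (simp add: frechet_derivative_works)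
  then have "frechet_derivative (\<lambda>p. inverse (g p)) (at p) v =
      - 1 * (inverse (g p) * frechet_derivative g (at p) v * inverse (g p))"
    if "p \<in> S" for p v
    by (simp add: frechet_derivative_at[OF D[OF that], symmetric])
  moreover have "higher_differentiable_on n S
      (\<lambda>p. - 1 * (inverse (g p) * frechet_derivative g (at p) v * inverse (g p)))" for v
    using Suc.prems
    by (intro higher_differentiable_on_mult[OF \<open>open S\<close>] higher_differentiable_on_const
        Suc.IH[OF Suc.prems[THEN higher_differentiable_on_SucD]]) auto
  ultimately have "higher_differentiable_on n S (\<lambda>p. frechet_derivative (\<lambda>p. inverse (g p)) (at p) v)" for v
    by (subst higher_differentiable_on_cong[OF \<open>open S\<close>]) auto
  then show ?case using differentiableI[OF D] by simp
qed

lemma smooth_on_const: "smooth_on S (\<lambda>_. c)"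
  by (simp add: smooth_on_def higher_differentiable_on_const)

lemma smooth_on_bounded_linear: "bounded_linear B \<Longrightarrow> smooth_on S B"
  by (simp add: smooth_on_def higher_differentiable_on_bounded_linear)

lemma smooth_on_bounded_linear_comp:
  "bounded_linear B \<Longrightarrow> open S \<Longrightarrow> smooth_on S g \<Longrightarrow> smooth_on S (\<lambda>p. B (g p))"
  by (simp add: smooth_on_def higher_differentiable_on_bounded_linear_comp)

lemma smooth_on_add: "open S \<Longrightarrow> smooth_on S g \<Longrightarrow> smooth_on S k \<Longrightarrow> smooth_on S (\<lambda>p. g p + k p)"
  by (simp add: smooth_on_def higher_differentiable_on_add)

lemma smooth_on_mult:
  fixes g k :: "'a::real_normed_vector \<Rightarrow> 'b::real_normed_algebra"
  shows "open S \<Longrightarrow> smooth_on S g \<Longrightarrow> smooth_on S k \<Longrightarrow> smooth_on S (\<lambda>p. g p * k p)"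
  by (simp add: smooth_on_def higher_differentiable_on_mult)

lemma smooth_on_diff:
  assumes "open S" "smooth_on S g" "smooth_on S k"
  shows "smooth_on S (\<lambda>p. g p - k p)"
  using smooth_on_add[OF assms(1,2) smooth_on_bounded_linear_comp[OF
        bounded_linear_minus[OF bounded_linear_ident] assms(1,3)]]
  by simp

lemma smooth_on_inverse:
  fixes g :: "'a::real_normed_vector \<Rightarrow> complex"
  shows "open S \<Longrightarrow> (\<And>p. p \<in> S \<Longrightarrow> g p \<noteq> 0) \<Longrightarrow> smooth_on S g \<Longrightarrow> smooth_on S (\<lambda>p. inverse (g p))"
  by (simp add: smooth_on_def higher_differentiable_on_inverse)

lemma smooth_on_frechet_derivative:
  "smooth_on S g \<Longrightarrow> smooth_on S (\<lambda>p. frechet_derivative g (at p) v)"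
  unfolding smooth_on_def by (metis higher_differentiable_on.simps(2))


section \<open>The configuration space and its smooth functions\<close>

text \<open>
  All \<open>N + M\<close> points are indexed by one finite linearly ordered type \<open>'i\<close>, whose order is the
  prescribed order of the points on the real line. Which of them are \<open>x\<close>'s is
  recorded by a subset \<open>X\<close> of the indices: \<open>N = card X\<close>, \<open>M = card (- X)\<close>, and \<open>p $ i\<close> is
  the coordinate \<open>x\<^sub>i\<close> if \<open>i \<in> X\<close> and \<open>y\<^sub>i\<close> otherwise. This allows every interlacing of
  the \<open>x\<close>'s and \<open>y\<close>'s, and \<open>M = 0\<close>.
\<close>

definition chamber :: "(real ^ 'i::{finite,linorder}) set" where
  "chamber = {p. \<forall>i j. i < j \<longrightarrow> p $ i < p $ j}"

lemma open_chamber: "open (chamber :: (real ^ 'i::{finite,linorder}) set)"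
proof -
  have *: "(chamber :: (real ^ 'i::{finite,linorder}) set) = (\<Inter>i. \<Inter>j\<in>{j. i < j}. {p. p $ i < p $ j})"
    by (auto simp: chamber_def)
  show ?thesis
    unfolding * by (intro open_INT ballI open_Collect_less) (auto intro!: continuous_intros)
qed

lemma chamber_nonempty: "(chamber :: (real ^ 'i::{finite,linorder}) set) \<noteq> {}"
proof -
  have "card {j. j < i} < card {j. j < i'}" if "i < i'" for i i' :: 'i
    using that by (intro psubset_card_mono) auto
  then have "(\<chi> i. real (card {j. j < i})) \<in> (chamber :: (real ^ 'i::{finite,linorder}) set)"
    by (simp add: chamber_def)
  then show ?thesis by blast
qed

lemma chamber_distinct:
  assumes "p \<in> chamber" "i \<noteq> j" shows "p $ i \<noteq> p $ j"
proof (cases "i < j")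
  case True
  then have "p $ i < p $ j" using assms(1) unfolding chamber_def by blast
  then show ?thesis by simp
next
  case False
  then have "j < i" using assms(2) by simp
  then have "p $ j < p $ i" using assms(1) unfolding chamber_def by blast
  then show ?thesis by simp
qed

text \<open>
  Functions are normalised to be zero outside \<open>chamber\<close>, so that equality is
  equality on \<open>chamber\<close>.
\<close>

typedef (overloaded) 'i::"{finite,linorder}" smooth_fun =
    "{g :: real ^ 'i::{finite,linorder} \<Rightarrow> complex. smooth_on chamber g \<and> (\<forall>p. p \<notin> chamber \<longrightarrow> g p = 0)}"
  by (rule exI[of _ "\<lambda>_. 0"]) (simp add: smooth_on_const)

setup_lifting type_definition_smooth_fun

lemma Rep_smooth_fun_outside: "p \<notin> chamber \<Longrightarrow> Rep_smooth_fun g p = 0"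
  using Rep_smooth_fun[of g] by simp

instantiation smooth_fun :: ("{finite,linorder}") comm_ring_1
begin

lift_definition zero_smooth_fun :: "'a smooth_fun" is "\<lambda>_. 0"
  by (simp add: smooth_on_const)

lift_definition one_smooth_fun :: "'a smooth_fun" is "\<lambda>p. if p \<in> chamber then 1 else 0"
  by (subst smooth_on_cong[OF open_chamber, of _ "\<lambda>_. 1"]) (auto simp: smooth_on_const)

lift_definition plus_smooth_fun :: "'a smooth_fun \<Rightarrow> 'a smooth_fun \<Rightarrow> 'a smooth_fun" is
  "\<lambda>g k p. g p + k p"
  by (simp add: smooth_on_add open_chamber)

lift_definition uminus_smooth_fun :: "'a smooth_fun \<Rightarrow> 'a smooth_fun" is "\<lambda>g p. - g p"
  by (auto intro!: smooth_on_bounded_linear_comp[OF bounded_linear_minus[OF bounded_linear_ident] open_chamber])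

lift_definition minus_smooth_fun :: "'a smooth_fun \<Rightarrow> 'a smooth_fun \<Rightarrow> 'a smooth_fun" is
  "\<lambda>g k p. g p - k p"
  by (auto simp: smooth_on_diff open_chamber)

lift_definition times_smooth_fun :: "'a smooth_fun \<Rightarrow> 'a smooth_fun \<Rightarrow> 'a smooth_fun" is
  "\<lambda>g k p. g p * k p"
  by (simp add: smooth_on_mult open_chamber)

instance
proof
  show "(0::'a smooth_fun) \<noteq> 1"
  proof
    obtain p :: "(real, 'a) vec" where p: "p \<in> chamber" using chamber_nonempty by blast
    assume "(0::'a smooth_fun) = 1"
    then have "Rep_smooth_fun (0::'a smooth_fun) p = Rep_smooth_fun 1 p" by simp
    then show False using p by (simp add: zero_smooth_fun.rep_eq one_smooth_fun.rep_eq)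
  qed
qed (simp_all add: Rep_smooth_fun_inject[symmetric] fun_eq_iff plus_smooth_fun.rep_eq
    minus_smooth_fun.rep_eq uminus_smooth_fun.rep_eq zero_smooth_fun.rep_eq one_smooth_fun.rep_eq
    times_smooth_fun.rep_eq algebra_simps Rep_smooth_fun_outside)

end

text \<open>The element of \<open>C\<^sup>\<infinity>(S)\<close> given by a function that is smooth on \<open>chamber\<close>.\<close>

definition smooth_fun_of :: "(real ^ 'i::{finite,linorder} \<Rightarrow> complex) \<Rightarrow> 'i smooth_fun" where
  "smooth_fun_of g = Abs_smooth_fun (\<lambda>p. if p \<in> chamber then g p else 0)"

lemma Rep_smooth_fun_of:
  assumes "smooth_on chamber g"
  shows "Rep_smooth_fun (smooth_fun_of g) p = (if p \<in> chamber then g p else 0)"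
proof -
  have "smooth_on chamber (\<lambda>p. if p \<in> chamber then g p else 0)"
    using assms by (subst smooth_on_cong[OF open_chamber]) auto
  then show ?thesis
    unfolding smooth_fun_of_def by (subst Abs_smooth_fun_inverse) auto
qed

lift_definition pderiv_smooth :: "'i \<Rightarrow> 'i::{finite,linorder} smooth_fun \<Rightarrow> 'i smooth_fun" is
  "\<lambda>i g p. if p \<in> chamber then frechet_derivative g (at p) (axis i 1) else 0"
  by (subst smooth_on_cong[OF open_chamber,
        of _ "\<lambda>p. frechet_derivative _ (at p) (axis _ 1)"])
     (auto simp: smooth_on_frechet_derivative)

definition const_smooth :: "complex \<Rightarrow> 'i::{finite,linorder} smooth_fun" where
  "const_smooth a = smooth_fun_of (\<lambda>_. a)"

definition coord_smooth :: "'i \<Rightarrow> 'i::{finite,linorder} smooth_fun" where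
  "coord_smooth i = smooth_fun_of (\<lambda>p. complex_of_real (p $ i))"

text \<open>The function \<open>1 / (p\<^sub>j - p\<^sub>i)\<close>, used only for \<open>j \<noteq> i\<close>.\<close>

definition inv_diff_smooth :: "'i \<Rightarrow> 'i \<Rightarrow> 'i::{finite,linorder} smooth_fun" where
  "inv_diff_smooth j i = smooth_fun_of (\<lambda>p. 1 / complex_of_real (p $ j - p $ i))"

lemma smooth_on_of_real:
  "smooth_on chamber Z \<Longrightarrow> smooth_on chamber (\<lambda>p. complex_of_real (Z p))"
  by (intro smooth_on_bounded_linear_comp[OF bounded_linear_of_real open_chamber])

lemma smooth_on_coord: "smooth_on chamber (\<lambda>p. complex_of_real (p $ i))"
  by (intro smooth_on_of_real smooth_on_bounded_linear bounded_linear_vec_nth)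

lemma Rep_const_smooth: "Rep_smooth_fun (const_smooth a) p = (if p \<in> chamber then a else 0)"
  by (simp add: const_smooth_def Rep_smooth_fun_of smooth_on_const)

lemma Rep_coord_smooth:
  "Rep_smooth_fun (coord_smooth i) p = (if p \<in> chamber then complex_of_real (p $ i) else 0)"
  by (simp add: coord_smooth_def Rep_smooth_fun_of smooth_on_coord)

lemma Rep_inv_diff_smooth:
  assumes "j \<noteq> i"
  shows "Rep_smooth_fun (inv_diff_smooth j i) p =
    (if p \<in> chamber then 1 / complex_of_real (p $ j - p $ i) else 0)"
proof -
  have "smooth_on chamber (\<lambda>p. p $ j - p $ i)"
    by (intro smooth_on_bounded_linear bounded_linear_sub bounded_linear_vec_nth)
  then have "smooth_on chamber (\<lambda>p. inverse (complex_of_real (p $ j - p $ i)))"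
    using chamber_distinct[OF _ assms]
    by (intro smooth_on_inverse open_chamber smooth_on_of_real) (simp_all only: of_real_eq_0_iff, force)
  then show ?thesis
    unfolding inv_diff_smooth_def by (subst Rep_smooth_fun_of) (simp_all add: divide_inverse)
qed


section \<open>The space \<open>C\<^sup>\<infinity>(S)[f\<^sub>-\<^sub>2, f\<^sub>-\<^sub>3, \<dots>]\<close>\<close>

text \<open>
  Polynomials are finitely supported maps from monomials to coefficients, monomials being
  finitely supported exponent functions. The indeterminate number \<open>k\<close> is \<open>f\<^sub>m\<close> with \<open>m = - 2 - k\<close>.
\<close>

type_synonym 'i fock = "(nat \<Rightarrow>\<^sub>0 nat) \<Rightarrow>\<^sub>0 'i smooth_fun"

definition fcoeff :: "'i::{finite,linorder} smooth_fun \<Rightarrow> 'i fock" where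
  "fcoeff g = Poly_Mapping.single 0 g"

abbreviation fconst :: "complex \<Rightarrow> 'i::{finite,linorder} fock" where
  "fconst a \<equiv> fcoeff (const_smooth a)"

abbreviation fcoord :: "'i \<Rightarrow> 'i::{finite,linorder} fock" where
  "fcoord i \<equiv> fcoeff (coord_smooth i)"

abbreviation finv_diff :: "'i \<Rightarrow> 'i \<Rightarrow> 'i::{finite,linorder} fock" where
  "finv_diff j i \<equiv> fcoeff (inv_diff_smooth j i)"

definition fvar :: "nat \<Rightarrow> 'i::{finite,linorder} fock" where
  "fvar k = Poly_Mapping.single (Poly_Mapping.single k 1) 1"

definition pderiv_coord :: "'i \<Rightarrow> 'i::{finite,linorder} fock \<Rightarrow> 'i fock" where
  "pderiv_coord i P = Poly_Mapping.map (pderiv_smooth i) P"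

text \<open>For a monomial \<open>\<mu>\<close> free of the variable, the coefficient \<open>of_nat 0\<close> removes the term.\<close>

definition pderiv_var :: "nat \<Rightarrow> 'i::{finite,linorder} fock \<Rightarrow> 'i fock" where
  "pderiv_var k P = (\<Sum>\<mu>\<in>Poly_Mapping.keys P.
     Poly_Mapping.single (\<mu> - Poly_Mapping.single k 1)
       (of_nat (Poly_Mapping.lookup \<mu> k) * Poly_Mapping.lookup P \<mu>))"

definition fscale :: "complex \<Rightarrow> 'i::{finite,linorder} fock \<Rightarrow> 'i fock" where
  "fscale a P = fconst a * P"

lemma fconst_hom:
  "fconst (a + b) = (fconst a + fconst b :: 'i::{finite,linorder} fock)"
  "fconst (a * b) = (fconst a * fconst b :: 'i fock)"
  "fconst 1 = (1 :: 'i fock)"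
proof -
  have "const_smooth (a + b) = (const_smooth a + const_smooth b :: 'i smooth_fun)"
    by (rule Rep_smooth_fun_inject[THEN iffD1])
       (auto simp: fun_eq_iff Rep_const_smooth plus_smooth_fun.rep_eq)
  then show "fconst (a + b) = (fconst a + fconst b :: 'i fock)"
    by (simp add: fcoeff_def single_add)
  have "const_smooth (a * b) = (const_smooth a * const_smooth b :: 'i smooth_fun)"
    by (rule Rep_smooth_fun_inject[THEN iffD1])
       (auto simp: fun_eq_iff Rep_const_smooth times_smooth_fun.rep_eq)
  then show "fconst (a * b) = (fconst a * fconst b :: 'i fock)"
    by (simp add: fcoeff_def mult_single)
  have "const_smooth 1 = (1 :: 'i smooth_fun)"
    by (rule Rep_smooth_fun_inject[THEN iffD1])
       (auto simp: fun_eq_iff Rep_const_smooth one_smooth_fun.rep_eq)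
  then show "fconst 1 = (1 :: 'i fock)"
    by (simp add: fcoeff_def)
qed

interpretation fock: vector_space fscale
  by unfold_locales (simp_all add: fscale_def fconst_hom algebra_simps)


section \<open>Formal Laurent series at infinity\<close>

text \<open>
  A series \<open>\<Sum>\<^sub>n a\<^sub>n z\<^sup>n\<close> with finitely many positive powers is the formal Laurent series
  in \<open>1 / z\<close> with coefficients \<open>n \<mapsto> a\<^bsub>-n\<^esub>\<close>.
\<close>

definition zpow :: "int \<Rightarrow> 'a::comm_ring_1 fls" where
  "zpow n = fls_X_intpow (- n)"

definition Res :: "'a::comm_ring_1 fls \<Rightarrow> 'a" where
  "Res g = fls_nth g 1"

definition dz :: "'a::comm_ring_1 fls \<Rightarrow> 'a fls" where
  "dz g = - (zpow (- 2) * fls_deriv g)"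

text \<open>\<open>f_series a = z + \<Sum>\<^sub>k a\<^sub>k z\<^bsup>-1-k\<^esup>\<close>; \<open>k = - 2 - m\<close> gives the exponents \<open>1 + m\<close>, \<open>m \<le> - 2\<close>.\<close>

definition f_series :: "(nat \<Rightarrow> 'a::comm_ring_1) \<Rightarrow> 'a fls" where
  "f_series a = Abs_fls (\<lambda>n. if n = - 1 then 1 else if n \<ge> 1 then a (nat (n - 1)) else 0)"

text \<open>Inverse of a series with leading coefficient \<open>1\<close>.\<close>

definition linv :: "'a::comm_ring_1 fls \<Rightarrow> 'a fls" where
  "linv g = fls_right_inverse g 1"

text \<open>
  \<open>expand_recip j g r\<close> is \<open>1 / (g(z) - r)\<^bsup>1+j\<^esup>\<close> expanded in \<open>|g(z)| > |r|\<close>, for \<open>g(z) = z + \<dots>\<close>.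
  Each coefficient is a finite sum, since the terms with \<open>m \<ge> n\<close> do not contribute to \<open>z\<^bsup>-n\<^esup>\<close>;
  the terms with \<open>m < j\<close> vanish.
\<close>

definition expand_recip :: "nat \<Rightarrow> 'a::comm_ring_1 fls \<Rightarrow> 'a \<Rightarrow> 'a fls" where
  "expand_recip j g r =
     Abs_fls (\<lambda>n. Sum_any (\<lambda>m. of_nat (m choose j) * fls_nth (linv g ^ (1 + m)) n * r ^ (m - j)))"

lemma f_series_nth:
  "fls_nth (f_series a) n = (if n = - 1 then 1 else if n \<ge> 1 then a (nat (n - 1)) else 0)"
  unfolding f_series_def by (rule nth_Abs_fls_lower_bound[of "- 1"]) auto

lemma dz_nth: "fls_nth (dz g) (- n) = of_int (n + 1) * fls_nth g (- (n + 1))"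
  by (simp add: dz_def zpow_def fls_X_intpow_times_conv_shift algebra_simps)

lemma mult_linv:
  assumes "fls_nth g (fls_subdegree g) = 1"
  shows "g * linv g = 1"
  unfolding linv_def by (rule fls_right_inverse) (simp add: assms)

lemma f_series_subdegree: "fls_subdegree (f_series a) = - 1"
  by (rule fls_subdegree_eqI) (auto simp: f_series_nth)

lemma f_series_mult_linv: "f_series a * linv (f_series a) = 1"
  by (rule mult_linv) (simp add: f_series_subdegree f_series_nth)

lemma dz_f_series_mult_linv: "dz (f_series a) * linv (dz (f_series a)) = 1"
proof (rule mult_linv)
  have *: "fls_nth (dz (f_series a)) n = of_int (1 - n) * fls_nth (f_series a) (n - 1)" for n
    using dz_nth[of "f_series a" "- n"] by (simp add: algebra_simps)
  have "fls_subdegree (dz (f_series a)) = 0"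
    by (rule fls_subdegree_eqI) (auto simp: * f_series_nth)
  then show "fls_nth (dz (f_series a)) (fls_subdegree (dz (f_series a))) = 1"
    by (simp add: * f_series_nth)
qed

lemma linv_f_series_power_nth_eq_0:
  assumes "n < int m" shows "fls_nth (linv (f_series a) ^ m) n = 0"
proof -
  have "fls_subdegree (linv (f_series a)) \<ge> 1"
  proof (rule fls_subdegree_geI)
    show "linv (f_series a) \<noteq> 0"
      using f_series_mult_linv[of a] by auto
    show "fls_nth (linv (f_series a)) k = 0" if "k < 1" for k
      using that by (simp add: linv_def f_series_subdegree)
  qed
  then have "int m \<le> int m * fls_subdegree (linv (f_series a))"
    by (simp add: mult_le_cancel_left1)
  then show ?thesis
    using assms fls_pow_nth_below_subdegree[of n m "linv (f_series a)"] by linarith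
qed

lemma expand_recip_nth:
  "fls_nth (expand_recip j (f_series a) r) n =
     (\<Sum>m<nat n. of_nat (m choose j) * fls_nth (linv (f_series a) ^ (1 + m)) n * r ^ (m - j))"
proof -
  have *: "Sum_any (\<lambda>m. of_nat (m choose j) * fls_nth (linv (f_series a) ^ (1 + m)) n * r ^ (m - j)) =
      (\<Sum>m<nat n. of_nat (m choose j) * fls_nth (linv (f_series a) ^ (1 + m)) n * r ^ (m - j))" for n
  proof (rule Sum_any.expand_superset)
    show "{m. of_nat (m choose j) * fls_nth (linv (f_series a) ^ (1 + m)) n * r ^ (m - j) \<noteq> 0}
        \<subseteq> {..<nat n}"
    proof safe
      fix m
      assume "of_nat (m choose j) * fls_nth (linv (f_series a) ^ (1 + m)) n * r ^ (m - j) \<noteq> 0"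
      then have "fls_nth (linv (f_series a) ^ (1 + m)) n \<noteq> 0" by auto
      then have "\<not> n < int (1 + m)" using linv_f_series_power_nth_eq_0 by blast
      then show "m < nat n" by linarith
    qed
  qed simp
  have "fls_nth (expand_recip j (f_series a) r) n =
      Sum_any (\<lambda>m. of_nat (m choose j) * fls_nth (linv (f_series a) ^ (1 + m)) n * r ^ (m - j))"
    unfolding expand_recip_def
    by (rule nth_Abs_fls_lower_bound[of 0]) (simp only: *, simp)
  then show ?thesis by (simp only: *)
qed


section \<open>The operators\<close>

abbreviation f_ser :: "'i::{finite,linorder} fock fls" where
  "f_ser \<equiv> f_series fvar"

text \<open>
  \<open>f(z)\<close> with the coefficients regarded as constant Laurent series in a second variable \<open>u\<close>:
  elements of \<open>'i fock fls fls\<close> are series in \<open>z\<close> whose coefficients are series in \<open>u\<close>.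
\<close>

abbreviation f_ser2 :: "'i::{finite,linorder} fock fls fls" where
  "f_ser2 \<equiv> f_series (\<lambda>k. fls_const (fvar k))"

abbreviation df :: "'i::{finite,linorder} fock fls" where
  "df \<equiv> dz f_ser"

definition schwarzian :: "'i::{finite,linorder} fock fls" where
  "schwarzian = dz (dz df) * linv df - fls_const (fconst (3 / 2)) * (dz df * linv df) ^ 2"

definition boundary_term :: "real \<Rightarrow> 'i \<Rightarrow> 'i::{finite,linorder} fock \<Rightarrow> 'i fock fls" where
  "boundary_term \<delta> i P = df ^ 2 *
     (fls_const (fconst (complex_of_real \<delta>)) * expand_recip 1 f_ser (fcoord i) * fls_const P
      + expand_recip 0 f_ser (fcoord i) * fls_const (pderiv_coord i P))"

text \<open>
  The weights are \<open>\<delta>\<^sub>i = hx i\<close> for \<open>i \<in> X\<close> and \<open>hy i\<close> for \<open>i \<notin> X\<close>. In the sum over \<open>k\<close>, which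
  has finite support for every polynomial \<open>P\<close>, the index is \<open>l = - 2 - k\<close>, so that
  \<open>z\<^bsup>-2-l\<^esup> = z\<^sup>k\<close>.
\<close>

definition stress_tensor ::
  "real \<Rightarrow> 'i set \<Rightarrow> ('i \<Rightarrow> real) \<Rightarrow> ('i \<Rightarrow> real) \<Rightarrow> 'i::{finite,linorder} fock \<Rightarrow> 'i fock fls" where
  "stress_tensor c X hx hy P =
     fls_const (fconst (complex_of_real (c / 12))) * schwarzian * fls_const P
     - Sum_any (\<lambda>k. Res (fls_const (df ^ 2) * zpow (int k) * expand_recip 0 f_ser2 f_ser)
              * fls_const (pderiv_var k P))
     + (\<Sum>i\<in>X. boundary_term (hx i) i P)
     + (\<Sum>i\<in>- X. boundary_term (hy i) i P)"

definition vir_op ::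
  "real \<Rightarrow> 'i set \<Rightarrow> ('i \<Rightarrow> real) \<Rightarrow> ('i \<Rightarrow> real) \<Rightarrow> int \<Rightarrow> 'i::{finite,linorder} fock \<Rightarrow> 'i fock" where
  "vir_op c X hx hy n P = Res (zpow (1 - n) * stress_tensor c X hx hy P)"

definition central_charge :: "real \<Rightarrow> real" where
  "central_charge \<kappa> = (6 - \<kappa>) * (3 * \<kappa> - 8) / (2 * \<kappa>)"

definition h_x :: "('i \<Rightarrow> real) \<Rightarrow> 'i \<Rightarrow> real" where
  "h_x kap i = (6 - kap i) / (2 * kap i)"

definition null_op ::
  "'i set \<Rightarrow> ('i \<Rightarrow> real) \<Rightarrow> ('i \<Rightarrow> real) \<Rightarrow> 'i \<Rightarrow> 'i::{finite,linorder} fock \<Rightarrow> 'i fock" where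
  "null_op X kap hy i P =
     fconst (complex_of_real (kap i / 2)) * pderiv_coord i (pderiv_coord i P)
     + (\<Sum>j\<in>X - {i}. 2 * finv_diff j i * pderiv_coord j P
          + fconst (complex_of_real ((kap j - 6) / kap j)) * finv_diff j i ^ 2 * P)
     + (\<Sum>j\<in>- X. 2 * finv_diff j i * pderiv_coord j P
          - fconst (complex_of_real (2 * hy j)) * finv_diff j i ^ 2 * P)"

definition p_poly :: "nat \<Rightarrow> 'i \<Rightarrow> 'i::{finite,linorder} fock" where
  "p_poly k i = Res (zpow (int k) * expand_recip 0 f_ser (fcoord i))"

definition A_op ::
  "'i set \<Rightarrow> ('i \<Rightarrow> real) \<Rightarrow> ('i \<Rightarrow> real) \<Rightarrow> 'i \<Rightarrow> 'i::{finite,linorder} fock \<Rightarrow> 'i fock" where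
  "A_op X kap hy i P = null_op X kap hy i P + 2 * Sum_any (\<lambda>k. p_poly k i * pderiv_var k P)"


section \<open>Virasoro modules\<close>

text \<open>
  A subspace \<open>V\<close> carrying a representation of the Virasoro algebra in which
  \<open>L\<^sub>n\<close> acts as \<open>L n\<close> and the central element as \<open>c\<close>.
\<close>

definition virasoro_module ::
  "real \<Rightarrow> (int \<Rightarrow> 'i fock \<Rightarrow> 'i fock) \<Rightarrow> 'i::{finite,linorder} fock set \<Rightarrow> bool" where
  "virasoro_module c L V \<longleftrightarrow>
     fock.subspace V \<and>
     (\<forall>n. \<forall>v\<in>V. L n v \<in> V) \<and>
     (\<forall>n. \<forall>v\<in>V. \<forall>w\<in>V. L n (v + w) = L n v + L n w) \<and>
     (\<forall>n a. \<forall>v\<in>V. L n (fscale a v) = fscale a (L n v)) \<and>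
     (\<forall>n m. \<forall>v\<in>V. L n (L m v) - L m (L n v) =
        fscale (of_int (n - m)) (L (n + m) v)
        + (if n + m = 0 then fscale (of_real c / 12 * of_int (n ^ 3 - n)) v else 0))"

definition vir_invariant ::
  "(int \<Rightarrow> 'i fock \<Rightarrow> 'i fock) \<Rightarrow> 'i::{finite,linorder} fock set \<Rightarrow> bool" where
  "vir_invariant L W \<longleftrightarrow> fock.subspace W \<and> (\<forall>n. \<forall>v\<in>W. L n v \<in> W)"

definition virasoro_submodule ::
  "real \<Rightarrow> (int \<Rightarrow> 'i fock \<Rightarrow> 'i fock) \<Rightarrow> 'i::{finite,linorder} fock set \<Rightarrow> bool" where
  "virasoro_submodule c L W \<longleftrightarrow> virasoro_module c L UNIV \<and> vir_invariant L W"

text \<open>\<open>\<U>(vir) v\<close>, the submodule generated by \<open>v\<close>.\<close>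

definition vir_generated ::
  "(int \<Rightarrow> 'i fock \<Rightarrow> 'i fock) \<Rightarrow> 'i::{finite,linorder} fock \<Rightarrow> 'i fock set" where
  "vir_generated L v = vir_invariant L hull {v}"

text \<open>
  \<open>\<U>(vir)\<close> is spanned by the words in the generators, and the central element acts as a scalar.
\<close>

lemma vir_generated_eq_span_words:
  assumes add: "\<And>n v w. L n (v + w) = L n v + L n w"
    and scale: "\<And>n a v. L n (fscale a v) = fscale a (L n v)"
  shows "vir_generated L v = fock.span (range (\<lambda>ns. foldr L ns v))"
  unfolding vir_generated_def
proof (rule hull_unique)
  show "{v} \<subseteq> fock.span (range (\<lambda>ns. foldr L ns v))"
    using fock.span_base[OF rangeI[of "\<lambda>ns. foldr L ns v" "[]"]] by simp
  show "vir_invariant L (fock.span (range (\<lambda>ns. foldr L ns v)))"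
    unfolding vir_invariant_def
  proof (intro conjI allI ballI fock.subspace_span)
    fix n w
    assume "w \<in> fock.span (range (\<lambda>ns. foldr L ns v))"
    then show "L n w \<in> fock.span (range (\<lambda>ns. foldr L ns v))"
    proof (induction rule: fock.span_induct_alt)
      case base
      have "L n 0 = 0" using add[of n 0 0] by simp
      then show ?case by (simp add: fock.span_zero)
    next
      case (step a x y)
      from step(1) obtain ns where "x = foldr L ns v" by blast
      then have "L n x = foldr L (n # ns) v" by simp
      then have "L n x \<in> fock.span (range (\<lambda>ns. foldr L ns v))"
        using fock.span_base[OF rangeI[of "\<lambda>ns. foldr L ns v" "n # ns"]] by simp
      then show ?case
        using step(2) by (simp add: add scale fock.span_add fock.span_scale)
    qed
  qed
  fix W
  assume "{v} \<subseteq> W" and W: "vir_invariant L W"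
  then have "foldr L ns v \<in> W" for ns
    by (induction ns) (auto simp: vir_invariant_def)
  then show "fock.span (range (\<lambda>ns. foldr L ns v)) \<subseteq> W"
    using W by (intro fock.span_minimal) (auto simp: vir_invariant_def)
qed

definition highest_weight_module ::
  "real \<Rightarrow> (int \<Rightarrow> 'i fock \<Rightarrow> 'i fock) \<Rightarrow> 'i::{finite,linorder} fock set \<Rightarrow> 'i fock \<Rightarrow> real \<Rightarrow> bool" where
  "highest_weight_module c L V v h \<longleftrightarrow>
     virasoro_module c L V \<and> V = vir_generated L v \<and>
     (\<forall>n>0. L n v = 0) \<and> L 0 v = fscale (of_real h) v"

text \<open>
  \<open>ordered_word L m e v = L\<^bsub>-m\<^esub>\<^bsup>e(-m)\<^esup> \<dots> L\<^sub>1\<^bsup>e(1)\<^esup> v\<close>, the factor with the largest index acting first.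
\<close>

definition ordered_word ::
  "(int \<Rightarrow> 'i fock \<Rightarrow> 'i fock) \<Rightarrow> int \<Rightarrow> (int \<Rightarrow> nat) \<Rightarrow> 'i::{finite,linorder} fock \<Rightarrow> 'i fock" where
  "ordered_word L m e v = foldr (\<lambda>j. L j ^^ e j) [- m..1] v"

definition fock_of_real_fun :: "(real ^ 'i::{finite,linorder} \<Rightarrow> real) \<Rightarrow> 'i fock" where
  "fock_of_real_fun Z = fcoeff (smooth_fun_of (\<lambda>p. complex_of_real (Z p)))"

end

theory Submission
  imports Defs
begin

text \<open>
  The coordinate and variable derivatives in \<open>L\<^sub>n\<close> form a derivation \<open>V\<^sub>n\<close> with a transparent action
  on the generators: with \<open>v\<^sub>n\<close> the polynomial such that \<open>v\<^sub>n(f) - z\<^bsup>1-n\<^esup> f' = O(1/z)\<close>, one has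
  \<open>V\<^sub>n x\<^sub>i = v\<^sub>n(x\<^sub>i)\<close> and \<open>V\<^sub>n f = v\<^sub>n(f) - z\<^bsup>1-n\<^esup> f'\<close>: \<open>V\<^sub>n\<close> reparametrises f from the right and
  restores its normalisation by a polynomial vector field from the left, which also moves the points.
  Moreover \<open>L\<^sub>n = V\<^sub>n + c/12 Res (z\<^bsup>1-n\<^esup> Sf) + \<Sum>\<^sub>i \<delta>\<^sub>i v\<^sub>n'(x\<^sub>i)\<close>. Since a polynomial p with \<open>p(f) = O(1/z)\<close>
  vanishes, comparing polynomial parts gives \<open>[V\<^sub>n, V\<^sub>m] = (n - m) V\<^bsub>n+m\<^esub>\<close>, and the transformation law
  of the Schwarzian derivative yields the central term.

  Likewise the first order part of \<open>A\<^sub>I\<close> is the Loewner vector field, which moves f by \<open>2/(f - x\<^sub>I)\<close>, and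
  comparing polynomial parts once more gives \<open>[A\<^sub>I, L\<^sub>n] = 2 v\<^sub>n'(x\<^sub>I) A\<^sub>I\<close>; here the values of \<open>h\<^sub>x\<close> and
  of the central charge cancel the terms with \<open>v\<^sub>n''(x\<^sub>I)\<close> and \<open>v\<^sub>n'''(x\<^sub>I)\<close>. Hence the common kernel is
  invariant. The statements about \<open>L\<^sub>n Z\<close> for \<open>n \<ge> 0\<close> follow from \<open>v\<^sub>1 = 1\<close>, \<open>v\<^sub>0 = x\<close> and \<open>v\<^sub>n = 0\<close> for
  \<open>n \<ge> 2\<close>, and words are sorted with the commutation relations.
\<close>

section \<open>Derivations\<close>

text \<open>Two features of the coefficient ring shape the proof. It has zero divisors and few
  inverses, so series are controlled by bounds on their exponents, polynomial parts are unique
  because f is monic, and rational constants are avoided by clearing denominators and cancelling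
  integers at the end. Moreover the coordinates do not generate the smooth functions algebraically,
  so comparing derivations on generators requires their values on every smooth function; vector
  fields therefore keep explicit coefficients, and their brackets use the symmetry of second
  derivatives. The residues are Cauchy integrals in the coordinate w = f(z): Res (p(f) f') = 0 and
  Res (p(f) f'/(f - x)) = p(x). Replacing z^(1-n) f' by v_n(f), up to a term O(1/z), turns the
  boundary terms of L_n into values of v_n and v_n'. The constants are forced: the v'' terms of the
  commutator with A_I cancel for h = (6 - kap)/(2 kap), and then the v''' terms cancel for c = h (3
  kap - 8).\<close>

definition derivation :: "('a::comm_ring_1 \<Rightarrow> 'a) \<Rightarrow> bool" where
  "derivation d \<longleftrightarrow> (\<forall>x y. d (x + y) = d x + d y) \<and> (\<forall>x y. d (x * y) = d x * y + x * d y)"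

lemma derivationI:
  "(\<And>x y. d (x + y) = d x + d y) \<Longrightarrow> (\<And>x y. d (x * y) = d x * y + x * d y) \<Longrightarrow> derivation d"
  by (simp add: derivation_def)

context
  fixes d :: "'a::comm_ring_1 \<Rightarrow> 'a"
  assumes d: "derivation d"
begin

lemma derivation_add: "d (x + y) = d x + d y"
  using d by (simp add: derivation_def)

lemma derivation_mult: "d (x * y) = d x * y + x * d y"
  using d by (simp add: derivation_def)

lemma derivation_0: "d 0 = 0"
  using derivation_add[of 0 0] by simp

lemma derivation_1: "d 1 = 0"
  using derivation_mult[of 1 1] by simp

lemma derivation_minus: "d (- x) = - d x"
  using derivation_add[of x "- x"] by (simp add: derivation_0 eq_neg_iff_add_eq_0 add.commute)

lemma derivation_diff: "d (x - y) = d x - d y"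
  using derivation_add[of x "- y"] by (simp add: derivation_minus)

lemma derivation_sum: "d (sum g I) = (\<Sum>i\<in>I. d (g i))"
  by (induction I rule: infinite_finite_induct) (simp_all add: derivation_0 derivation_add)

lemma derivation_of_nat: "d (of_nat n) = 0"
  by (induction n) (simp_all add: derivation_0 derivation_1 derivation_add)

lemma derivation_numeral: "d (numeral n) = 0"
  using derivation_of_nat[of "numeral n"] by simp

lemma derivation_of_int: "d (of_int n) = 0"
  by (cases n) (simp_all add: derivation_of_nat derivation_diff derivation_minus derivation_1)

lemma derivation_power: "d (x ^ n) = of_nat n * x ^ (n - 1) * d x"
proof (induction n)
  case (Suc n)
  then show ?case
    by (cases n) (simp_all add: derivation_mult algebra_simps)
qed (simp add: derivation_1)

text \<open>Differentiate x y = 1 and multiply by y. The inverse enters through a relation because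
  the rings in question are not fields; \<open>linv\<close> and \<open>finv_diff\<close> are the
  instances.\<close>

lemma derivation_inverse:
  assumes "x * y = 1"
  shows "d y = - (y ^ 2) * d x"
proof -
  have "y * (d x * y + x * d y) = 0"
    using derivation_mult[of x y] by (simp add: assms derivation_1)
  then have "y * d x * y + (x * y) * d y = 0"
    by (simp only: algebra_simps)
  then show ?thesis
    by (simp add: assms power2_eq_square eq_neg_iff_add_eq_0 algebra_simps)
qed

end

lemma derivation_commutator:
  assumes "derivation d" "derivation e"
  shows "derivation (\<lambda>x. d (e x) - e (d x))"
  using assms by (intro derivationI) (simp_all add: derivation_add derivation_mult algebra_simps)

lemma derivation_diff_fun:
  assumes "derivation d" "derivation e"
  shows "derivation (\<lambda>x. d x - e x)"
  using assms by (intro derivationI) (simp_all add: derivation_add derivation_mult algebra_simps)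

section \<open>Polynomials over a commutative ring\<close>

text \<open>\<^const>\<open>pderiv\<close> is only available without zero divisors, which \<open>C\<^sup>\<infinity>(S)\<close> has.\<close>

definition pder :: "'a::comm_ring_1 poly \<Rightarrow> 'a poly" where
  "pder p = Poly (map (\<lambda>i. of_nat (Suc i) * coeff p (Suc i)) [0..<degree p])"

lemma coeff_pder: "coeff (pder p) n = of_nat (Suc n) * coeff p (Suc n)"
proof (cases "n < degree p")
  case False
  then show ?thesis
    by (simp add: pder_def nth_default_def coeff_eq_0 del: of_nat_Suc)
qed (simp add: pder_def nth_default_def)

lemma pder_0 [simp]: "pder 0 = 0"
  by (simp add: poly_eq_iff coeff_pder)

lemma pder_pCons: "pder (pCons a p) = p + pCons 0 (pder p)"
  by (rule poly_eqI) (simp add: coeff_pder coeff_pCons algebra_simps split: nat.split)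

lemma pder_add: "pder (p + q) = pder p + pder q"
  by (rule poly_eqI) (simp add: coeff_pder algebra_simps)

lemma pder_smult: "pder (smult c p) = smult c (pder p)"
  by (rule poly_eqI) (simp add: coeff_pder algebra_simps)

lemma pder_mult: "pder (p * q) = pder p * q + p * pder q"
  by (induction p) (simp_all add: pder_pCons pder_add pder_smult algebra_simps)

lemma derivation_pder: "derivation pder"
  by (intro derivationI pder_add pder_mult)

text \<open>Chain rule for a polynomial whose coefficients also vary: \<open>map_poly d\<close> acts
  on them, \<open>pder\<close> accounts for the argument.\<close>

lemma derivation_poly:
  assumes "derivation d"
  shows "d (poly p x) = poly (map_poly d p) x + poly (pder p) x * d x"
proof (induction p)
  case (pCons a p)
  then show ?case
    using assms
    by (simp add: map_poly_pCons derivation_0 derivation_add derivation_mult pder_pCons algebra_simps)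
qed (simp add: derivation_0[OF assms])


section \<open>Formal Laurent series at infinity\<close>

text \<open>Series are in 1/z, so this is the estimate O(z^(-n)). A bound is stable under sums and
  products, whereas \<open>fls_subdegree\<close> jumps under cancellation and with zero
  divisors.\<close>

definition vanishes_below :: "int \<Rightarrow> 'a::zero fls \<Rightarrow> bool" where
  "vanishes_below n g \<longleftrightarrow> (\<forall>k<n. fls_nth g k = 0)"

lemma vanishes_belowD: "vanishes_below n g \<Longrightarrow> k < n \<Longrightarrow> fls_nth g k = 0"
  by (simp add: vanishes_below_def)

lemma vanishes_below_mono: "vanishes_below n g \<Longrightarrow> m \<le> n \<Longrightarrow> vanishes_below m g"
  by (auto simp: vanishes_below_def)

lemma vanishes_below_subdegree: "vanishes_below (fls_subdegree g) g"
  by (simp add: vanishes_below_def)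

lemma vanishes_below_0 [simp]: "vanishes_below n 0"
  by (simp add: vanishes_below_def)

lemma vanishes_below_const [simp]: "n \<le> 0 \<Longrightarrow> vanishes_below n (fls_const c)"
  by (simp add: vanishes_below_def)

lemma vanishes_below_1 [simp]: "n \<le> 0 \<Longrightarrow> vanishes_below n (1 :: 'a::zero_neq_one fls)"
  by (auto simp: vanishes_below_def)

lemma vanishes_below_add:
  fixes g :: "'a::comm_ring_1 fls"
  shows "vanishes_below n g \<Longrightarrow> vanishes_below n h \<Longrightarrow> vanishes_below n (g + h)"
  by (simp add: vanishes_below_def)

lemma vanishes_below_diff:
  fixes g :: "'a::comm_ring_1 fls"
  shows "vanishes_below n g \<Longrightarrow> vanishes_below n h \<Longrightarrow> vanishes_below n (g - h)"
  by (simp add: vanishes_below_def)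

lemma vanishes_below_minus:
  fixes g :: "'a::comm_ring_1 fls"
  shows "vanishes_below n g \<Longrightarrow> vanishes_below n (- g)"
  by (simp add: vanishes_below_def)

text \<open>The convolution may be cut at any valid lower bounds, not only at the subdegrees,
  because all extra terms are 0. Both ranges are compared with the common range
  \<open>T\<close>.\<close>

lemma fls_times_nth_vanishes:
  fixes g h :: "'a::comm_ring_1 fls"
  assumes "vanishes_below m g" "vanishes_below n h"
  shows "fls_nth (g * h) k = (\<Sum>i = m..k - n. fls_nth g i * fls_nth h (k - i))"
proof -
  define T where "T = {min m (fls_subdegree g)..max (k - n) (k - fls_subdegree h)}"
  have zero: "fls_nth g i * fls_nth h (k - i) = 0"
    if "i < m \<or> i < fls_subdegree g \<or> k - n < i \<or> k - fls_subdegree h < i" for i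
    using assms that by (auto simp: vanishes_below_def)
  have "fls_nth (g * h) k = (\<Sum>i = fls_subdegree g..k - fls_subdegree h. fls_nth g i * fls_nth h (k - i))"
    by (rule fls_times_nth(2))
  also have "\<dots> = (\<Sum>i\<in>T. fls_nth g i * fls_nth h (k - i))"
    by (rule sum.mono_neutral_left) (use zero in \<open>auto simp: T_def\<close>)
  also have "\<dots> = (\<Sum>i = m..k - n. fls_nth g i * fls_nth h (k - i))"
    by (rule sum.mono_neutral_right) (use zero in \<open>auto simp: T_def\<close>)
  finally show ?thesis .
qed

lemma vanishes_below_mult:
  fixes g h :: "'a::comm_ring_1 fls"
  assumes "vanishes_below m g" "vanishes_below n h"
  shows "vanishes_below (m + n) (g * h)"
  unfolding vanishes_below_def by (simp add: fls_times_nth_vanishes[OF assms])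

lemma vanishes_below_mult':
  fixes g h :: "'a::comm_ring_1 fls"
  assumes "vanishes_below m g" "vanishes_below n h" "k \<le> m + n"
  shows "vanishes_below k (g * h)"
  using vanishes_below_mono[OF vanishes_below_mult[OF assms(1,2)] assms(3)] .

lemma fls_mult_leading:
  fixes g h :: "'a::comm_ring_1 fls"
  assumes "vanishes_below m g" "vanishes_below n h"
  shows "fls_nth (g * h) (m + n) = fls_nth g m * fls_nth h n"
  by (simp add: fls_times_nth_vanishes[OF assms])

lemma vanishes_below_power:
  fixes g :: "'a::comm_ring_1 fls"
  assumes "vanishes_below m g"
  shows "vanishes_below (int k * m) (g ^ k) \<and> fls_nth (g ^ k) (int k * m) = fls_nth g m ^ k"
proof (induction k)
  case (Suc k)
  have "int (Suc k) * m = m + int k * m"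
    by (simp add: algebra_simps)
  with Suc assms show ?case
    using vanishes_below_mult[OF assms, of "int k * m" "g ^ k"]
      fls_mult_leading[OF assms, of "int k * m" "g ^ k"]
    by simp
qed auto

section \<open>Powers of z, the derivative d/dz and residues\<close>

lemma zpow_mult_nth: "fls_nth (zpow n * g) k = fls_nth g (k + n)"
  unfolding zpow_def fls_X_intpow_times_conv_shift(1) by simp

lemma zpow_add: "zpow (m + n) = (zpow m * zpow n :: 'a::comm_ring_1 fls)"
  using fls_X_intpow_times_fls_X_intpow[of "- m" "- n", where ?'a = 'a] by (simp add: zpow_def)

lemma zpow_nth: "fls_nth (zpow n :: 'a::comm_ring_1 fls) k = (if k = - n then 1 else 0)"
  using zpow_mult_nth[of n "1 :: 'a fls" k] by (simp add: eq_neg_iff_add_eq_0)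

lemma zpow_0 [simp]: "zpow 0 = 1"
  by (simp add: zpow_def)

lemma vanishes_below_zpow: "k \<le> - n \<Longrightarrow> vanishes_below k (zpow n :: 'a::comm_ring_1 fls)"
  by (simp add: vanishes_below_def zpow_nth)

lemma derivation_dz: "derivation (dz :: 'a::comm_ring_1 fls \<Rightarrow> 'a fls)"
  by (intro derivationI) (simp_all add: dz_def algebra_simps)

lemmas dz_simps = derivation_add[OF derivation_dz] derivation_diff[OF derivation_dz]
  derivation_minus[OF derivation_dz] derivation_mult[OF derivation_dz] derivation_0[OF derivation_dz]
  derivation_1[OF derivation_dz]

lemma dz_const [simp]: "dz (fls_const c) = 0"
  by (simp add: dz_def)

lemma dz_nth': "fls_nth (dz g) n = of_int (1 - n) * fls_nth g (n - 1)"
  using dz_nth[of g "- n"] by (simp add: algebra_simps)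

lemma vanishes_below_dz: "vanishes_below n g \<Longrightarrow> vanishes_below (n + 1) (dz g)"
  by (simp add: vanishes_below_def dz_nth')

lemma dz_zpow: "dz (zpow n :: 'a::comm_ring_1 fls) = of_int n * zpow (n - 1)"
  by (rule fls_eqI) (simp add: dz_nth' zpow_nth)

lemma Res_add: "Res (g + h) = Res g + Res h"
  and Res_diff: "Res (g - h) = Res g - Res h"
  and Res_minus: "Res (- g) = - Res g"
  and Res_0 [simp]: "Res 0 = 0"
  and Res_const_mult: "Res (fls_const c * g) = c * Res g"
  and Res_mult_const: "Res (g * fls_const c) = Res g * c"
  by (simp_all add: Res_def)

lemma Res_sum: "Res (sum g I) = (\<Sum>i\<in>I. Res (g i))"
  by (simp add: Res_def fls_nth_sum)

lemma Res_of_nat_mult: "Res (of_nat n * g) = of_nat n * Res g"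
  by (simp add: Res_def)

lemma Res_dz: "Res (dz g) = 0"
  by (simp add: Res_def dz_nth')

lemma Res_vanishes: "vanishes_below 2 g \<Longrightarrow> Res g = 0"
  by (simp add: vanishes_below_def Res_def)

lemma Res_by_parts: "Res (dz g * h) = - Res (g * dz h)"
  using Res_dz[of "g * h"] by (simp add: dz_simps Res_add eq_neg_iff_add_eq_0)

lemma linv_leading:
  assumes "vanishes_below n g" "fls_nth g n = 1"
  shows "g * linv g = 1" "vanishes_below (- n) (linv g)" "fls_nth (linv g) (- n) = 1"
proof -
  have sub: "fls_subdegree g = n"
    by (rule fls_subdegree_eqI) (use assms in \<open>auto simp: vanishes_below_def\<close>)
  show 1: "g * linv g = 1"
    by (rule mult_linv) (simp add: sub assms)
  show 2: "vanishes_below (- n) (linv g)"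
    by (simp add: vanishes_below_def linv_def sub)
  show "fls_nth (linv g) (- n) = 1"
    using fls_mult_leading[OF assms(1) 2] by (simp add: 1 assms)
qed

lemma inverse_unique_comm:
  fixes x :: "'a::comm_ring_1"
  assumes "x * y = 1" "x * y' = 1"
  shows "y = y'"
  by (metis assms mult.commute mult.left_commute mult.right_neutral)

text \<open>Serves two purposes: with a derivation it varies the coefficients while z stays fixed,
  and with \<open>fls_const\<close> it embeds series in z into series over a second
  variable.\<close>

definition fls_map :: "('a::zero \<Rightarrow> 'b::zero) \<Rightarrow> 'a fls \<Rightarrow> 'b fls" where
  "fls_map d g = Abs_fls (\<lambda>n. d (fls_nth g n))"

lemma fls_map_nth:
  assumes "d 0 = 0"
  shows "fls_nth (fls_map d g) n = d (fls_nth g n)"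
  unfolding fls_map_def
  by (rule nth_Abs_fls_lower_bound[of "fls_subdegree g"]) (simp add: assms)

lemma vanishes_below_fls_map:
  "d 0 = 0 \<Longrightarrow> vanishes_below n g \<Longrightarrow> vanishes_below n (fls_map d g)"
  by (simp add: vanishes_below_def fls_map_nth)

lemma derivation_fls_map:
  assumes d: "derivation d"
  shows "derivation (fls_map d)"
proof (rule derivationI)
  note nth = fls_map_nth[of d, OF derivation_0[OF d]]
  note van = vanishes_below_fls_map[of d, OF derivation_0[OF d]]
  show "fls_map d (g + h) = fls_map d g + fls_map d h" for g h
    by (rule fls_eqI) (simp add: nth derivation_add[OF d])
  show "fls_map d (g * h) = fls_map d g * h + g * fls_map d h" for g h
  proof (rule fls_eqI)
    fix k
    show "fls_nth (fls_map d (g * h)) k = fls_nth (fls_map d g * h + g * fls_map d h) k"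
      using vanishes_below_subdegree[of g] vanishes_below_subdegree[of h]
      by (simp add: nth van fls_times_nth_vanishes[of "fls_subdegree g" _ "fls_subdegree h"]
          derivation_sum[OF d] derivation_mult[OF d] sum.distrib)
  qed
qed

lemma fls_map_const: "d 0 = 0 \<Longrightarrow> fls_map d (fls_const a) = fls_const (d a)"
  by (rule fls_eqI) (simp add: fls_map_nth)

lemma fls_map_dz: "derivation d \<Longrightarrow> fls_map d (dz g) = dz (fls_map d g)"
  by (rule fls_eqI)
     (simp add: fls_map_nth derivation_0 dz_nth' derivation_mult derivation_diff derivation_1 derivation_of_int)

lemma fls_map_zpow: "derivation d \<Longrightarrow> fls_map d (zpow n) = 0"
  by (rule fls_eqI) (simp add: fls_map_nth derivation_0 derivation_1 zpow_nth)

lemma Res_fls_map: "derivation d \<Longrightarrow> Res (fls_map d g) = d (Res g)"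
  by (simp add: Res_def fls_map_nth derivation_0)

lemma fls_map_const_mult:
  fixes g h :: "'a::comm_ring_1 fls"
  shows "fls_map fls_const (g * h) = fls_map fls_const g * fls_map fls_const h"
proof (rule fls_eqI)
  fix k
  have sum: "fls_const (sum u I) = (\<Sum>i\<in>I. fls_const (u i))" for u :: "int \<Rightarrow> 'a" and I
    by (induction I rule: infinite_finite_induct) (simp_all flip: fls_plus_const)
  show "fls_nth (fls_map fls_const (g * h)) k = fls_nth (fls_map fls_const g * fls_map fls_const h) k"
    using vanishes_below_subdegree[of g] vanishes_below_subdegree[of h]
    by (simp add: fls_map_nth vanishes_below_fls_map sum
        fls_times_nth_vanishes[of "fls_subdegree g" _ "fls_subdegree h"])
qed

lemma fls_map_const_power:
  "fls_map fls_const (g ^ n) = fls_map fls_const (g :: 'a::comm_ring_1 fls) ^ n"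
  by (induction n) (simp_all add: fls_map_const_mult fls_map_const flip: fls_const_1)

definition peval :: "'a::comm_ring_1 poly \<Rightarrow> 'a fls \<Rightarrow> 'a fls" where
  "peval p g = poly (map_poly fls_const p) g"

lemma peval_0 [simp]: "peval 0 g = 0"
  by (simp add: peval_def)

lemma peval_pCons [simp]: "peval (pCons a p) g = fls_const a + g * peval p g"
  by (simp add: peval_def map_poly_pCons)

lemma peval_add: "peval (p + q) g = peval p g + peval q g"
  by (induction p q rule: poly_induct2) (simp_all add: algebra_simps flip: fls_plus_const)

lemma peval_smult: "peval (smult c p) g = fls_const c * peval p g"
  by (induction p) (simp_all add: algebra_simps flip: fls_const_mult_const)

lemma peval_minus: "peval (- p) g = - peval p g"
  using peval_smult[of "- 1" p g] by (simp del: fls_const_uminus add: fls_const_uminus[of "1::'a"])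

lemma peval_diff: "peval (p - q) g = peval p g - peval q g"
  using peval_add[of p "- q" g] by (simp add: peval_minus)

lemma peval_mult: "peval (p * q) g = peval p g * peval q g"
  by (induction p) (simp_all add: peval_add peval_smult algebra_simps)

lemma peval_monom: "peval (monom c n) g = fls_const c * g ^ n"
  by (induction n) (simp_all add: monom_Suc monom_0 mult_ac)

lemma dz_peval: "dz (peval p g) = peval (pder p) g * dz g"
  by (induction p) (simp_all add: dz_simps pder_pCons peval_add algebra_simps)

lemma fls_map_peval:
  assumes d: "derivation d"
  shows "fls_map d (peval p g) = peval (map_poly d p) g + peval (pder p) g * fls_map d g"
proof (induction p)
  case (pCons a p)
  then show ?case
    by (simp add: map_poly_pCons derivation_0[OF d] derivation_add[OF derivation_fls_map[OF d]]
        derivation_mult[OF derivation_fls_map[OF d]] fls_map_const pder_pCons peval_add algebra_simps)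
qed (simp add: derivation_0[OF derivation_fls_map[OF d]])

section \<open>Expansion in powers of f\<close>

text \<open>\<open>torsion_free\<close> is the form in which characteristic 0 is used: residue and
  Taylor arguments yield identities multiplied by an integer, which is then cancelled.\<close>

locale formal_map =
  fixes a :: "nat \<Rightarrow> 'a::comm_ring_1"
  assumes torsion_free: "of_nat (Suc n) * x = 0 \<Longrightarrow> x = (0::'a)"
begin

abbreviation f :: "'a fls" where "f \<equiv> f_series a"
abbreviation f1 :: "'a fls" where "f1 \<equiv> dz f"
abbreviation g1 :: "'a fls" where "g1 \<equiv> linv f1"
abbreviation recip :: "'a \<Rightarrow> 'a fls" where "recip x \<equiv> linv (f - fls_const x)"

lemma f_leading: "vanishes_below (- 1) f" "fls_nth f (- 1) = 1"
  by (simp_all add: vanishes_below_def f_series_nth)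

lemma f1_leading: "vanishes_below 0 f1" "fls_nth f1 0 = 1"
  by (auto simp: vanishes_below_def f_series_nth dz_nth')

lemma f1_minus_1: "vanishes_below 2 (f1 - 1)"
  by (auto simp: vanishes_below_def f_series_nth dz_nth')

lemma f2_vanishes: "vanishes_below 3 (dz f1)"
  using vanishes_below_dz[OF f1_minus_1] by (simp add: dz_simps)

lemma g1_leading: "f1 * g1 = 1" "vanishes_below 0 g1" "fls_nth g1 0 = 1"
  using linv_leading[OF f1_leading] by simp_all

lemma linv_f_leading: "f * linv f = 1" "vanishes_below 1 (linv f)" "fls_nth (linv f) 1 = 1"
  using linv_leading[OF f_leading] by simp_all

lemma recip_leading:
  "(f - fls_const x) * recip x = 1" "vanishes_below 1 (recip x)" "fls_nth (recip x) 1 = 1"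
  using linv_leading[of "- 1" "f - fls_const x"] f_leading
  by (simp_all add: vanishes_below_diff)

lemma f_power_leading: "vanishes_below (- int k) (f ^ k)" "fls_nth (f ^ k) (- int k) = 1"
  using vanishes_below_power[OF f_leading(1), of k] f_leading(2) by simp_all

lemma linv_f_power_leading:
  "vanishes_below (int k) (linv f ^ k)" "fls_nth (linv f ^ k) (int k) = 1"
  using vanishes_below_power[OF linv_f_leading(2), of k] linv_f_leading(3) by simp_all

text \<open>Since f = z + ... is monic, the top coefficient of p survives in p(f) even in a ring
  with zero divisors. Uniqueness of polynomial parts rests on this.\<close>

lemma peval_leading:
  "vanishes_below (- int (degree p)) (peval p f) \<and> fls_nth (peval p f) (- int (degree p)) = lead_coeff p"
proof (induction p)
  case (pCons b p)
  show ?case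
  proof (cases "p = 0")
    case False
    have "- int (degree (pCons b p)) = - 1 + - int (degree p)"
      using False by simp
    then show ?thesis
      using False pCons.IH vanishes_below_mult[OF f_leading(1), of "- int (degree p)" "peval p f"]
        fls_mult_leading[OF f_leading(1), of "- int (degree p)" "peval p f"]
      by (simp add: vanishes_below_add f_leading)
  qed simp
qed simp

lemma degree_le_if_vanishes_below:
  assumes "vanishes_below (- int d) (peval p f)"
  shows "degree p \<le> d"
proof (rule ccontr)
  assume *: "\<not> degree p \<le> d"
  then have "fls_nth (peval p f) (- int (degree p)) = 0"
    using assms by (intro vanishes_belowD) auto
  then show False
    using * peval_leading[of p] by auto
qed

lemma poly_eq_0_if_vanishes_below:
  assumes "vanishes_below 1 (peval p f)"
  shows "p = 0"
proof -
  have "fls_nth (peval p f) (- int (degree p)) = 0"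
    using assms by (intro vanishes_belowD) auto
  then show ?thesis
    using peval_leading[of p] by auto
qed

text \<open>Each f^N is monic of degree N in z, so a multiple of it removes the top power of g; the
  induction is on a strict bound \<open>N\<close> for the degree of g.\<close>

lemma ex_poly_part: "\<exists>p. vanishes_below 1 (peval p f - g)"
proof -
  have "\<exists>p. vanishes_below 1 (peval p f - g)" if "vanishes_below (1 - int N) g" for N
    using that
  proof (induction N arbitrary: g)
    case 0
    then show ?case
      by (intro exI[of _ 0]) (simp add: vanishes_below_minus)
  next
    case (Suc N)
    define c where "c = fls_nth g (- int N)"
    let ?m = "peval (monom c N) f"
    have "vanishes_below (- int N) (g - ?m)"
      using Suc.prems f_power_leading(1)[of N] vanishes_below_mult'[of 0 "fls_const c" "- int N" "f ^ N"]
      by (intro vanishes_below_diff) (simp_all add: peval_monom)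
    moreover have "fls_nth (g - ?m) (- int N) = 0"
      by (simp add: peval_monom f_power_leading c_def)
    ultimately have "vanishes_below (1 - int N) (g - ?m)"
      unfolding vanishes_below_def by (metis linorder_cases zless_add1_eq add.commute diff_conv_add_uminus)
    then obtain p where "vanishes_below 1 (peval p f - (g - ?m))"
      using Suc.IH by blast
    then show ?case
      by (intro exI[of _ "p + monom c N"]) (simp add: peval_add algebra_simps)
  qed
  moreover have "vanishes_below (1 - int (nat (1 - fls_subdegree g))) g"
    by (rule vanishes_below_mono[OF vanishes_below_subdegree]) simp
  ultimately show ?thesis by blast
qed

definition poly_part :: "'a fls \<Rightarrow> 'a poly" where
  "poly_part g = (SOME p. vanishes_below 1 (peval p f - g))"

text \<open>The sign makes the tail of z^(1-n) f' the variation of f under V_n, not its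
  negative.\<close>

definition tail :: "'a fls \<Rightarrow> 'a fls" where
  "tail g = peval (poly_part g) f - g"

lemma tail_vanishes: "vanishes_below 1 (tail g)"
  using someI_ex[OF ex_poly_part[of g]] by (simp add: tail_def poly_part_def)

lemma poly_part_eqI:
  assumes "vanishes_below 1 (peval p f - g)"
  shows "poly_part g = p"
proof -
  have "vanishes_below 1 (tail g - (peval p f - g))"
    by (intro vanishes_below_diff tail_vanishes assms)
  then have "vanishes_below 1 (peval (poly_part g - p) f)"
    by (simp add: tail_def peval_diff)
  then show ?thesis
    using poly_eq_0_if_vanishes_below by fastforce
qed

text \<open>(k+1) f^k f' is the derivative of f^(k+1), hence has no residue. The exponent k is left
  free because the induction moves factors f from p to the power.\<close>

lemma Res_peval_power: "Res (peval p f * f ^ k * f1) = 0"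
proof (induction p arbitrary: k)
  case (pCons b p)
  have "of_nat (Suc k) * (f ^ k * f1) = dz (f ^ Suc k)"
    by (subst derivation_power[OF derivation_dz]) (simp add: mult.assoc)
  then have "of_nat (Suc k) * Res (f ^ k * f1) = 0"
    by (metis Res_dz Res_of_nat_mult)
  then have "Res (f ^ k * f1) = 0"
    by (rule torsion_free)
  moreover have "Res (peval p f * f ^ Suc k * f1) = 0"
    by (rule pCons.IH)
  moreover have "peval (pCons b p) f * f ^ k * f1 = fls_const b * (f ^ k * f1) + peval p f * f ^ Suc k * f1"
    by (simp add: algebra_simps)
  ultimately show ?case
    by (simp add: Res_add Res_const_mult)
qed simp

lemma Res_peval: "Res (peval p f * f1) = 0"
  using Res_peval_power[of p 0] by simp

text \<open>Cauchy's formula in the coordinate f: divide p by w - x. The quotient gives a polynomial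
  in f times f', without residue, and the remainder p(x) multiplies Res (f'/(f - x)) = 1.\<close>

lemma Res_peval_recip: "Res (peval p f * f1 * recip x) = poly p x"
proof -
  define q where "q = synthetic_div p x"
  have "peval p f = peval ([:- x, 1:] * q + [:poly p x:]) f"
    unfolding q_def by (simp only: synthetic_div_correct')
  then have "peval p f = (f - fls_const x) * peval q f + fls_const (poly p x)"
    by (simp only: peval_add peval_mult peval_pCons peval_0) simp
  then have "peval p f * f1 * recip x =
      peval q f * f1 * ((f - fls_const x) * recip x) + fls_const (poly p x) * (f1 * recip x)"
    by (simp only:) (simp add: algebra_simps)
  moreover have "Res (f1 * recip x) = 1"
    using fls_mult_leading[OF f1_leading(1) recip_leading(2)[of x]]
    by (simp add: Res_def f1_leading recip_leading)
  ultimately show ?thesis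
    by (simp add: recip_leading Res_add Res_const_mult Res_peval)
qed

lemma derivation_recip:
  assumes "derivation d"
  shows "d (recip x) = - (recip x ^ 2) * (d f - d (fls_const x))"
  using derivation_inverse[OF assms recip_leading(1)] by (simp add: derivation_diff[OF assms])

text \<open>Integration by parts; iterated, it is Cauchy's formula for derivatives with the
  factorials left undivided.\<close>

lemma Res_peval_recip_power:
  "of_nat (Suc j) * Res (peval p f * f1 * recip x ^ (j + 2)) = Res (peval (pder p) f * f1 * recip x ^ Suc j)"
proof -
  have "of_nat (Suc j) * (peval p f * f1 * recip x ^ (j + 2)) = - (peval p f * dz (recip x ^ Suc j))"
    by (subst derivation_power[OF derivation_dz])
       (simp add: derivation_recip[OF derivation_dz] power2_eq_square mult_ac)
  then have "of_nat (Suc j) * Res (peval p f * f1 * recip x ^ (j + 2)) = - Res (peval p f * dz (recip x ^ Suc j))"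
    by (metis Res_minus Res_of_nat_mult)
  also have "\<dots> = Res (dz (peval p f) * recip x ^ Suc j)"
    by (simp only: Res_by_parts)
  finally show ?thesis
    by (simp add: dz_peval)
qed

lemma Res_peval_recip2: "Res (peval p f * f1 * recip x ^ 2) = poly (pder p) x"
  using Res_peval_recip_power[of 0 p x] by (simp add: Res_peval_recip power2_eq_square)

text \<open>Duality of the powers f^(-1-m) and f^j. For m < j the integrand is a polynomial in f
  times f', for m = j it is f'/f, and for m > j it is O(z^(-2)).\<close>

lemma Res_linv_f_power:
  "Res (linv f ^ Suc m * f ^ j * f1) = (if m = j then 1 else 0)"
proof -
  have cancel: "linv f ^ k * f ^ k = 1" for k
    by (metis linv_f_leading(1) mult.commute power_mult_distrib power_one)
  consider "m < j" | "m = j" | "j < m" by linarith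
  then show ?thesis
  proof cases
    case 1
    then have "f ^ j = f ^ Suc m * f ^ (j - Suc m)"
      by (metis Suc_leI add_diff_inverse_nat less_Suc_eq_le not_less power_add)
    then have "linv f ^ Suc m * f ^ j * f1 = peval 1 f * f ^ (j - Suc m) * f1"
      using cancel[of "Suc m"] by (simp add: peval_def flip: mult.assoc)
    then show ?thesis
      using 1 Res_peval_power[of 1 "j - Suc m"] by simp
  next
    case 2
    then have "linv f ^ Suc m * f ^ j * f1 = linv f * f1"
      using cancel[of m] by (simp add: mult_ac)
    then show ?thesis
      using 2 fls_mult_leading[OF linv_f_leading(2) f1_leading(1)]
      by (simp add: Res_def linv_f_leading f1_leading)
  next
    case 3
    then have "linv f ^ Suc m = linv f ^ (Suc m - j) * linv f ^ j"
      by (metis le_add_diff_inverse2 less_imp_le_nat less_SucI power_add)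
    then have "linv f ^ Suc m * f ^ j * f1 = linv f ^ (Suc m - j) * (linv f ^ j * f ^ j) * f1"
      by (simp only: mult_ac)
    then have *: "linv f ^ Suc m * f ^ j * f1 = linv f ^ (Suc m - j) * f1"
      by (simp only: cancel mult_1_right)
    have "vanishes_below 2 (linv f ^ (Suc m - j) * f1)"
      using 3 by (intro vanishes_below_mult'[OF linv_f_power_leading(1) f1_leading(1)]) auto
    then show ?thesis
      using 3 * by (simp add: Res_vanishes)
  qed
qed

text \<open>The expansion \<open>r = \<Sum>\<^sub>m Res (r f' f\<^sup>m) f\<^bsup>-1-m\<^esup>\<close>, in which only \<open>m \<le> k\<close> contributes to \<open>z\<^bsup>-1-k\<^esup>\<close>.\<close>

lemma nth_eq_sum_linv_f_power:
  assumes "vanishes_below 1 r"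
  shows "fls_nth r (int k + 1) =
    (\<Sum>m<Suc k. fls_nth (linv f ^ Suc m) (int k + 1) * Res (r * f ^ m * f1))"
proof -
  define s where "s = (\<Sum>m<Suc k. fls_const (Res (r * f ^ m * f1)) * linv f ^ Suc m)"
  have Res0: "Res ((r - s) * f ^ j * f1) = 0" if "j < Suc k" for j
  proof -
    have "Res (s * f ^ j * f1) =
        (\<Sum>m<Suc k. Res (r * f ^ m * f1) * Res (linv f ^ Suc m * f ^ j * f1))"
      unfolding s_def by (simp only: sum_distrib_right Res_sum mult.assoc Res_const_mult)
    also have "\<dots> = (\<Sum>m<Suc k. if m = j then Res (r * f ^ m * f1) else 0)"
      by (intro sum.cong refl) (subst Res_linv_f_power, simp)
    also have "\<dots> = Res (r * f ^ j * f1)"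
      using that by simp
    finally show ?thesis
      by (simp add: left_diff_distrib Res_diff)
  qed
  have "vanishes_below 1 s"
    unfolding vanishes_below_def
  proof safe
    fix i :: int assume "i < 1"
    then have "fls_nth (linv f ^ Suc m) i = 0" for m
      by (intro vanishes_belowD[OF linv_f_power_leading(1)]) simp
    then show "fls_nth s i = 0"
      by (simp add: s_def fls_nth_sum)
  qed
  then have base: "vanishes_below 1 (r - s)"
    by (rule vanishes_below_diff[OF assms])
  \<comment> \<open>Vanishing moments kill one coefficient at a time: if r - s is O(z^(-1-j)), its
    moment against f^j f' is its coefficient of z^(-1-j), since f^j f' is z^j plus lower
    powers.\<close>
  have "vanishes_below (int j + 1) (r - s)" if "j \<le> Suc k" for j
    using that
  proof (induction j)
    case (Suc j)
    then have IH: "vanishes_below (int j + 1) (r - s)" by simp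
    have "fls_nth ((r - s) * (f ^ j * f1)) (int j + 1 + (- int j + 0)) =
        fls_nth (r - s) (int j + 1) * fls_nth (f ^ j * f1) (- int j + 0)"
      by (rule fls_mult_leading[OF IH vanishes_below_mult[OF f_power_leading(1) f1_leading(1)]])
    also have "fls_nth (f ^ j * f1) (- int j + 0) = 1"
      by (subst fls_mult_leading[OF f_power_leading(1) f1_leading(1)])
         (simp add: f_power_leading f1_leading)
    finally have "fls_nth (r - s) (int j + 1) = 0"
      using Res0[of j] Suc.prems by (simp add: Res_def mult.assoc)
    with IH show ?case
      unfolding vanishes_below_def
      by (metis add.commute linorder_less_linear of_nat_Suc zless_add1_eq)
  qed (simp add: base)
  from this[of "Suc k"] have "fls_nth (r - s) (int k + 1) = 0"
    by (rule vanishes_belowD) simp_all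
  then have "fls_nth r (int k + 1) = fls_nth s (int k + 1)"
    by simp
  also have "\<dots> = (\<Sum>m<Suc k. fls_nth (linv f ^ Suc m) (int k + 1) * Res (r * f ^ m * f1))"
    by (simp only: s_def fls_nth_sum fls_mult_const_nth) (simp only: mult.commute)
  finally show ?thesis .
qed

text \<open>A series O(1/z) is determined by its moments Res (r f^m f'), the coefficients of its
  expansion in the f^(-1-m). This allows the algebraic inverse to replace the expansion that defines
  \<open>expand_recip\<close>.\<close>

lemma expand_recip_eqI:
  assumes "vanishes_below 1 r" "\<And>m. Res (r * f ^ m * f1) = of_nat (m choose j) * x ^ (m - j)"
  shows "expand_recip j f x = r"
proof (rule fls_eqI)
  fix n
  show "fls_nth (expand_recip j f x) n = fls_nth r n"
  proof (cases "n \<ge> 1")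
    case True
    then obtain k where k: "n = int k + 1"
      by (metis zle_iff_zadd add.commute)
    then have "nat n = Suc k" by simp
    then show ?thesis
      unfolding expand_recip_nth k nth_eq_sum_linv_f_power[OF assms(1)] assms(2)
      by (intro sum.cong) (simp_all add: mult_ac)
  next
    case False
    then show ?thesis
      using vanishes_belowD[OF assms(1), of n] by (simp add: expand_recip_nth)
  qed
qed

lemma expand_recip_0: "expand_recip 0 f x = recip x"
proof (rule expand_recip_eqI[OF recip_leading(2)])
  fix m
  show "Res (recip x * f ^ m * f1) = of_nat (m choose 0) * x ^ (m - 0)"
    using Res_peval_recip[of "monom 1 m" x] by (simp add: peval_monom poly_monom mult_ac)
qed

lemma expand_recip_1: "expand_recip 1 f x = recip x ^ 2"
proof (rule expand_recip_eqI)
  show "vanishes_below 1 (recip x ^ 2)"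
    unfolding power2_eq_square
    by (rule vanishes_below_mult'[OF recip_leading(2) recip_leading(2)]) simp
  fix m
  have "pder (monom (1::'a) m) = monom (of_nat m) (m - 1)"
    by (rule poly_eqI) (cases m; simp add: coeff_pder)
  then show "Res (recip x ^ 2 * f ^ m * f1) = of_nat (m choose 1) * x ^ (m - 1)"
    using Res_peval_recip2[of "monom 1 m" x] by (simp add: peval_monom poly_monom mult_ac)
qed

text \<open>As coefficientwise \<open>fls_const\<close> is multiplicative, f(z) can be inverted
  before it is embedded into two variables. The factor z^k selects the coefficient of z^(-1-k), to
  which only m \<le> k contributes.\<close>

lemma Res_expand_recip_two_variables:
  "Res (fls_const u * zpow (int k) * expand_recip 0 (f_series (\<lambda>i. fls_const (a i))) h) =
     u * (\<Sum>m<Suc k. fls_const (fls_nth (linv f ^ Suc m) (int k + 1)) * h ^ m)"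
proof -
  let ?F = "f_series (\<lambda>i. fls_const (a i))"
  have F: "?F = fls_map fls_const f"
    by (rule fls_eqI) (simp add: fls_map_nth f_series_nth)
  have "?F * fls_map fls_const (linv f) = 1"
    unfolding F fls_map_const_mult[symmetric] linv_f_leading(1)
    by (rule fls_eqI) (simp add: fls_map_nth)
  then have linv: "linv ?F = fls_map fls_const (linv f)"
    by (rule inverse_unique_comm[OF f_series_mult_linv])
  have "Res (fls_const u * zpow (int k) * expand_recip 0 ?F h) = u * fls_nth (expand_recip 0 ?F h) (int k + 1)"
    by (simp add: Res_def mult.assoc zpow_mult_nth add.commute)
  also have "fls_nth (expand_recip 0 ?F h) (int k + 1) =
      (\<Sum>m<Suc k. fls_const (fls_nth (linv f ^ Suc m) (int k + 1)) * h ^ m)"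
  proof -
    have "nat (int k + 1) = Suc k" by simp
    then show ?thesis
      unfolding expand_recip_nth linv fls_map_const_power[symmetric]
      by (simp add: fls_map_nth del: power_Suc)
  qed
  finally show ?thesis .
qed

text \<open>This is the action of the stress tensor on \<open>f(z)\<close>: residues against \<open>f'(u)\<^sup>2 / (f(z) - f(u))\<close>
  pick out the part of \<open>w f'\<close> that is not a polynomial in \<open>f\<close>.\<close>

lemma Res_kernel:
  "Res (w * Res (fls_const (f1 ^ 2) * zpow (int k) * expand_recip 0 (f_series (\<lambda>i. fls_const (a i))) f))
   = - fls_nth (tail (w * f1)) (int k + 1)"
proof -
  define b where "b m = fls_nth (linv f ^ Suc m) (int k + 1)" for m
  have w: "w * f1 = peval (poly_part (w * f1)) f - tail (w * f1)"
    by (simp add: tail_def)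
  have "Res (w * (f1 ^ 2 * (\<Sum>m<Suc k. fls_const (b m) * f ^ m))) =
      (\<Sum>m<Suc k. b m * Res ((w * f1) * f ^ m * f1))"
    by (simp only: sum_distrib_left Res_sum flip: Res_const_mult)
       (simp only: power2_eq_square mult_ac)
  \<comment> \<open>The polynomial part of \<open>w * f1\<close> has zero moments; those of the tail
    reassemble into one of its coefficients.\<close>
  also have "\<dots> = (\<Sum>m<Suc k. b m * - Res (tail (w * f1) * f ^ m * f1))"
    by (subst w) (simp only: left_diff_distrib Res_diff Res_peval_power diff_0)
  also have "\<dots> = - fls_nth (tail (w * f1)) (int k + 1)"
    by (simp only: nth_eq_sum_linv_f_power[OF tail_vanishes] b_def mult_minus_right sum_negf)
  finally show ?thesis
    by (simp only: Res_expand_recip_two_variables b_def)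
qed

section \<open>Deformations of f and the Schwarzian derivative\<close>

text \<open>The derivation d/df = (1/f') d/dz, that is, differentiation in the coordinate w =
  f(z).\<close>

definition Df :: "'a fls \<Rightarrow> 'a fls" where
  "Df b = g1 * dz b"

lemma dz_eq_Df: "dz b = f1 * Df b"
  by (simp add: Df_def g1_leading flip: mult.assoc)

lemma Df_diff: "Df (b - c) = Df b - Df c"
  by (simp add: Df_def dz_simps algebra_simps)

lemma Df_peval: "Df (peval p f) = peval (pder p) f"
proof -
  have "Df (peval p f) = peval (pder p) f * (f1 * g1)"
    by (simp add: Df_def dz_peval mult_ac)
  then show ?thesis
    by (simp add: g1_leading)
qed

lemma vanishes_below_Df: "vanishes_below n b \<Longrightarrow> vanishes_below (n + 1) (Df b)"
  using vanishes_below_mult[OF g1_leading(2) vanishes_below_dz] by (simp add: Df_def)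

text \<open>With primes for d/df, the two integrands add up to the z-derivative of b c'' - b' c' + c
  b''.\<close>

lemma Res_Df3_antisym: "Res (f1 * (b * Df (Df (Df c)))) = - Res (f1 * (c * Df (Df (Df b))))"
proof -
  have "f1 * (b * Df (Df (Df c))) + f1 * (c * Df (Df (Df b))) =
      dz (b * Df (Df c) - Df b * Df c + c * Df (Df b))"
    by (simp add: dz_simps dz_eq_Df[of b] dz_eq_Df[of c] dz_eq_Df[of "Df b"] dz_eq_Df[of "Df c"]
        dz_eq_Df[of "Df (Df b)"] dz_eq_Df[of "Df (Df c)"] algebra_simps)
  then have "Res (f1 * (b * Df (Df (Df c)))) + Res (f1 * (c * Df (Df (Df b)))) = 0"
    by (simp only: Res_dz flip: Res_add)
  then show ?thesis
    by (simp add: eq_neg_iff_add_eq_0)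
qed

text \<open>\<open>\<theta>\<close> stands for 3/2. It is later pinned down by 2 \<theta> = 3, so
  that the base ring need not come with a division by 2.\<close>

definition schw :: "'a \<Rightarrow> 'a fls" where
  "schw \<theta> = dz (dz f1) * g1 - fls_const \<theta> * (dz f1 * g1) ^ 2"

text \<open>f'' = O(z^(-3)) and f''' = O(z^(-4)), because f' = 1 + O(z^(-2)). This removes the
  Schwarzian from L_n for n \<ge> -1.\<close>

lemma schw_vanishes: "vanishes_below 4 (schw \<theta>)"
proof -
  have "vanishes_below 4 (dz (dz f1) * g1)"
    using vanishes_below_mult[OF vanishes_below_dz[OF f2_vanishes] g1_leading(2)] by simp
  moreover have "vanishes_below 4 (fls_const \<theta> * (dz f1 * g1) ^ 2)"
    unfolding power2_eq_square
    by (rule vanishes_below_mult'[of 0 _ 4])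
       (auto intro!: vanishes_below_mult'[of 3 _ 3] vanishes_below_mult'[OF f2_vanishes g1_leading(2)])
  ultimately show ?thesis
    unfolding schw_def by (rule vanishes_below_diff)
qed

context
  fixes \<theta> :: 'a
  assumes \<theta>: "2 * \<theta> = 3"
begin

lemma two_const_theta: "2 * fls_const \<theta> = 3"
proof -
  have "fls_const 2 * fls_const \<theta> = fls_const 3"
    by (simp only: fls_const_mult_const \<theta>)
  then show ?thesis
    by (simp only: fls_const_numeral)
qed

lemma derivation_theta:
  assumes "derivation d"
  shows "d \<theta> = 0"
proof -
  have "of_nat (Suc 1) * d \<theta> = d (2 * \<theta>)"
    by (simp add: derivation_mult[OF assms] derivation_numeral[OF assms])
  also have "\<dots> = 0"
    by (simp add: \<theta> derivation_numeral[OF assms])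
  finally show ?thesis
    by (rule torsion_free)
qed

text \<open>Infinitesimal form of S(g o f) = (Sg o f) f'^2 + Sf for g a first-order perturbation w +
  b(w) of the identity, where Sg is b''' to first order. The products of f'' with the second
  f-derivative of b cancel because 2 \<theta> = 3.\<close>

lemma fls_map_schw:
  assumes d: "derivation d"
  shows "fls_map d (schw \<theta>) = f1 ^ 2 * Df (Df (Df (fls_map d f)))"
proof -
  define D where "D = fls_map d"
  have D: "derivation D"
    unfolding D_def by (rule derivation_fls_map[OF d])
  define b b1 b2 b3 where "b = D f" and "b1 = Df b" and "b2 = Df b1" and "b3 = Df b2"
  define f2 f3 t where "f2 = dz f1" and "f3 = dz f2" and "t = fls_const \<theta>"
  have b: "dz b = f1 * b1" "dz b1 = f1 * b2" "dz b2 = f1 * b3"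
    unfolding b1_def b2_def b3_def by (rule dz_eq_Df)+
  have t: "2 * t = 3"
    unfolding t_def by (rule two_const_theta)
  have Df1: "D f1 = f1 * b1"
    using b by (simp add: D_def fls_map_dz[OF d] b_def)
  have Df2: "D f2 = f2 * b1 + f1 * (f1 * b2)"
    using Df1 b by (simp add: f2_def D_def fls_map_dz[OF d] dz_simps)
  have Df3: "D f3 = f3 * b1 + 3 * (f2 * (f1 * b2)) + f1 * (f1 * (f1 * b3))"
    using Df2 b by (simp add: f3_def D_def fls_map_dz[OF d] dz_simps algebra_simps flip: f2_def)
  have Dg1: "D g1 = - (g1 * b1)"
    using derivation_inverse[OF D g1_leading(1)] g1_leading(1)
    by (simp add: Df1 power2_eq_square mult_ac(1)) (simp add: mult.commute mult.left_commute flip: mult.assoc)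
  have Dt: "D t = 0"
    unfolding t_def D_def by (simp add: fls_map_const derivation_0[OF d] derivation_theta[OF d])
  have "D (schw \<theta>) = D f3 * g1 + f3 * D g1 - t * (2 * (f2 * g1) * (D f2 * g1 + f2 * D g1))"
    by (simp add: schw_def derivation_diff[OF D] derivation_mult[OF D] power2_eq_square Dt
        algebra_simps flip: f2_def f3_def t_def)
  also have "\<dots> = 3 * (f2 * b2) * (f1 * g1) + f1 ^ 2 * b3 * (f1 * g1) - (2 * t) * (f2 * b2) * (f1 * g1) * (f1 * g1)"
    by (simp add: Df2 Df3 Dg1 algebra_simps power2_eq_square)
  also have "\<dots> = f1 ^ 2 * b3"
    by (simp add: g1_leading t)
  finally show ?thesis
    by (simp add: D_def b3_def b2_def b1_def b_def)
qed

text \<open>The deformation \<open>e f'\<close> is a reparametrisation of z, and \<open>Sf\<close> transforms as a projective connection.\<close>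

lemma Df3_mult_f1:
  "f1 ^ 2 * Df (Df (Df (e * f1))) =
     dz (dz (dz e)) + 2 * (dz e * schw \<theta>) + e * dz (schw \<theta>)"
proof -
  \<comment> \<open>s = f''/f' turns the definition of Sf into a Riccati equation, s' = Sf +
    (\<theta> - 1) s^2, with \<theta> - 1 = 1/2.\<close>
  define s where "s = dz f1 * g1"
  define S t where "S = schw \<theta>" and "t = fls_const \<theta>"
  have t: "2 * t = 3"
    unfolding t_def by (rule two_const_theta)
  have dg1: "dz g1 = - (g1 * s)"
    using derivation_inverse[OF derivation_dz g1_leading(1)]
    by (simp add: s_def power2_eq_square mult_ac)
  have ds: "dz s = S + t * s ^ 2 - s ^ 2"
    by (simp add: s_def S_def schw_def t_def dz_simps dg1 power2_eq_square algebra_simps)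
  have dt: "dz t = 0"
    by (simp add: t_def)
  have dds: "dz (dz s) = dz S + (2 * t) * (s * dz s) - 2 * (s * dz s)"
    by (subst ds) (simp add: dz_simps dt power2_eq_square algebra_simps)
  then have dds: "dz (dz s) = dz S + s * dz s"
    by (simp add: t)
  have gf: "g1 * (f1 * c) = c" "f1 * (g1 * c) = c" for c
    by (simp_all add: mult.commute[of g1 f1] g1_leading flip: mult.assoc)
  have 1: "Df (e * f1) = dz e + e * s"
    by (simp add: Df_def dz_simps distrib_left s_def mult_ac gf g1_leading)
  have 2: "Df (Df (e * f1)) = g1 * (dz (dz e) + dz e * s + e * dz s)"
    by (simp add: 1 Df_def[of "dz e + e * s"] dz_simps algebra_simps)
  have "Df (Df (Df (e * f1))) = g1 * (g1 * (dz (dz (dz e)) + 2 * (dz e * dz s) + e * dz (dz s)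
      - dz e * s ^ 2 - e * s * dz s))"
    unfolding 2 by (simp add: Df_def dz_simps dg1 algebra_simps power2_eq_square)
  then have "f1 ^ 2 * Df (Df (Df (e * f1))) = dz (dz (dz e)) + 2 * (dz e * dz s) + e * dz (dz s)
      - dz e * s ^ 2 - e * s * dz s"
    by (simp add: power2_eq_square gf mult.assoc)
  also have "\<dots> = dz (dz (dz e)) + 2 * (dz e * S) + (2 * t) * (dz e * s ^ 2) - 3 * (dz e * s ^ 2) + e * dz S"
    unfolding dds by (simp add: ds algebra_simps)
  finally show ?thesis
    by (simp add: t S_def)
qed

end

text \<open>\<open>vpoly n\<close> is the polynomial vector field \<open>v\<close> for which \<open>v(f) - z\<^bsup>1-n\<^esup> f'\<close> is \<open>O(1/z)\<close>:
  the vector field \<open>z\<^bsup>1-n\<^esup> \<partial>\<^sub>z\<close> transported by f, up to a correction that preserves the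
  normalisation of f.\<close>

abbreviation eps :: "int \<Rightarrow> 'a fls" where "eps n \<equiv> zpow (1 - n)"
definition vpoly :: "int \<Rightarrow> 'a poly" where "vpoly n = poly_part (eps n * f1)"
definition rem :: "int \<Rightarrow> 'a fls" where "rem n = tail (eps n * f1)"

lemma rem_eq: "rem n = peval (vpoly n) f - eps n * f1"
  by (simp add: rem_def vpoly_def tail_def)

lemma eps_f1: "eps n * f1 = peval (vpoly n) f - rem n"
  by (simp add: rem_eq)

lemma rem_vanishes: "vanishes_below 1 (rem n)"
  by (simp add: rem_def tail_vanishes)

lemma dz_eps: "dz (eps n) = of_int (1 - n) * zpow (- n)"
  by (simp add: dz_zpow)

text \<open>The bracket of the vector fields z^(1-n) d/dz, that is, the Witt algebra
  relation.\<close>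

lemma eps_wronskian: "eps m * dz (eps n) - eps n * dz (eps m) = of_int (m - n) * eps (n + m)"
proof -
  have "eps m * zpow (- n) = eps (n + m)" "eps n * zpow (- m) = eps (n + m)"
    by (simp_all add: algebra_simps flip: zpow_add)
  then have "eps m * dz (eps n) - eps n * dz (eps m) = of_int (1 - n) * eps (n + m) - of_int (1 - m) * eps (n + m)"
    unfolding dz_eps by (simp only: mult.left_commute[of "eps m"] mult.left_commute[of "eps n"])
  then show ?thesis
    by (simp add: algebra_simps)
qed

section \<open>Commutators of the vector fields V_n and the Schwarzian cocycle\<close>

lemma fls_map_rem:
  assumes d: "derivation d"
  shows "fls_map d (rem n) =
    peval (map_poly d (vpoly n)) f + peval (pder (vpoly n)) f * fls_map d f - eps n * dz (fls_map d f)"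
  unfolding rem_eq derivation_diff[OF derivation_fls_map[OF d]] derivation_mult[OF derivation_fls_map[OF d]]
  by (simp add: fls_map_peval[OF d] fls_map_dz[OF d] fls_map_zpow[OF d])

context
  fixes d e :: "'a \<Rightarrow> 'a" and n m :: int
  assumes d: "derivation d" and e: "derivation e"
    and df: "fls_map d f = rem n" and ef: "fls_map e f = rem m"
begin

text \<open>The terms with f'' and the mixed products of v_m' with z^(1-n) f' cancel between the two
  variations, which leaves a polynomial in f and a Wronskian times f'.\<close>

lemma rem_commutator_aux:
  "fls_map d (rem m) - fls_map e (rem n) =
    peval (map_poly d (vpoly m) - map_poly e (vpoly n) + pder (vpoly m) * vpoly n - pder (vpoly n) * vpoly m) f
    - of_int (n - m) * (eps (n + m) * f1)"
proof -
  have dz_rem: "dz (rem k) = peval (pder (vpoly k)) f * f1 - dz (eps k) * f1 - eps k * dz f1" for k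
    by (simp add: rem_eq dz_simps dz_peval)
  have "of_int (n - m) * (eps (n + m) * f1) = - ((eps m * dz (eps n) - eps n * dz (eps m)) * f1)"
    by (simp add: eps_wronskian algebra_simps)
  then show ?thesis
    unfolding fls_map_rem[OF d] fls_map_rem[OF e] df ef dz_rem
    by (simp add: rem_eq peval_add peval_diff peval_mult algebra_simps)
qed

lemma vpoly_commutator:
  "map_poly d (vpoly m) - map_poly e (vpoly n) + pder (vpoly m) * vpoly n - pder (vpoly n) * vpoly m =
    smult (of_int (n - m)) (vpoly (n + m))" (is "?Q = _")
  and rem_commutator:
  "fls_map d (rem m) - fls_map e (rem n) = of_int (n - m) * rem (n + m)"
proof -
  have "fls_map d (rem m) - fls_map e (rem n) - of_int (n - m) * rem (n + m) =
      peval (?Q - smult (of_int (n - m)) (vpoly (n + m))) f"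
    unfolding rem_commutator_aux
    by (simp only: rem_eq[of "n + m"] peval_diff[of ?Q] peval_smult fls_of_int right_diff_distrib) simp
  moreover have "vanishes_below 1 (fls_map d (rem m) - fls_map e (rem n) - of_int (n - m) * rem (n + m))"
    using vanishes_below_mult[of 0 "of_int (n - m)" 1 "rem (n + m)"] rem_vanishes
    by (intro vanishes_below_diff vanishes_below_fls_map derivation_0 d e) (auto simp: fls_of_int)
  ultimately have Q: "?Q - smult (of_int (n - m)) (vpoly (n + m)) = 0"
    by (intro poly_eq_0_if_vanishes_below) simp
  then show "?Q = smult (of_int (n - m)) (vpoly (n + m))" by simp
  then show "fls_map d (rem m) - fls_map e (rem n) = of_int (n - m) * rem (n + m)"
    unfolding rem_commutator_aux
    by (simp only: peval_smult rem_eq[of "n + m"] fls_of_int[symmetric] right_diff_distrib)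
qed

end

text \<open>Replace z^(1-m) f' by v_m(f), the product of two tails being O(z^(-5)); move the three
  derivatives to v_m by skew-symmetry; then replace \<open>rem n\<close> by -z^(1-n) f', since
  polynomials in f times f' have no residue. The exchange of n and m makes the v''' terms cancel in
  the cocycle.\<close>

lemma Res_eps_Df3_rem:
  "Res (eps m * (f1 ^ 2 * Df (Df (Df (rem n))))) =
     Res (eps n * (f1 ^ 2 * peval (pder (pder (pder (vpoly m)))) f))"
proof -
  have "vanishes_below 5 (f1 * (rem m * Df (Df (Df (rem n)))))"
    using vanishes_below_Df[OF vanishes_below_Df[OF vanishes_below_Df[OF rem_vanishes[of n]]]]
    by (intro vanishes_below_mult'[OF f1_leading(1) vanishes_below_mult[OF rem_vanishes]]) auto
  then have 0: "Res (f1 * (rem m * Df (Df (Df (rem n))))) = 0"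
    by (intro Res_vanishes) (rule vanishes_below_mono, auto)
  have "Res (eps m * (f1 ^ 2 * Df (Df (Df (rem n))))) = Res (f1 * ((eps m * f1) * Df (Df (Df (rem n)))))"
    by (simp add: power2_eq_square mult_ac)
  also have "\<dots> = Res (f1 * (peval (vpoly m) f * Df (Df (Df (rem n)))))"
    by (simp add: eps_f1 left_diff_distrib right_diff_distrib Res_diff 0)
  also have "\<dots> = - Res (rem n * (f1 * peval (pder (pder (pder (vpoly m)))) f))"
    by (subst Res_Df3_antisym) (simp add: Df_peval mult_ac)
  also have "\<dots> = Res ((eps n * f1) * (f1 * peval (pder (pder (pder (vpoly m)))) f))
      - Res (peval (vpoly n * pder (pder (pder (vpoly m)))) f * f1)"
    unfolding rem_eq left_diff_distrib by (simp add: Res_diff peval_mult mult_ac)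
  also have "\<dots> = Res (eps n * (f1 ^ 2 * peval (pder (pder (pder (vpoly m)))) f))"
    by (simp only: Res_peval power2_eq_square diff_0_right) (simp only: mult_ac)
  finally show ?thesis .
qed

text \<open>The Gelfand-Fuks cocycle of the Witt algebra and source of n^3 - n, which is (1 -
  m)(-m)(-m - 1) at m = -n.\<close>

lemma Res_eps_dz3_eps:
  "Res (eps n * dz (dz (dz (eps m)))) = (if n + m = 0 then of_int (n ^ 3 - n) else 0)"
proof -
  have "dz (dz (dz (eps m))) = of_int (1 - m) * (of_int (- m) * (of_int (- m - 1) * zpow (- 2 - m)))"
    by (simp add: dz_zpow dz_simps derivation_of_int[OF derivation_dz])
  then have "dz (dz (dz (eps m))) = fls_const (of_int ((1 - m) * (- m) * (- m - 1))) * zpow (- 2 - m)"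
    unfolding fls_of_int[symmetric] by (simp only: of_int_mult mult.assoc)
  moreover have "zpow (- 1 - (n + m)) = (eps n * zpow (- 2 - m) :: 'a fls)"
    unfolding zpow_add[symmetric] by (rule arg_cong[of _ _ zpow]) simp
  ultimately have "eps n * dz (dz (dz (eps m))) =
      fls_const (of_int ((1 - m) * (- m) * (- m - 1))) * zpow (- 1 - (n + m))"
    by (simp only: mult.left_commute)
  then have "Res (eps n * dz (dz (dz (eps m)))) = of_int ((1 - m) * (- m) * (- m - 1)) * (if n + m = 0 then 1 else 0)"
    by (simp only: Res_const_mult) (simp add: Res_def zpow_nth)
  moreover have "(1 - m) * (- m) * (- m - 1) = n ^ 3 - n" if "n + m = 0"
  proof -
    have "m = - n" using that by simp
    then show ?thesis by (simp add: power3_eq_cube algebra_simps)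
  qed
  ultimately show ?thesis
    by (cases "n + m = 0") (simp_all only: refl if_True if_False mult_1_right mult_zero_right)
qed

context
  fixes \<theta> :: 'a
  assumes \<theta>: "2 * \<theta> = 3"
begin

text \<open>For e = z^(1-n), the terms 2 e' Sf + e (Sf)' of the transformation law, paired with
  z^(1-m), are the Wronskian times Sf up to an exact term.\<close>

lemma Res_eps_reparam:
  "Res (eps m * (f1 ^ 2 * Df (Df (Df (eps n * f1))))) =
    Res (eps m * dz (dz (dz (eps n)))) - of_int (n - m) * Res (eps (n + m) * schw \<theta>)"
proof -
  have "eps m * (f1 ^ 2 * Df (Df (Df (eps n * f1)))) = eps m * dz (dz (dz (eps n)))
      + (eps m * dz (eps n) - eps n * dz (eps m)) * schw \<theta> + dz (eps m * eps n * schw \<theta>)"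
    unfolding Df3_mult_f1[OF \<theta>] by (simp add: dz_simps algebra_simps)
  then have "Res (eps m * (f1 ^ 2 * Df (Df (Df (eps n * f1))))) =
      Res (eps m * dz (dz (dz (eps n)))) + Res ((eps m * dz (eps n) - eps n * dz (eps m)) * schw \<theta>)"
    by (simp only: Res_add Res_dz add_0_right)
  also have "Res ((eps m * dz (eps n) - eps n * dz (eps m)) * schw \<theta>) = - (of_int (n - m) * Res (eps (n + m) * schw \<theta>))"
    unfolding eps_wronskian fls_of_int mult.assoc Res_const_mult by (simp add: algebra_simps)
  finally show ?thesis by simp
qed

lemma Res_schw_variation:
  assumes d: "derivation d" and df: "fls_map d f = rem n"
  shows "d (Res (eps m * schw \<theta>)) = Res (eps m * (f1 ^ 2 * Df (Df (Df (rem n)))))"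
  unfolding Res_fls_map[OF d, symmetric] derivation_mult[OF derivation_fls_map[OF d]]
  by (simp add: fls_map_zpow[OF d] fls_map_schw[OF \<theta> d] df)

text \<open>Split \<open>rem n\<close> into v_n(f) - z^(1-n) f' in the first variation. The v_n'''
  part equals the second variation by \<open>Res_eps_Df3_rem\<close>, so only the reparametrisation
  part is left.\<close>

lemma Res_schw_cocycle:
  assumes d: "derivation d" and e: "derivation e"
    and df: "fls_map d f = rem n" and ef: "fls_map e f = rem m"
  shows "d (Res (eps m * schw \<theta>)) - e (Res (eps n * schw \<theta>)) =
    of_int (n - m) * Res (eps (n + m) * schw \<theta>) + (if n + m = 0 then of_int (n ^ 3 - n) else 0)"
proof -
  have "e (Res (eps n * schw \<theta>)) = Res (eps m * (f1 ^ 2 * peval (pder (pder (pder (vpoly n)))) f))"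
    by (simp only: Res_schw_variation[OF e ef] Res_eps_Df3_rem)
  moreover have "d (Res (eps m * schw \<theta>)) =
      Res (eps m * (f1 ^ 2 * peval (pder (pder (pder (vpoly n)))) f)) - Res (eps m * (f1 ^ 2 * Df (Df (Df (eps n * f1)))))"
    unfolding Res_schw_variation[OF d df]
    by (simp add: rem_eq[of n] Df_diff Df_peval right_diff_distrib Res_diff)
  moreover have "Res (eps m * dz (dz (dz (eps n)))) = - Res (eps n * dz (dz (dz (eps m))))"
  proof (cases "n + m = 0")
    case True
    then have "m = - n" by simp
    show ?thesis unfolding Res_eps_dz3_eps unfolding \<open>m = - n\<close> by simp
  qed (simp add: Res_eps_dz3_eps add.commute)
  ultimately show ?thesis
    by (simp add: Res_eps_reparam Res_eps_dz3_eps)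
qed

end

end

section \<open>Variations under the Loewner flow\<close>

lemma ex_linear_poly:
  fixes p :: "'a::zero poly"
  assumes "degree p \<le> 1"
  shows "\<exists>u v. p = [:u, v:]"
proof -
  have "p = [:coeff p 0, coeff p 1:]"
    using assms by (intro poly_eqI) (auto simp: coeff_pCons coeff_eq_0 split: nat.split)
  then show ?thesis by blast
qed

text \<open>Derivatives of the polynomial in \<open>vpoly_loewner\<close>, with l standing for w -
  x. At the zero of l only the terms without l survive.\<close>

lemma pder_loewner_identity:
  fixes l q v :: "'a::comm_ring_1 poly"
  assumes l: "pder l = 1"
  defines "P \<equiv> q * l ^ 2 + 2 * (pder v * l) + 2 * v"
  shows "pder P = pder q * l ^ 2 + 2 * (q * l) + 2 * (pder (pder v) * l) + 4 * pder v"
    and "pder (pder P) = pder (pder q) * l ^ 2 + 4 * (pder q * l) + 2 * q + 2 * (pder (pder (pder v)) * l)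
      + 6 * pder (pder v)"
    and "pder (pder (pder P)) = pder (pder (pder q)) * l ^ 2 + 6 * (pder (pder q) * l) + 6 * pder q
      + 2 * (pder (pder (pder (pder v))) * l) + 8 * pder (pder (pder v))"
proof -
  note simps = pder_add derivation_mult[OF derivation_pder] derivation_numeral[OF derivation_pder]
    l power2_eq_square
  show 1: "pder P = pder q * l ^ 2 + 2 * (q * l) + 2 * (pder (pder v) * l) + 4 * pder v"
    by (simp add: P_def simps algebra_simps)
  show 2: "pder (pder P) = pder (pder q) * l ^ 2 + 4 * (pder q * l) + 2 * q + 2 * (pder (pder (pder v)) * l)
      + 6 * pder (pder v)"
    by (simp add: 1 simps algebra_simps)
  show "pder (pder (pder P)) = pder (pder (pder q)) * l ^ 2 + 6 * (pder (pder q) * l) + 6 * pder q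
      + 2 * (pder (pder (pder (pder v))) * l) + 8 * pder (pder (pder v))"
    by (simp add: 2 simps algebra_simps)
qed

lemma peval_numeral: "peval (numeral k) g = numeral k"
  by (simp only: numeral_poly peval_pCons peval_0 mult_zero_right add_0_right fls_const_numeral)

context formal_map
begin

lemma peval_vpoly_cases:
  assumes "vanishes_below 1 (peval p f - eps n * f1)"
  shows "vpoly n = p"
  unfolding vpoly_def by (rule poly_part_eqI[OF assms])

lemma vpoly_1: "vpoly 1 = 1"
  using vanishes_below_minus[OF vanishes_below_mono[OF f1_minus_1]]
  by (intro peval_vpoly_cases) (simp add: one_pCons)

lemma vpoly_0: "vpoly 0 = [:0, 1:]"
proof (rule peval_vpoly_cases)
  have "vanishes_below 1 (f - zpow 1)"
    by (auto simp: vanishes_below_def f_series_nth zpow_nth)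
  moreover have "vanishes_below 1 (zpow 1 * (f1 - 1))"
    by (rule vanishes_below_mult'[OF vanishes_below_zpow f1_minus_1]) auto
  ultimately have "vanishes_below 1 ((f - zpow 1) - zpow 1 * (f1 - 1))"
    by (rule vanishes_below_diff)
  then show "vanishes_below 1 (peval [:0, 1:] f - eps 0 * f1)"
    by (simp add: algebra_simps)
qed

lemma vpoly_ge_2: "n \<ge> 2 \<Longrightarrow> vpoly n = 0"
  using vanishes_below_mult'[OF vanishes_below_zpow f1_leading(1), of 1 "1 - n" 1]
  by (intro peval_vpoly_cases) (simp add: vanishes_below_minus)

text \<open>z^(1-n) Sf is O(z^(-3-n)), hence O(z^(-2)) from n = -1 on.\<close>

lemma Res_eps_schw: "n \<ge> -1 \<Longrightarrow> Res (eps n * schw \<theta>) = 0"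
  by (intro Res_vanishes vanishes_below_mult'[OF vanishes_below_zpow schw_vanishes, of "n - 1"]) auto

lemma recip_cancel: "(f - fls_const x) * (recip x * c) = c" "recip x * ((f - fls_const x) * c) = c"
  by (simp_all add: mult.commute[of "recip x" "f - fls_const x"] recip_leading flip: mult.assoc)

text \<open>\<open>b\<close> is an infinitesimal Loewner flow with driving point x.\<close>

context
  fixes b :: "'a \<Rightarrow> 'a" and x :: 'a
  assumes b: "derivation b" and bf: "fls_map b f = 2 * recip x"
begin

lemma pder_l: "pder [:- x, 1:] = 1"
  and poly_l: "poly [:- x, 1:] x = 0"
  by (simp_all add: pder_pCons one_pCons)

text \<open>Multiplied by \<open>(f - x)\<^sup>2\<close>, the variation of \<open>v(f) - z\<^bsup>1-n\<^esup> f' = O(1/z)\<close> under b is a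
  polynomial in f of degree at most one.\<close>

lemma vpoly_loewner:
  "map_poly b (vpoly n) * [:- x, 1:] ^ 2 + 2 * (pder (vpoly n) * [:- x, 1:]) + 2 * vpoly n =
    [:2 * poly (vpoly n) x - 4 * poly (pder (vpoly n)) x * x, 4 * poly (pder (vpoly n)) x:]"
  (is "?P = _")
proof -
  define w r where "w = f - fls_const x" and "r = recip x"
  have cancel: "w * (r * c) = c" for c
    unfolding w_def r_def by (rule recip_cancel)
  have pw: "peval [:- x, 1:] f = w"
    by (simp add: w_def)
  have "dz r = - (r * (r * f1))"
    by (simp add: r_def derivation_recip[OF derivation_dz] power2_eq_square mult_ac)
  then have dz_r: "dz (2 * r) = - (2 * (r * (r * f1)))"
    by (simp add: dz_simps derivation_numeral[OF derivation_dz])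
  have "peval ?P f = w ^ 2 * fls_map b (rem n) + 2 * rem n"
  proof -
    have "fls_map b (rem n) = peval (map_poly b (vpoly n)) f + peval (pder (vpoly n)) f * (2 * r)
        + eps n * (2 * (r * (r * f1)))"
      by (simp add: fls_map_rem[OF b] bf dz_r flip: r_def)
    then have "w ^ 2 * fls_map b (rem n) = w ^ 2 * peval (map_poly b (vpoly n)) f
        + 2 * (w * (r * (peval (pder (vpoly n)) f * w))) + 2 * (w * (r * (w * (r * (eps n * f1)))))"
      by (simp only: power2_eq_square distrib_left mult_ac)
    then have "w ^ 2 * fls_map b (rem n) = w ^ 2 * peval (map_poly b (vpoly n)) f
        + 2 * (peval (pder (vpoly n)) f * w) + 2 * (peval (vpoly n) f - rem n)"
      by (simp only: cancel eps_f1)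
    then show ?thesis
      by (simp only: peval_add peval_numeral peval_mult pw power2_eq_square) (simp add: algebra_simps)
  qed
  \<comment> \<open>(f - x)^2 is O(z^2), and the variation of an O(1/z) series is O(1/z), whence the
    degree bound 1.\<close>
  moreover have "vanishes_below (- int 1) (w ^ 2 * fls_map b (rem n) + 2 * rem n)"
  proof (rule vanishes_below_add)
    have w: "vanishes_below (- 1) w"
      unfolding w_def by (intro vanishes_below_diff f_leading) simp
    have "vanishes_below 1 (fls_map b (rem n))"
      by (intro vanishes_below_fls_map rem_vanishes derivation_0 b)
    then show "vanishes_below (- int 1) (w ^ 2 * fls_map b (rem n))"
      unfolding power2_eq_square by (rule vanishes_below_mult'[OF vanishes_below_mult[OF w w]]) simp
    show "vanishes_below (- int 1) (2 * rem n)"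
      using vanishes_below_mono[OF rem_vanishes[of n], of "- 1"]
      by (simp add: vanishes_below_def)
  qed
  ultimately have "degree ?P \<le> 1"
    by (intro degree_le_if_vanishes_below) simp
  then obtain u v where uv: "?P = [:u, v:]"
    by (metis ex_linear_poly)
  \<comment> \<open>A linear polynomial is known from its value and slope at x, where every term
    containing w - x drops out.\<close>
  have "poly ?P x = 2 * poly (vpoly n) x"
    by simp
  moreover have "poly (pder ?P) x = 4 * poly (pder (vpoly n)) x"
    by (subst pder_loewner_identity(1)[OF pder_l]) (simp only: poly_add poly_mult poly_power poly_numeral poly_l, simp)
  ultimately have "v = 4 * poly (pder (vpoly n)) x" "u = 2 * poly (vpoly n) x - v * x"
    unfolding uv by (simp_all add: pder_pCons algebra_simps)
  then show ?thesis
    unfolding uv by simp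
qed

lemma poly_vpoly_loewner:
  "poly (map_poly b (vpoly n)) w * (w - x) ^ 2 + 2 * poly (pder (vpoly n)) w * (w - x) + 2 * poly (vpoly n) w =
    2 * poly (vpoly n) x + 4 * poly (pder (vpoly n)) x * (w - x)"
proof -
  have "poly [:- x, 1:] w = w - x" by simp
  with arg_cong[OF vpoly_loewner, of "\<lambda>p. poly p w" n] show ?thesis
    by (simp only: poly_add poly_mult poly_power poly_numeral) (simp add: algebra_simps)
qed

lemma poly_pder_vpoly_loewner:
  "poly (pder (map_poly b (vpoly n))) w * (w - x) ^ 2 + 2 * (poly (map_poly b (vpoly n)) w * (w - x))
    + 2 * (poly (pder (pder (vpoly n))) w * (w - x)) + 4 * poly (pder (vpoly n)) w = 4 * poly (pder (vpoly n)) x"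
proof -
  have "poly [:- x, 1:] w = w - x" by simp
  with arg_cong[OF vpoly_loewner[of n], of pder] show ?thesis
    unfolding pder_loewner_identity(1)[OF pder_l]
    by (drule_tac arg_cong[of _ _ "\<lambda>p. poly p w"])
       (simp only: poly_add poly_mult poly_power poly_numeral pder_pCons, simp)
qed

text \<open>With q for \<open>map_poly b (vpoly n)\<close>: the polynomial of
  \<open>vpoly_loewner\<close> is linear, so its second and third derivatives vanish; at x they are
  2 q + 6 v'' and 6 q' + 8 v'''. Halving gives both claims, a factor 3 replacing the constant
  4/3.\<close>

lemma poly_vpoly_loewner_at: "poly (map_poly b (vpoly n)) x = - 3 * poly (pder (pder (vpoly n))) x"
  and poly_pder_vpoly_loewner_at:
    "3 * poly (pder (map_poly b (vpoly n))) x = - 4 * poly (pder (pder (pder (vpoly n)))) x"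
proof -
  have "poly (pder (pder (map_poly b (vpoly n) * [:- x, 1:] ^ 2 + 2 * (pder (vpoly n) * [:- x, 1:]) + 2 * vpoly n))) x = 0"
    unfolding vpoly_loewner by (simp add: pder_pCons)
  then have "of_nat (Suc 1) * (poly (map_poly b (vpoly n)) x + 3 * poly (pder (pder (vpoly n))) x) = 0"
    unfolding pder_loewner_identity(2)[OF pder_l]
    by (simp only: poly_add poly_mult poly_power poly_numeral poly_l) (simp add: algebra_simps)
  from torsion_free[OF this] show "poly (map_poly b (vpoly n)) x = - 3 * poly (pder (pder (vpoly n))) x"
    by (simp add: eq_neg_iff_add_eq_0)
  have "poly (pder (pder (pder (map_poly b (vpoly n) * [:- x, 1:] ^ 2 + 2 * (pder (vpoly n) * [:- x, 1:]) + 2 * vpoly n)))) x = 0"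
    unfolding vpoly_loewner by (simp add: pder_pCons)
  then have "of_nat (Suc 1) * (3 * poly (pder (map_poly b (vpoly n))) x + 4 * poly (pder (pder (pder (vpoly n)))) x) = 0"
    unfolding pder_loewner_identity(3)[OF pder_l]
    by (simp only: poly_add poly_mult poly_power poly_numeral poly_l) (simp add: algebra_simps)
  from torsion_free[OF this] show "3 * poly (pder (map_poly b (vpoly n))) x = - 4 * poly (pder (pder (pder (vpoly n)))) x"
    by (simp add: eq_neg_iff_add_eq_0)
qed

text \<open>Over the common denominator (f - x)^2 the numerator is P(f) - 2 v(x), with P from
  \<open>vpoly_loewner\<close>, hence 4 v'(x) (f - x). So [b, d] moves f by 2 v'(x) times the
  Loewner variation.\<close>

lemma rem_loewner_commutator:
  assumes d: "derivation d" and df: "fls_map d f = rem n" and dx: "d x = poly (vpoly n) x"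
  shows "fls_map b (rem n) - fls_map d (2 * recip x) = fls_const (4 * poly (pder (vpoly n)) x) * recip x"
proof -
  define w r where "w = f - fls_const x" and "r = recip x"
  have cancel: "r * (w * c) = c" for c
    unfolding w_def r_def by (rule recip_cancel)
  have pw: "peval [:- x, 1:] f = w"
    by (simp add: w_def)
  note D = derivation_fls_map[OF d]
  define p p' q k where "p = peval (vpoly n) f" and "p' = peval (pder (vpoly n)) f"
    and "q = peval (map_poly b (vpoly n)) f" and "k = fls_const (poly (vpoly n) x)"
  have "dz r = - (r * (r * f1))"
    by (simp add: r_def derivation_recip[OF derivation_dz] power2_eq_square mult_ac)
  then have "dz (2 * r) = - (2 * (r * (r * f1)))"
    by (simp add: dz_simps derivation_numeral[OF derivation_dz])
  then have b_rem: "fls_map b (rem n) = q + p' * (2 * r) + eps n * (2 * (r * (r * f1)))"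
    by (simp add: fls_map_rem[OF b] bf q_def p'_def flip: r_def)
  have "fls_map d r = - (r * (r * (rem n - k)))"
    by (simp add: r_def k_def derivation_recip[OF D] df dx fls_map_const derivation_0[OF d]
        power2_eq_square mult_ac)
  then have "fls_map d (2 * r) = - (2 * (r * (r * (rem n - k))))"
    by (simp add: derivation_mult[OF D] derivation_numeral[OF D])
  then have "fls_map b (rem n) - fls_map d (2 * r) = q + 2 * (r * p') + 2 * (r * (r * (p - k)))"
    unfolding b_rem by (simp add: rem_eq[of n] p_def algebra_simps)
  also have "\<dots> = r * (w * (r * (w * q))) + r * (w * (2 * (r * p'))) + 2 * (r * (r * (p - k)))"
    by (simp only: cancel)
  also have "\<dots> = r * (r * (q * (w * w) + 2 * (p' * w) + 2 * p - 2 * k))"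
    by (simp add: algebra_simps)
  also have "q * (w * w) + 2 * (p' * w) + 2 * p = 2 * k + fls_const (4 * poly (pder (vpoly n)) x) * w"
  proof -
    have "[:2 * poly (vpoly n) x - 4 * poly (pder (vpoly n)) x * x, 4 * poly (pder (vpoly n)) x:] =
        2 * [:poly (vpoly n) x:] + [:4 * poly (pder (vpoly n)) x:] * [:- x, 1:]"
      by (simp add: numeral_poly mult_ac)
    from arg_cong[OF vpoly_loewner[of n, unfolded this], of "\<lambda>p. peval p f"] show ?thesis
      by (simp only: peval_add peval_numeral peval_mult pw power2_eq_square flip: p_def p'_def q_def)
         (simp add: k_def)
  qed
  also have "r * (r * (2 * k + fls_const (4 * poly (pder (vpoly n)) x) * w - 2 * k)) =
      r * (w * (r * fls_const (4 * poly (pder (vpoly n)) x)))"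
    by (simp add: mult_ac)
  finally show ?thesis
    unfolding r_def[symmetric] cancel mult.commute[of "fls_const _"] .
qed

text \<open>The third f-derivative of 2/(f - x) is -12/(f - x)^4, and Cauchy's formula makes Res
  (v(f) f'/(f - x)^4) the value v'''(x)/6; hence the constant -2.\<close>

lemma Res_schw_loewner:
  assumes \<theta>: "2 * \<theta> = 3"
  shows "b (Res (eps n * schw \<theta>)) = - 2 * poly (pder (pder (pder (vpoly n)))) x"
proof -
  have Df_recip: "Df (recip x) = - (recip x ^ 2)"
  proof -
    have "Df (recip x) = - (recip x ^ 2 * (f1 * g1))"
      by (simp add: Df_def derivation_recip[OF derivation_dz] mult_ac)
    then show ?thesis
      by (simp add: g1_leading)
  qed
  have Df_mult: "Df (c * c') = Df c * c' + c * Df c'" for c c'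
    by (simp add: Df_def dz_simps algebra_simps)
  have Df_uminus: "Df (- c) = - Df c" for c
    by (simp add: Df_def dz_simps)
  have Df_num: "Df (numeral k) = 0" for k
    by (simp add: Df_def derivation_numeral[OF derivation_dz])
  have D3: "Df (Df (Df (2 * recip x))) = - 12 * recip x ^ 4"
    by (simp add: Df_mult Df_recip Df_uminus Df_num power2_eq_square power4_eq_xxxx algebra_simps)
  have "b (Res (eps n * schw \<theta>)) = Res (eps n * (f1 ^ 2 * Df (Df (Df (2 * recip x)))))"
    unfolding Res_fls_map[OF b, symmetric] derivation_mult[OF derivation_fls_map[OF b]]
    by (simp add: fls_map_zpow[OF b] fls_map_schw[OF \<theta> b] bf)
  also have "\<dots> = - of_nat 12 * Res ((eps n * f1) * f1 * recip x ^ 4)"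
  proof -
    have "eps n * (f1 ^ 2 * (- 12 * recip x ^ 4)) = - (of_nat 12 * ((eps n * f1) * f1 * recip x ^ 4))"
      by (simp add: power2_eq_square mult_ac)
    then show ?thesis
      unfolding D3 by (simp only: Res_minus Res_of_nat_mult mult_minus_left)
  qed
  also have "Res ((eps n * f1) * f1 * recip x ^ 4) = Res (peval (vpoly n) f * f1 * recip x ^ 4)"
  proof -
    have "vanishes_below 4 (recip x ^ 4)"
      using vanishes_below_power[OF recip_leading(2), of 4 x] by simp
    then have "vanishes_below 2 (rem n * f1 * recip x ^ 4)"
      by (rule vanishes_below_mult'[OF vanishes_below_mult[OF rem_vanishes f1_leading(1)]]) simp
    then show ?thesis
      by (simp add: eps_f1 left_diff_distrib Res_diff Res_vanishes)
  qed
  \<comment> \<open>12 = 2 * 2 * 3: a factor 3 and a factor 2 are consumed by two integrations by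
    parts, so nothing has to be divided.\<close>
  also have "- of_nat 12 * Res (peval (vpoly n) f * f1 * recip x ^ 4) =
      - 2 * (of_nat 2 * (of_nat 3 * Res (peval (vpoly n) f * f1 * recip x ^ 4)))"
    by simp
  also have "of_nat 3 * Res (peval (vpoly n) f * f1 * recip x ^ 4) = Res (peval (pder (vpoly n)) f * f1 * recip x ^ 3)"
    using Res_peval_recip_power[of 2 "vpoly n" x] by (simp add: eval_nat_numeral)
  also have "of_nat 2 * Res (peval (pder (vpoly n)) f * f1 * recip x ^ 3) =
      Res (peval (pder (pder (vpoly n))) f * f1 * recip x ^ 2)"
    using Res_peval_recip_power[of 1 "pder (vpoly n)" x] by (simp add: eval_nat_numeral)
  finally show ?thesis
    by (simp only: Res_peval_recip2)
qed

end

text \<open>z^(1-n) f' may be replaced by v_n(f), because the tail contributes only O(z^(-2)); what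
  is left is Cauchy's formula.\<close>

lemma Res_eps_recip: "Res (eps n * (f1 ^ 2 * recip x)) = poly (vpoly n) x"
  and Res_eps_recip2: "Res (eps n * (f1 ^ 2 * recip x ^ 2)) = poly (pder (vpoly n)) x"
proof -
  have van: "vanishes_below 2 (rem n * f1 * (recip x * c))" if "vanishes_below 0 c" for c
    by (rule vanishes_below_mult'[OF vanishes_below_mult[OF rem_vanishes f1_leading(1)]
          vanishes_below_mult[OF recip_leading(2) that]]) simp
  have *: "Res (eps n * (f1 ^ 2 * (recip x * c))) = Res (peval (vpoly n) f * f1 * (recip x * c))"
    if "vanishes_below 0 c" for c
  proof -
    have "eps n * (f1 ^ 2 * (recip x * c)) = (eps n * f1) * f1 * (recip x * c)"
      by (simp add: power2_eq_square mult_ac)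
    then show ?thesis
      using Res_vanishes[OF van[OF that]] by (simp only: eps_f1 left_diff_distrib Res_diff) simp
  qed
  show "Res (eps n * (f1 ^ 2 * recip x)) = poly (vpoly n) x"
    using *[of 1] by (simp add: Res_peval_recip)
  show "Res (eps n * (f1 ^ 2 * recip x ^ 2)) = poly (pder (vpoly n)) x"
    using *[of "recip x"] vanishes_below_mono[OF recip_leading(2), of 0] Res_peval_recip2[of "vpoly n" x]
    by (simp add: power2_eq_square)
qed

end

section \<open>Symmetry of second derivatives\<close>

lemma has_real_derivative_along_line:
  fixes h :: "'a::real_normed_vector \<Rightarrow> real"
  assumes "(h has_derivative h') (at (q + s *\<^sub>R u))"
  shows "((\<lambda>s. h (q + s *\<^sub>R u)) has_real_derivative h' u) (at s)"
proof -
  have "((\<lambda>s. q + s *\<^sub>R u) has_derivative (\<lambda>y. y *\<^sub>R u)) (at s)"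
    by (auto intro!: derivative_eq_intros)
  from diff_chain_at[OF this assms]
  have "((\<lambda>s. h (q + s *\<^sub>R u)) has_derivative (\<lambda>y. h' (y *\<^sub>R u))) (at s)"
    by (simp add: o_def)
  moreover have "h' (y *\<^sub>R u) = y * h' u" for y
    using linear_scale[OF has_derivative_linear[OF assms], of y u] by simp
  ultimately show ?thesis
    by (simp add: has_field_derivative_def mult_commute_abs)
qed

text \<open>The mean value theorem twice: in direction u for the difference between the two sides of
  the parallelogram, then in direction v for the derivative of h along u.\<close>

lemma second_difference_mean_value:
  fixes h :: "'a::real_normed_vector \<Rightarrow> real"
  assumes t: "t > 0"
    and in_S: "\<And>a b. 0 \<le> a \<Longrightarrow> a \<le> t \<Longrightarrow> 0 \<le> b \<Longrightarrow> b \<le> t \<Longrightarrow> p + a *\<^sub>R u + b *\<^sub>R v \<in> S"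
    and h: "\<And>q. q \<in> S \<Longrightarrow> (h has_derivative h' q) (at q)"
    and hu: "\<And>q. q \<in> S \<Longrightarrow> ((\<lambda>q. h' q u) has_derivative hu' q) (at q)"
  shows "\<exists>a b. 0 < a \<and> a < t \<and> 0 < b \<and> b < t \<and>
    h (p + t *\<^sub>R u + t *\<^sub>R v) - h (p + t *\<^sub>R u) - h (p + t *\<^sub>R v) + h p = t * (t * hu' (p + a *\<^sub>R u + b *\<^sub>R v) v)"
proof -
  have "\<exists>a>0. a < t \<and> (h (p + t *\<^sub>R v + t *\<^sub>R u) - h (p + t *\<^sub>R u)) - (h (p + t *\<^sub>R v + 0 *\<^sub>R u) - h (p + 0 *\<^sub>R u)) =
      (t - 0) * (h' (p + t *\<^sub>R v + a *\<^sub>R u) u - h' (p + a *\<^sub>R u) u)"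
  proof (rule MVT2[OF t])
    fix a assume a: "0 \<le> a" "a \<le> t"
    have "p + t *\<^sub>R v + a *\<^sub>R u \<in> S" "p + a *\<^sub>R u \<in> S"
      using in_S[of a t] in_S[of a 0] a t by (simp_all add: algebra_simps)
    then show "((\<lambda>a. h (p + t *\<^sub>R v + a *\<^sub>R u) - h (p + a *\<^sub>R u)) has_real_derivative
        h' (p + t *\<^sub>R v + a *\<^sub>R u) u - h' (p + a *\<^sub>R u) u) (at a)"
      by (intro DERIV_diff has_real_derivative_along_line h)
  qed
  then obtain a where a: "0 < a" "a < t" and
    1: "h (p + t *\<^sub>R u + t *\<^sub>R v) - h (p + t *\<^sub>R u) - h (p + t *\<^sub>R v) + h p =
      t * (h' (p + a *\<^sub>R u + t *\<^sub>R v) u - h' (p + a *\<^sub>R u) u)"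
    by (auto simp: algebra_simps)
  have "\<exists>b>0. b < t \<and> h' (p + a *\<^sub>R u + t *\<^sub>R v) u - h' (p + a *\<^sub>R u + 0 *\<^sub>R v) u =
      (t - 0) * hu' (p + a *\<^sub>R u + b *\<^sub>R v) v"
    using t a in_S hu by (intro MVT2 has_real_derivative_along_line) auto
  then show ?thesis
    using a 1 by auto
qed

text \<open>The second difference is symmetric in u and v; divided by t^2 it equals each mixed
  derivative at some point near p. Continuity brings both within half of the supposed gap of their
  values at p.\<close>

lemma second_derivative_symmetric_real:
  fixes h :: "'a::real_normed_vector \<Rightarrow> real"
  assumes S: "open S" "p \<in> S"
    and h: "\<And>q. q \<in> S \<Longrightarrow> (h has_derivative h' q) (at q)"
    and hu: "\<And>q. q \<in> S \<Longrightarrow> ((\<lambda>q. h' q u) has_derivative hu' q) (at q)"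
    and hv: "\<And>q. q \<in> S \<Longrightarrow> ((\<lambda>q. h' q v) has_derivative hv' q) (at q)"
    and cont: "continuous_on S (\<lambda>q. hu' q v)" "continuous_on S (\<lambda>q. hv' q u)"
  shows "hu' p v = hv' p u"
proof (rule ccontr)
  assume "hu' p v \<noteq> hv' p u"
  define e where "e = \<bar>hu' p v - hv' p u\<bar> / 2"
  have e: "e > 0" using \<open>hu' p v \<noteq> hv' p u\<close> by (simp add: e_def)
  obtain d1 where d1: "d1 > 0" "\<And>q. q \<in> S \<Longrightarrow> dist q p < d1 \<Longrightarrow> dist (hu' q v) (hu' p v) < e"
    using cont(1) S(2) e unfolding continuous_on_iff by blast
  obtain d2 where d2: "d2 > 0" "\<And>q. q \<in> S \<Longrightarrow> dist q p < d2 \<Longrightarrow> dist (hv' q u) (hv' p u) < e"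
    using cont(2) S(2) e unfolding continuous_on_iff by blast
  obtain d3 where d3: "d3 > 0" "ball p d3 \<subseteq> S"
    using S open_contains_ball by blast
  define d where "d = min d1 (min d2 d3)"
  \<comment> \<open>The summand 1 keeps the denominator positive for u = v = 0, and the
    parallelogram stays within distance \<open>d\<close> of p.\<close>
  define t where "t = d / (2 * (norm u + norm v + 1))"
  have n: "norm u + norm v + 1 > 0" by (simp add: add_nonneg_pos)
  have t: "t > 0" using d1 d2 d3 n by (simp add: t_def d_def)
  have close: "dist (p + a *\<^sub>R u + b *\<^sub>R v) p < d" if "0 \<le> a" "a \<le> t" "0 \<le> b" "b \<le> t" for a b
  proof -
    have "dist (p + a *\<^sub>R u + b *\<^sub>R v) p \<le> norm (a *\<^sub>R u) + norm (b *\<^sub>R v)"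
      unfolding dist_norm using norm_triangle_ineq[of "a *\<^sub>R u" "b *\<^sub>R v"] by (simp add: algebra_simps)
    also have "\<dots> \<le> t * norm u + t * norm v"
      using that by (auto intro!: add_mono mult_right_mono)
    also have "\<dots> < 2 * (t * (norm u + norm v + 1))"
    proof -
      have "t * norm u \<ge> 0" "t * norm v \<ge> 0" using t by simp_all
      then show ?thesis using t unfolding distrib_left by linarith
    qed
    also have "2 * (t * (norm u + norm v + 1)) = d"
      using n by (simp add: t_def field_simps)
    finally show ?thesis .
  qed
  have in_S: "p + a *\<^sub>R u + b *\<^sub>R v \<in> S" if "0 \<le> a" "a \<le> t" "0 \<le> b" "b \<le> t" for a b
    using close[OF that] d3(2) by (auto simp: d_def dist_commute subset_eq)
  obtain a b where ab: "0 < a" "a < t" "0 < b" "b < t" and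
    1: "h (p + t *\<^sub>R u + t *\<^sub>R v) - h (p + t *\<^sub>R u) - h (p + t *\<^sub>R v) + h p = t * (t * hu' (p + a *\<^sub>R u + b *\<^sub>R v) v)"
    using second_difference_mean_value[OF t in_S h hu] by blast
  have in_S': "p + a *\<^sub>R v + b *\<^sub>R u \<in> S" if "0 \<le> a" "a \<le> t" "0 \<le> b" "b \<le> t" for a b
    using in_S[of b a] that by (simp add: algebra_simps)
  obtain a' b' where ab': "0 < a'" "a' < t" "0 < b'" "b' < t" and
    2: "h (p + t *\<^sub>R v + t *\<^sub>R u) - h (p + t *\<^sub>R v) - h (p + t *\<^sub>R u) + h p = t * (t * hv' (p + a' *\<^sub>R v + b' *\<^sub>R u) u)"
    using second_difference_mean_value[OF t in_S' h hv] by blast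
  have 3: "p + t *\<^sub>R v + t *\<^sub>R u = p + t *\<^sub>R u + t *\<^sub>R v"
    by (simp add: algebra_simps)
  have "t * (t * hu' (p + a *\<^sub>R u + b *\<^sub>R v) v) = t * (t * hv' (p + a' *\<^sub>R v + b' *\<^sub>R u) u)"
    using 1 2[unfolded 3] by linarith
  then have eq: "hu' (p + a *\<^sub>R u + b *\<^sub>R v) v = hv' (p + a' *\<^sub>R v + b' *\<^sub>R u) u"
    using t by simp
  have "dist (hu' (p + a *\<^sub>R u + b *\<^sub>R v) v) (hu' p v) < e"
    using ab close[of a b] in_S[of a b] by (intro d1(2)) (auto simp: d_def)
  moreover have "dist (hv' (p + a' *\<^sub>R v + b' *\<^sub>R u) u) (hv' p u) < e"
    using ab' close[of b' a'] in_S'[of a' b'] by (intro d2(2)) (auto simp: d_def algebra_simps)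
  ultimately have "dist (hu' p v) (hv' p u) < e + e"
    unfolding eq by (metis dist_commute dist_triangle_less_add)
  then show False
    by (simp add: e_def dist_real_def)
qed

lemma smooth_on_differentiable:
  "smooth_on S g \<Longrightarrow> p \<in> S \<Longrightarrow> (g has_derivative frechet_derivative g (at p)) (at p)"
  unfolding smooth_on_def using higher_differentiable_on.simps(2)[of 0 S g] frechet_derivative_works by blast

lemma smooth_on_continuous: "smooth_on S g \<Longrightarrow> continuous_on S g"
  unfolding smooth_on_def using higher_differentiable_on.simps(1) by blast

text \<open>The mean value argument is for real functions, so real and imaginary parts are treated
  separately.\<close>

lemma frechet_derivative_commute:
  fixes g :: "'a::real_normed_vector \<Rightarrow> complex"
  assumes S: "open S" "p \<in> S" and g: "smooth_on S g"
  shows "frechet_derivative (\<lambda>q. frechet_derivative g (at q) u) (at p) v =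
    frechet_derivative (\<lambda>q. frechet_derivative g (at q) v) (at p) u"
proof -
  let ?gu = "\<lambda>q. frechet_derivative g (at q) u" and ?gv = "\<lambda>q. frechet_derivative g (at q) v"
  have smooth: "smooth_on S ?gu" "smooth_on S ?gv"
    by (intro smooth_on_frechet_derivative g)+
  have "B (frechet_derivative ?gu (at p) v) = B (frechet_derivative ?gv (at p) u)"
    if B: "bounded_linear (B :: complex \<Rightarrow> real)" for B
  proof (rule second_derivative_symmetric_real[OF S, of "\<lambda>q. B (g q)" "\<lambda>q w. B (frechet_derivative g (at q) w)"])
    show "((\<lambda>q. B (g q)) has_derivative (\<lambda>w. B (frechet_derivative g (at q) w))) (at q)" if "q \<in> S" for q
      by (intro bounded_linear.has_derivative[OF B] smooth_on_differentiable[OF g that])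
    show "((\<lambda>q. B (?gu q)) has_derivative (\<lambda>w. B (frechet_derivative ?gu (at q) w))) (at q)" if "q \<in> S" for q
      by (intro bounded_linear.has_derivative[OF B] smooth_on_differentiable[OF smooth(1) that])
    show "((\<lambda>q. B (?gv q)) has_derivative (\<lambda>w. B (frechet_derivative ?gv (at q) w))) (at q)" if "q \<in> S" for q
      by (intro bounded_linear.has_derivative[OF B] smooth_on_differentiable[OF smooth(2) that])
    show "continuous_on S (\<lambda>q. B (frechet_derivative ?gu (at q) v))"
      "continuous_on S (\<lambda>q. B (frechet_derivative ?gv (at q) u))"
      by (intro bounded_linear.continuous_on[OF B] smooth_on_continuous smooth_on_frechet_derivative smooth)+
  qed
  from this[OF bounded_linear_Re] this[OF bounded_linear_Im] show ?thesis
    by (rule complex_eqI)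
qed


section \<open>Derivations of the function space\<close>

lemma smooth_fun_eqI:
  assumes "\<And>p. p \<in> chamber \<Longrightarrow> Rep_smooth_fun g p = Rep_smooth_fun h p"
  shows "g = h"
proof -
  have "Rep_smooth_fun g p = Rep_smooth_fun h p" for p
    using assms by (cases "p \<in> chamber") (simp_all add: Rep_smooth_fun_outside)
  then show ?thesis
    by (simp add: fun_eq_iff flip: Rep_smooth_fun_inject)
qed

lemma Rep_smooth_fun_sum: "Rep_smooth_fun (sum u I) p = (\<Sum>i\<in>I. Rep_smooth_fun (u i) p)"
  by (induction I rule: infinite_finite_induct) (simp_all add: zero_smooth_fun.rep_eq plus_smooth_fun.rep_eq)

lemma smooth_on_Rep_smooth_fun: "smooth_on chamber (Rep_smooth_fun g)"
  using Rep_smooth_fun[of g] by simp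

lemma Rep_smooth_fun_has_derivative:
  "p \<in> chamber \<Longrightarrow> (Rep_smooth_fun g has_derivative frechet_derivative (Rep_smooth_fun g) (at p)) (at p)"
  by (rule smooth_on_differentiable[OF smooth_on_Rep_smooth_fun])

text \<open>Representatives are cut off to 0 outside the chamber, but the chamber is open, so a
  formula valid inside determines the derivatives there.\<close>

lemma Rep_pderiv_smooth_eqI:
  assumes p: "p \<in> chamber" and D: "(k has_derivative k') (at p)"
    and eq: "\<And>q. q \<in> chamber \<Longrightarrow> Rep_smooth_fun g q = k q"
  shows "Rep_smooth_fun (pderiv_smooth i g) p = k' (axis i 1)"
proof -
  have "(Rep_smooth_fun g has_derivative k') (at p)"
    by (rule has_derivative_transform_within_open[OF D open_chamber p]) (simp add: eq)
  then show ?thesis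
    using p by (simp add: pderiv_smooth.rep_eq flip: frechet_derivative_at)
qed

lemma derivation_pderiv_smooth: "derivation (pderiv_smooth i)"
proof (rule derivationI; rule smooth_fun_eqI)
  fix g h :: "'a smooth_fun" and p :: "(real, 'a) vec"
  assume p: "p \<in> chamber"
  note D = Rep_smooth_fun_has_derivative[OF p]
  show "Rep_smooth_fun (pderiv_smooth i (g + h)) p = Rep_smooth_fun (pderiv_smooth i g + pderiv_smooth i h) p"
    using p by (subst Rep_pderiv_smooth_eqI[OF p has_derivative_add[OF D D]])
      (simp_all add: plus_smooth_fun.rep_eq pderiv_smooth.rep_eq)
  show "Rep_smooth_fun (pderiv_smooth i (g * h)) p =
      Rep_smooth_fun (pderiv_smooth i g * h + g * pderiv_smooth i h) p"
    using p by (subst Rep_pderiv_smooth_eqI[OF p has_derivative_mult[OF D D]])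
      (simp_all add: plus_smooth_fun.rep_eq times_smooth_fun.rep_eq pderiv_smooth.rep_eq add.commute)
qed

lemma pderiv_smooth_commute: "pderiv_smooth i (pderiv_smooth j g) = pderiv_smooth j (pderiv_smooth i g)"
proof (rule smooth_fun_eqI)
  fix p :: "(real, 'a) vec" assume p: "p \<in> chamber"
  let ?D = "\<lambda>w q. frechet_derivative (Rep_smooth_fun g) (at q) w"
  have *: "Rep_smooth_fun (pderiv_smooth i (pderiv_smooth j g)) p =
      frechet_derivative (?D (axis j 1)) (at p) (axis i 1)" for i j
    by (rule Rep_pderiv_smooth_eqI[OF p smooth_on_differentiable[OF smooth_on_frechet_derivative[OF smooth_on_Rep_smooth_fun] p]])
       (simp add: pderiv_smooth.rep_eq)
  show "Rep_smooth_fun (pderiv_smooth i (pderiv_smooth j g)) p = Rep_smooth_fun (pderiv_smooth j (pderiv_smooth i g)) p"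
    unfolding * by (rule frechet_derivative_commute[OF open_chamber p smooth_on_Rep_smooth_fun])
qed

lemma pderiv_smooth_const: "pderiv_smooth i (const_smooth c) = 0"
  by (rule smooth_fun_eqI, subst Rep_pderiv_smooth_eqI[OF _ has_derivative_const])
     (auto simp: Rep_const_smooth zero_smooth_fun.rep_eq)

lemma pderiv_smooth_coord: "pderiv_smooth i (coord_smooth j) = (if i = j then 1 else 0)"
proof (rule smooth_fun_eqI)
  fix p :: "(real, 'a) vec" assume p: "p \<in> chamber"
  have "((\<lambda>p. complex_of_real (p $ j)) has_derivative (\<lambda>q. complex_of_real (q $ j))) (at p)"
    by (intro bounded_linear.has_derivative[OF bounded_linear_of_real]
        bounded_linear_imp_has_derivative bounded_linear_vec_nth)
  from Rep_pderiv_smooth_eqI[OF p this, of "coord_smooth j" i]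
  show "Rep_smooth_fun (pderiv_smooth i (coord_smooth j)) p = Rep_smooth_fun (if i = j then 1 else 0) p"
    using p by (auto simp: Rep_coord_smooth axis_def one_smooth_fun.rep_eq zero_smooth_fun.rep_eq)
qed

section \<open>Derivations of the polynomial algebra over the smooth functions\<close>

lemma poly_mapping_single_induct [case_names zero add]:
  assumes "P 0" "\<And>p \<mu> c. P p \<Longrightarrow> P (p + Poly_Mapping.single \<mu> c)"
  shows "P (p :: 'a \<Rightarrow>\<^sub>0 'b::comm_monoid_add)"
proof (induction p rule: Poly_Mapping.update_induct)
  case (update f a b)
  have "Poly_Mapping.update a b f = f + Poly_Mapping.single a b"
    using update(1)
    by (intro poly_mapping_eqI) (auto simp: lookup_update lookup_add lookup_single when_def in_keys_iff)
  with assms(2)[OF update(3)] show ?case by simp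
qed (rule assms(1))

lemma derivation_fockI:
  fixes d :: "'i::{finite,linorder} fock \<Rightarrow> 'i fock"
  assumes add: "\<And>P Q. d (P + Q) = d P + d Q"
    and single: "\<And>\<mu> \<nu> a b. d (Poly_Mapping.single \<mu> a * Poly_Mapping.single \<nu> b) =
      d (Poly_Mapping.single \<mu> a) * Poly_Mapping.single \<nu> b + Poly_Mapping.single \<mu> a * d (Poly_Mapping.single \<nu> b)"
  shows "derivation d"
proof (rule derivationI[OF add])
  have 0: "d 0 = 0"
    using add[of 0 0] by simp
  have 1: "d (P * Poly_Mapping.single \<nu> b) = d P * Poly_Mapping.single \<nu> b + P * d (Poly_Mapping.single \<nu> b)" for P \<nu> b
    by (induction P rule: poly_mapping_single_induct) (simp_all add: 0 add single algebra_simps)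
  show "d (P * Q) = d P * Q + P * d Q" for P Q
    by (induction Q rule: poly_mapping_single_induct) (simp_all add: 0 add 1 algebra_simps)
qed

text \<open>All smooth functions count as generators here, since coordinates alone do not generate
  them. Monomials are products of powers of the \<open>fvar k\<close>, so the Leibniz rule does the
  rest.\<close>

lemma derivation_fock_eq_0I:
  fixes d :: "'i::{finite,linorder} fock \<Rightarrow> 'i fock"
  assumes d: "derivation d" and coeff: "\<And>g. d (fcoeff g) = 0" and var: "\<And>k. d (fvar k) = 0"
  shows "d P = 0"
proof -
  have mono: "d (Poly_Mapping.single \<mu> 1) = 0" for \<mu>
  proof (induction \<mu> rule: poly_mapping_single_induct)
    case zero
    then show ?case by (simp add: derivation_1[OF d])
  next
    case (add \<mu> k n)
    have "Poly_Mapping.single (Poly_Mapping.single k n) (1 :: 'i smooth_fun) = fvar k ^ n"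
    proof (induction n)
      case (Suc n)
      have "Poly_Mapping.single k (Suc n) = Poly_Mapping.single k 1 + Poly_Mapping.single k n"
        by (simp flip: single_add)
      then show ?case
        unfolding power_Suc Suc.IH[symmetric] by (simp only: fvar_def mult_single mult_1)
    qed simp
    then have "Poly_Mapping.single (\<mu> + Poly_Mapping.single k n) 1 = (Poly_Mapping.single \<mu> 1 * fvar k ^ n :: 'i fock)"
      by (metis mult_single mult_1_right)
    then show ?case
      by (simp add: derivation_mult[OF d] derivation_power[OF d] var add.IH)
  qed
  have "d (Poly_Mapping.single \<mu> c) = 0" for \<mu> c
  proof -
    have "Poly_Mapping.single \<mu> c = fcoeff c * Poly_Mapping.single \<mu> 1"
      by (simp add: fcoeff_def mult_single)
    then show ?thesis
      by (simp add: derivation_mult[OF d] coeff mono)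
  qed
  then show ?thesis
    by (induction P rule: poly_mapping_single_induct) (simp_all add: derivation_0[OF d] derivation_add[OF d])
qed

lemma derivation_fock_eqI:
  fixes d e :: "'i::{finite,linorder} fock \<Rightarrow> 'i fock"
  assumes "derivation d" "derivation e"
    and "\<And>g. d (fcoeff g) = e (fcoeff g)" "\<And>k. d (fvar k) = e (fvar k)"
  shows "d P = e P"
  using derivation_fock_eq_0I[OF derivation_diff_fun[OF assms(1,2)], of P] assms(3,4) by simp

lemma fcoeff_hom:
  "fcoeff (g + h) = fcoeff g + fcoeff h" "fcoeff (g * h) = fcoeff g * fcoeff h"
  "fcoeff 0 = 0" "fcoeff 1 = 1" "fcoeff (- g) = - fcoeff g"
  by (simp_all add: fcoeff_def single_add mult_single single_uminus)

lemma fcoeff_sum: "fcoeff (sum u I) = (\<Sum>i\<in>I. fcoeff (u i))"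
  by (induction I rule: infinite_finite_induct) (simp_all add: fcoeff_hom)

lemma lookup_pderiv_coord: "Poly_Mapping.lookup (pderiv_coord i P) \<mu> = pderiv_smooth i (Poly_Mapping.lookup P \<mu>)"
  unfolding pderiv_coord_def
  by (simp add: Poly_Mapping.map.rep_eq when_def derivation_0[OF derivation_pderiv_smooth])

lemma pderiv_coord_single: "pderiv_coord i (Poly_Mapping.single \<mu> g) = Poly_Mapping.single \<mu> (pderiv_smooth i g)"
  by (rule poly_mapping_eqI)
     (simp add: lookup_pderiv_coord lookup_single when_def derivation_0[OF derivation_pderiv_smooth])

lemma pderiv_coord_fcoeff: "pderiv_coord i (fcoeff g) = fcoeff (pderiv_smooth i g)"
  by (simp add: fcoeff_def pderiv_coord_single)

lemma pderiv_coord_fvar: "pderiv_coord i (fvar k) = 0"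
  by (simp add: fvar_def pderiv_coord_single derivation_1[OF derivation_pderiv_smooth])

lemma derivation_pderiv_coord: "derivation (pderiv_coord i)"
proof (rule derivation_fockI)
  show "pderiv_coord i (P + Q) = pderiv_coord i P + pderiv_coord i Q" for P Q
    by (rule poly_mapping_eqI) (simp add: lookup_pderiv_coord lookup_add derivation_add[OF derivation_pderiv_smooth])
qed (simp add: pderiv_coord_single mult_single derivation_mult[OF derivation_pderiv_smooth] single_add)

lemma pderiv_var_single:
  "pderiv_var k (Poly_Mapping.single \<mu> g) =
    Poly_Mapping.single (\<mu> - Poly_Mapping.single k 1) (of_nat (Poly_Mapping.lookup \<mu> k) * g)"
  by (cases "g = 0") (simp_all add: pderiv_var_def)

lemma pderiv_var_fcoeff: "pderiv_var k (fcoeff g) = 0"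
  by (simp add: fcoeff_def pderiv_var_single)

lemma pderiv_var_fvar: "pderiv_var k (fvar j) = (if k = j then 1 else 0)"
  by (simp add: fvar_def pderiv_var_single lookup_single when_def)

lemma derivation_pderiv_var: "derivation (pderiv_var k)"
proof (rule derivation_fockI)
  show "pderiv_var k (P + Q) = pderiv_var k P + pderiv_var k Q" for P Q
    unfolding pderiv_var_def
    by (rule setsum_keys_plus_distrib) (simp_all add: distrib_left single_add)
next
  fix \<mu> \<nu> :: "nat \<Rightarrow>\<^sub>0 nat" and a b :: "'a smooth_fun"
  let ?e = "Poly_Mapping.single k 1 :: nat \<Rightarrow>\<^sub>0 nat"
  \<comment> \<open>Subtraction of exponents is truncated, so the two monomials may differ when the
    variable is absent from \<open>\<mu>\<close>; but then the coefficient is 0.\<close>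
  have shift: "Poly_Mapping.single (\<mu> + \<nu> - ?e) (of_nat (Poly_Mapping.lookup \<mu> k) * c) =
      Poly_Mapping.single (\<mu> - ?e + \<nu>) (of_nat (Poly_Mapping.lookup \<mu> k) * c)" for \<mu> \<nu> and c :: "'a smooth_fun"
  proof (cases "Poly_Mapping.lookup \<mu> k = 0")
    case False
    then have "\<mu> + \<nu> - ?e = \<mu> - ?e + \<nu>"
      by (intro poly_mapping_eqI) (auto simp: lookup_add lookup_minus lookup_single when_def)
    then show ?thesis by simp
  qed simp
  show "pderiv_var k (Poly_Mapping.single \<mu> a * Poly_Mapping.single \<nu> b) =
      pderiv_var k (Poly_Mapping.single \<mu> a) * Poly_Mapping.single \<nu> b
      + Poly_Mapping.single \<mu> a * pderiv_var k (Poly_Mapping.single \<nu> b)"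
    using shift[of \<mu> \<nu> "a * b"] shift[of \<nu> \<mu> "a * b"]
    by (simp add: mult_single pderiv_var_single lookup_add distrib_right distrib_left single_add mult_ac add.commute)
qed

lemma finite_pderiv_var: "finite {k. pderiv_var k P \<noteq> 0}"
proof (rule finite_subset)
  show "{k. pderiv_var k P \<noteq> 0} \<subseteq> (\<Union>\<mu>\<in>Poly_Mapping.keys P. Poly_Mapping.keys \<mu>)"
  proof safe
    fix k assume "pderiv_var k P \<noteq> 0"
    then obtain \<mu> where "\<mu> \<in> Poly_Mapping.keys P" "Poly_Mapping.lookup \<mu> k \<noteq> 0"
      unfolding pderiv_var_def by (metis (no_types, lifting) mult_zero_left of_nat_0 single_zero sum.neutral)
    then show "k \<in> (\<Union>\<mu>\<in>Poly_Mapping.keys P. Poly_Mapping.keys \<mu>)"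
      by (auto simp: in_keys_iff)
  qed
qed auto

text \<open>Infinitely many nonzero \<open>\<alpha> k\<close> are allowed, because each P involves
  only finitely many variables.\<close>

definition vfield ::
  "(nat \<Rightarrow> 'i fock) \<Rightarrow> ('i \<Rightarrow> 'i fock) \<Rightarrow> 'i::{finite,linorder} fock \<Rightarrow> 'i fock" where
  "vfield \<alpha> \<beta> P = Sum_any (\<lambda>k. \<alpha> k * pderiv_var k P) + (\<Sum>i\<in>UNIV. \<beta> i * pderiv_coord i P)"

lemma vfield_eq_sum:
  assumes "finite F" "{k. pderiv_var k P \<noteq> 0} \<subseteq> F"
  shows "vfield \<alpha> \<beta> P = (\<Sum>k\<in>F. \<alpha> k * pderiv_var k P) + (\<Sum>i\<in>UNIV. \<beta> i * pderiv_coord i P)"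
  unfolding vfield_def
  by (subst Sum_any.expand_superset[OF assms(1)]) (use assms(2) in auto)

lemma derivation_vfield: "derivation (vfield \<alpha> \<beta>)"
proof -
  have "vfield \<alpha> \<beta> (P + Q) = vfield \<alpha> \<beta> P + vfield \<alpha> \<beta> Q \<and>
      vfield \<alpha> \<beta> (P * Q) = vfield \<alpha> \<beta> P * Q + P * vfield \<alpha> \<beta> Q" for P Q
  proof -
    define F where "F = {k. pderiv_var k P \<noteq> 0} \<union> {k. pderiv_var k Q \<noteq> 0}"
    have F: "finite F" by (simp add: F_def finite_pderiv_var)
    have PF: "{k. pderiv_var k P \<noteq> 0} \<subseteq> F" and QF: "{k. pderiv_var k Q \<noteq> 0} \<subseteq> F"
      by (auto simp: F_def)
    have add: "{k. pderiv_var k (P + Q) \<noteq> 0} \<subseteq> F" and mult: "{k. pderiv_var k (P * Q) \<noteq> 0} \<subseteq> F"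
      by (auto simp: F_def derivation_add[OF derivation_pderiv_var] derivation_mult[OF derivation_pderiv_var])
    note eq = vfield_eq_sum[OF F PF] vfield_eq_sum[OF F QF] vfield_eq_sum[OF F add] vfield_eq_sum[OF F mult]
    show ?thesis
      unfolding eq
      by (simp add: derivation_add[OF derivation_pderiv_var] derivation_mult[OF derivation_pderiv_var]
          derivation_add[OF derivation_pderiv_coord] derivation_mult[OF derivation_pderiv_coord]
          algebra_simps sum.distrib sum_distrib_left sum_distrib_right)
  qed
  then show ?thesis
    by (intro derivationI) auto
qed

lemma vfield_fvar: "vfield \<alpha> \<beta> (fvar k) = \<alpha> k"
  by (subst vfield_eq_sum[of "{k}"]) (auto simp: pderiv_var_fvar pderiv_coord_fvar)

lemma vfield_fcoeff: "vfield \<alpha> \<beta> (fcoeff g) = (\<Sum>i\<in>UNIV. \<beta> i * fcoeff (pderiv_smooth i g))"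
  by (subst vfield_eq_sum[of "{}"]) (auto simp: pderiv_var_fcoeff pderiv_coord_fcoeff)

text \<open>Not automatic for a \<open>derivation\<close>, which is merely additive: complex
  constants vanish because the coordinate derivatives kill them.\<close>

lemma vfield_fconst: "vfield \<alpha> \<beta> (fconst c) = 0"
  by (simp add: vfield_fcoeff pderiv_smooth_const fcoeff_hom)

lemma vfield_fcoord: "vfield \<alpha> \<beta> (fcoord i) = \<beta> i"
proof -
  have "\<beta> j * fcoeff (pderiv_smooth j (coord_smooth i)) = (if j = i then \<beta> j else 0)" for j
    by (simp add: pderiv_smooth_coord fcoeff_hom)
  then show ?thesis
    by (simp only: vfield_fcoeff) simp
qed

text \<open>Both sides are derivations, so generators suffice. On a smooth function the second-order
  terms cancel by \<open>pderiv_smooth_commute\<close>, the point where symmetry of second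
  derivatives enters.\<close>

lemma vfield_commutator:
  "vfield \<alpha> \<beta> (vfield \<alpha>' \<beta>' P) - vfield \<alpha>' \<beta>' (vfield \<alpha> \<beta> P) =
    vfield (\<lambda>k. vfield \<alpha> \<beta> (\<alpha>' k) - vfield \<alpha>' \<beta>' (\<alpha> k)) (\<lambda>i. vfield \<alpha> \<beta> (\<beta>' i) - vfield \<alpha>' \<beta>' (\<beta> i)) P"
proof (rule derivation_fock_eqI[where P = P
      and d = "\<lambda>P. vfield \<alpha> \<beta> (vfield \<alpha>' \<beta>' P) - vfield \<alpha>' \<beta>' (vfield \<alpha> \<beta> P)"])
  show "derivation (\<lambda>P. vfield \<alpha> \<beta> (vfield \<alpha>' \<beta>' P) - vfield \<alpha>' \<beta>' (vfield \<alpha> \<beta> P))"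
    by (intro derivation_commutator derivation_vfield)
  fix g :: "'a smooth_fun"
  have twice: "vfield \<alpha> \<beta> (vfield \<alpha>' \<beta>' (fcoeff g)) =
      (\<Sum>i\<in>UNIV. vfield \<alpha> \<beta> (\<beta>' i) * fcoeff (pderiv_smooth i g)) +
      (\<Sum>i\<in>UNIV. \<Sum>j\<in>UNIV. \<beta>' i * \<beta> j * fcoeff (pderiv_smooth j (pderiv_smooth i g)))" for \<alpha> \<beta> \<alpha>' \<beta>'
    unfolding vfield_fcoeff[of \<alpha>' \<beta>']
    by (simp add: derivation_sum[OF derivation_vfield] derivation_mult[OF derivation_vfield]
        vfield_fcoeff[of \<alpha> \<beta>] sum.distrib sum_distrib_left mult.assoc)
  have "(\<Sum>i\<in>UNIV. \<Sum>j\<in>UNIV. \<beta>' i * \<beta> j * fcoeff (pderiv_smooth j (pderiv_smooth i g))) =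
      (\<Sum>i\<in>UNIV. \<Sum>j\<in>UNIV. \<beta> i * \<beta>' j * fcoeff (pderiv_smooth j (pderiv_smooth i g)))"
    by (subst sum.swap) (intro sum.cong refl, subst pderiv_smooth_commute, simp add: mult_ac)
  then show "vfield \<alpha> \<beta> (vfield \<alpha>' \<beta>' (fcoeff g)) - vfield \<alpha>' \<beta>' (vfield \<alpha> \<beta> (fcoeff g)) =
    vfield (\<lambda>k. vfield \<alpha> \<beta> (\<alpha>' k) - vfield \<alpha>' \<beta>' (\<alpha> k)) (\<lambda>i. vfield \<alpha> \<beta> (\<beta>' i) - vfield \<alpha>' \<beta>' (\<beta> i)) (fcoeff g)"
    unfolding twice vfield_fcoeff[of "\<lambda>k. vfield \<alpha> \<beta> (\<alpha>' k) - vfield \<alpha>' \<beta>' (\<alpha> k)"]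
    by (simp add: left_diff_distrib sum_subtractf)
qed (simp_all add: derivation_vfield vfield_fvar)

lemma vfield_scale: "c * vfield \<alpha> \<beta> P = vfield (\<lambda>k. c * \<alpha> k) (\<lambda>i. c * \<beta> i) P"
  by (subst (1 2) vfield_eq_sum[OF finite_pderiv_var order_refl]) (simp add: distrib_left sum_distrib_left mult.assoc)

lemma vfield_add: "vfield \<alpha> \<beta> P + vfield \<alpha>' \<beta>' P = vfield (\<lambda>k. \<alpha> k + \<alpha>' k) (\<lambda>i. \<beta> i + \<beta>' i) P"
  by (subst (1 2 3) vfield_eq_sum[OF finite_pderiv_var order_refl]) (simp add: distrib_right sum.distrib)

lemma pderiv_coord_eq_vfield: "pderiv_coord i P = vfield (\<lambda>_. 0) (\<lambda>j. if j = i then 1 else 0) P"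
  by (subst vfield_eq_sum[OF finite_pderiv_var order_refl]) (simp add: if_distrib[of "\<lambda>x. x * _"] cong: if_cong)

lemma fock_torsion_free:
  fixes P :: "'i::{finite,linorder} fock"
  assumes "of_nat (Suc n) * P = 0"
  shows "P = 0"
proof -
  have 0: "fconst 0 = (0 :: 'i fock)"
    using fconst_hom(1)[of 0 0, where 'i = 'i] by simp
  have of_nat: "of_nat m = (fconst (of_nat m) :: 'i fock)" for m
    by (induction m) (simp_all add: fconst_hom 0)
  have "fconst (1 / of_nat (Suc n)) * of_nat (Suc n) = (1 :: 'i fock)"
    unfolding of_nat fconst_hom(2)[symmetric] by (simp add: fconst_hom del: of_nat_Suc)
  then have "P = fconst (1 / of_nat (Suc n)) * (of_nat (Suc n) * P)"
    by (simp only: mult.assoc[symmetric] mult_1_left)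
  then show ?thesis
    unfolding assms by simp
qed

lemma map_poly_pder:
  assumes d: "derivation d"
  shows "map_poly d (pder p) = pder (map_poly d p)"
  by (rule poly_eqI)
     (simp add: coeff_map_poly derivation_0[OF d] coeff_pder derivation_mult[OF d] derivation_add[OF d]
       derivation_1[OF d] derivation_of_nat[OF d])

text \<open>The point x moves along with f, and the resulting chain-rule terms match the product
  terms in \<open>vpoly_commutator\<close>.\<close>

lemma (in formal_map) vpoly_pder_commutator:
  assumes d: "derivation d" and e: "derivation e"
    and df: "fls_map d f = rem n" and ef: "fls_map e f = rem m"
    and dx: "d x = poly (vpoly n) x" and ex: "e x = poly (vpoly m) x"
  shows "d (poly (vpoly m) x) - e (poly (vpoly n) x) = of_int (n - m) * poly (vpoly (n + m)) x"
    and "d (poly (pder (vpoly m)) x) - e (poly (pder (vpoly n)) x) =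
      of_int (n - m) * poly (pder (vpoly (n + m))) x"
proof -
  note comm = vpoly_commutator[OF d e df ef]
  show "d (poly (vpoly m) x) - e (poly (vpoly n) x) = of_int (n - m) * poly (vpoly (n + m)) x"
    using arg_cong[OF comm, of "\<lambda>p. poly p x"]
    by (simp add: derivation_poly[OF d] derivation_poly[OF e] dx ex algebra_simps)
  show "d (poly (pder (vpoly m)) x) - e (poly (pder (vpoly n)) x) =
      of_int (n - m) * poly (pder (vpoly (n + m))) x"
    using arg_cong[OF comm, of "\<lambda>p. poly (pder p) x",
        unfolded pder_add derivation_diff[OF derivation_pder] pder_mult pder_smult]
    by (simp add: derivation_poly[OF d] derivation_poly[OF e] dx ex map_poly_pder[OF d] map_poly_pder[OF e]
        algebra_simps)
qed

text \<open>Meant for the coordinate derivatives. A derivation that fixes f changes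
  \<open>rem n\<close> by a polynomial in f which is O(1/z), hence by 0.\<close>

lemma (in formal_map) fls_map_eq_0:
  assumes d: "derivation d" and df: "fls_map d f = 0"
  shows "map_poly d (vpoly n) = 0" "fls_map d (rem n) = 0" "2 * \<theta> = 3 \<Longrightarrow> d (Res (eps n * schw \<theta>)) = 0"
proof -
  have rem: "fls_map d (rem n) = peval (map_poly d (vpoly n)) f"
    by (simp add: fls_map_rem[OF d] df dz_simps)
  moreover have "vanishes_below 1 (fls_map d (rem n))"
    by (intro vanishes_below_fls_map rem_vanishes derivation_0 d)
  ultimately show 0: "map_poly d (vpoly n) = 0"
    by (intro poly_eq_0_if_vanishes_below) simp
  show "fls_map d (rem n) = 0"
    using rem by (simp add: 0)
  show "d (Res (eps n * schw \<theta>)) = 0" if "2 * \<theta> = 3"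
    unfolding Res_fls_map[OF d, symmetric] derivation_mult[OF derivation_fls_map[OF d]]
    by (simp add: fls_map_zpow[OF d] fls_map_schw[OF that d] df Df_def dz_simps)
qed


section \<open>The Virasoro representation\<close>

interpretation fs: formal_map "fvar :: nat \<Rightarrow> 'i::{finite,linorder} fock"
  by unfold_locales (rule fock_torsion_free)

abbreviation fr :: "real \<Rightarrow> 'i::{finite,linorder} fock" where
  "fr a \<equiv> fconst (complex_of_real a)"

lemma fconst_of_nat: "fconst (of_nat n) = of_nat n"
proof (induction n)
  case 0
  show ?case
    using fconst_hom(1)[of 0 0] by simp
qed (simp add: fconst_hom)

lemma fconst_numeral: "fconst (numeral k) = numeral k"
  using fconst_of_nat[of "numeral k"] by simp

lemma fconst_uminus: "fconst (- a) = - fconst a"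
proof -
  have "fconst a + fconst (- a) = fconst 0"
    by (simp flip: fconst_hom)
  also have "\<dots> = 0"
    using fconst_of_nat[of 0] by simp
  finally show ?thesis
    by (simp add: eq_neg_iff_add_eq_0 add.commute)
qed

lemma fconst_of_int: "fconst (of_int n) = of_int n"
  by (cases n) (simp_all add: fconst_of_nat fconst_uminus fconst_hom del: of_nat_Suc)

lemma fr_hom:
  "fr (a + b) = fr a + fr b" "fr (a * b) = fr a * fr b" "fr 1 = 1" "fr (numeral k) = numeral k"
  "fr (- a) = - fr a" "fr (a - b) = fr a - fr b" "fr 0 = 0"
  using fconst_of_nat[of "numeral k"] fconst_of_nat[of 0]
    fconst_hom(1)[of "complex_of_real a" "- complex_of_real b"]
  by (simp_all add: fconst_hom fconst_uminus)

lemma two_fr_three_halves: "2 * fconst (3 / 2) = (3 :: 'i::{finite,linorder} fock)"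
proof -
  have "fconst 2 * fconst (3 / 2) = (fconst 3 :: 'i fock)"
    by (simp flip: fconst_hom)
  then show ?thesis
    by (simp add: fconst_numeral)
qed

lemma schwarzian_eq: "schwarzian = fs.schw (fconst (3 / 2))"
  by (simp add: schwarzian_def fs.schw_def)

text \<open>Index k + 1 belongs to z^(-1-k), whose coefficient in f is f_m with m = -2 - k. The
  bound on g says that the normalisation of f is preserved.\<close>

lemma fls_map_vfield_f_ser:
  assumes "vanishes_below 1 g" "\<And>k. \<alpha> k = fls_nth g (int k + 1)"
  shows "fls_map (vfield \<alpha> \<beta>) f_ser = g"
proof (rule fls_eqI)
  fix n :: int
  have 0: "vfield \<alpha> \<beta> 0 = 0" "vfield \<alpha> \<beta> 1 = 0"
    by (simp_all add: derivation_0[OF derivation_vfield] derivation_1[OF derivation_vfield])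
  consider "n = - 1" | "n \<ge> 1" | "n < 1" "n \<noteq> - 1" by linarith
  then show "fls_nth (fls_map (vfield \<alpha> \<beta>) f_ser) n = fls_nth g n"
    using assms(1) by cases (simp_all add: fls_map_nth 0 f_series_nth vfield_fvar assms(2) vanishes_belowD)
qed

definition vir_field :: "int \<Rightarrow> 'i::{finite,linorder} fock \<Rightarrow> 'i fock" where
  "vir_field n = vfield (\<lambda>k. fls_nth (fs.rem n) (int k + 1)) (\<lambda>i. poly (fs.vpoly n) (fcoord i))"

definition vir_weight ::
  "real \<Rightarrow> 'i set \<Rightarrow> ('i \<Rightarrow> real) \<Rightarrow> ('i \<Rightarrow> real) \<Rightarrow> int \<Rightarrow> 'i::{finite,linorder} fock" where
  "vir_weight c X hx hy n = fr (c / 12) * Res (zpow (1 - n) * schwarzian)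
     + (\<Sum>i\<in>UNIV. fr (if i \<in> X then hx i else hy i) * poly (pder (fs.vpoly n)) (fcoord i))"

lemma derivation_vir_field: "derivation (vir_field n)"
  by (simp add: vir_field_def derivation_vfield)

lemma vir_field_f_ser: "fls_map (vir_field n) f_ser = fs.rem n"
  unfolding vir_field_def by (rule fls_map_vfield_f_ser[OF fs.rem_vanishes refl])

lemma vir_field_fcoord: "vir_field n (fcoord i) = poly (fs.vpoly n) (fcoord i)"
  by (simp add: vir_field_def vfield_fcoord)

lemma vir_field_fconst: "vir_field n (fconst a) = 0"
  by (simp add: vir_field_def vfield_fconst)

lemma Res_boundary_term:
  "Res (zpow (1 - n) * boundary_term \<delta> i P) =
     fr \<delta> * poly (pder (fs.vpoly n)) (fcoord i) * P + poly (fs.vpoly n) (fcoord i) * pderiv_coord i P"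
proof -
  have "zpow (1 - n) * boundary_term \<delta> i P =
      fls_const (fr \<delta> * P) * (zpow (1 - n) * (df ^ 2 * linv (f_ser - fls_const (fcoord i)) ^ 2))
      + fls_const (pderiv_coord i P) * (zpow (1 - n) * (df ^ 2 * linv (f_ser - fls_const (fcoord i))))"
    unfolding boundary_term_def fs.expand_recip_0 fs.expand_recip_1 fls_const_mult_const[symmetric]
    by (simp only: distrib_left mult_ac)
  then show ?thesis
    by (simp only: Res_add Res_const_mult fs.Res_eps_recip fs.Res_eps_recip2) (simp add: mult_ac)
qed

lemma vir_op_eq:
  fixes P :: "'i::{finite,linorder} fock"
  shows "vir_op c X hx hy n P = vir_field n P + vir_weight c X hx hy n * P"
proof -
  define F where "F = {k. pderiv_var k P \<noteq> 0}"
  have F: "finite F" by (simp add: F_def finite_pderiv_var)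
  define R :: "nat \<Rightarrow> 'i fock fls" where "R k = Res (fls_const (df ^ 2) * zpow (int k) * expand_recip 0 f_ser2 f_ser)" for k
  have "Sum_any (\<lambda>k. R k * fls_const (pderiv_var k P)) = (\<Sum>k\<in>F. R k * fls_const (pderiv_var k P))"
    by (rule Sum_any.expand_superset[OF F]) (auto simp: F_def)
  then have "Res (zpow (1 - n) * Sum_any (\<lambda>k. R k * fls_const (pderiv_var k P))) =
      (\<Sum>k\<in>F. Res (zpow (1 - n) * R k) * pderiv_var k P)"
    by (simp only: sum_distrib_left Res_sum Res_mult_const flip: mult.assoc)
  \<comment> \<open>This sign from \<open>Res_kernel\<close> is compensated by the minus sign of the
    sum in \<open>stress_tensor\<close>.\<close>
  also have "\<dots> = - (\<Sum>k\<in>F. fls_nth (fs.rem n) (int k + 1) * pderiv_var k P)"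
    unfolding R_def fs.Res_kernel fs.rem_def[symmetric] by (simp add: sum_negf)
  finally have var: "Res (zpow (1 - n) * Sum_any (\<lambda>k. R k * fls_const (pderiv_var k P))) =
      - (\<Sum>k\<in>F. fls_nth (fs.rem n) (int k + 1) * pderiv_var k P)" .
  have schw: "Res (zpow (1 - n) * (fls_const (fr (c / 12)) * schwarzian * fls_const P)) =
      fr (c / 12) * Res (zpow (1 - n) * schwarzian) * P"
  proof -
    have "zpow (1 - n) * (fls_const (fr (c / 12)) * schwarzian * fls_const P) =
        fls_const (fr (c / 12)) * (zpow (1 - n) * schwarzian) * fls_const P"
      by (simp only: mult_ac)
    then show ?thesis
      by (simp only: Res_const_mult Res_mult_const)
  qed
  define t where "t i = fr (if i \<in> X then hx i else hy i) * poly (pder (fs.vpoly n)) (fcoord i) * P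
    + poly (fs.vpoly n) (fcoord i) * pderiv_coord i P" for i
  have "(\<Sum>i\<in>X. Res (zpow (1 - n) * boundary_term (hx i) i P)) + (\<Sum>i\<in>- X. Res (zpow (1 - n) * boundary_term (hy i) i P))
      = (\<Sum>i\<in>X. t i) + (\<Sum>i\<in>- X. t i)"
    unfolding Res_boundary_term t_def by (intro arg_cong2[of _ _ _ _ "(+)"] sum.cong) auto
  also have "\<dots> = (\<Sum>i\<in>UNIV. t i)"
    by (subst sum.union_disjoint[symmetric]) (auto simp: Compl_partition)
  finally have bd: "(\<Sum>i\<in>X. Res (zpow (1 - n) * boundary_term (hx i) i P))
      + (\<Sum>i\<in>- X. Res (zpow (1 - n) * boundary_term (hy i) i P)) = (\<Sum>i\<in>UNIV. t i)" .
  have "vir_op c X hx hy n P = fr (c / 12) * Res (zpow (1 - n) * schwarzian) * P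
      + (\<Sum>k\<in>F. fls_nth (fs.rem n) (int k + 1) * pderiv_var k P) + (\<Sum>i\<in>UNIV. t i)"
    unfolding vir_op_def stress_tensor_def R_def[symmetric] distrib_left right_diff_distrib
      sum_distrib_left Res_add Res_diff Res_sum schw var
    using bd by (simp add: add.assoc)
  then show ?thesis
    by (simp add: vir_field_def vir_weight_def t_def vfield_eq_sum[OF F, unfolded F_def, OF order_refl]
        sum.distrib sum_distrib_right distrib_right F_def add_ac)
qed

lemma vir_field_commutator:
  fixes P :: "'i::{finite,linorder} fock"
  shows "vir_field n (vir_field m P) - vir_field m (vir_field n P) = of_int (n - m) * vir_field (n + m) P"
proof -
  have "vir_field n (fls_nth (fs.rem m) k :: 'i fock) - vir_field m (fls_nth (fs.rem n) k) =
      of_int (n - m) * fls_nth (fs.rem (n + m)) k" for k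
    using arg_cong[OF fs.rem_commutator[OF derivation_vir_field derivation_vir_field vir_field_f_ser vir_field_f_ser],
        of "\<lambda>g. fls_nth g k" n m]
    by (simp add: fls_map_nth derivation_0[OF derivation_vir_field] del: of_int_diff)
  moreover have "vir_field n (poly (fs.vpoly m) (fcoord i)) - vir_field m (poly (fs.vpoly n) (fcoord i)) =
      of_int (n - m) * poly (fs.vpoly (n + m)) (fcoord i)" for i :: 'i
    by (rule fs.vpoly_pder_commutator(1)[OF derivation_vir_field derivation_vir_field vir_field_f_ser vir_field_f_ser
        vir_field_fcoord vir_field_fcoord])
  ultimately show ?thesis
    by (simp add: vir_field_def vfield_commutator vfield_scale)
qed

lemma vir_weight_commutator:
  fixes X :: "'i::{finite,linorder} set"
  shows "vir_field n (vir_weight c X hx hy m) - vir_field m (vir_weight c X hx hy n) =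
    of_int (n - m) * vir_weight c X hx hy (n + m) + (if n + m = 0 then fr (c / 12) * of_int (n ^ 3 - n) else 0)"
proof -
  note V = derivation_vir_field
  define u :: "'i \<Rightarrow> 'i fock" where "u i = fr (if i \<in> X then hx i else hy i)" for i
  define S :: "int \<Rightarrow> 'i fock" where "S k = Res (zpow (1 - k) * schwarzian)" for k
  have S: "vir_field n (S m) - vir_field m (S n) = of_int (n - m) * S (n + m) + (if n + m = 0 then of_int (n ^ 3 - n) else 0)"
    unfolding S_def schwarzian_eq
    by (rule fs.Res_schw_cocycle[OF two_fr_three_halves V V vir_field_f_ser vir_field_f_ser])
  have p: "vir_field n (poly (pder (fs.vpoly m)) (fcoord i)) - vir_field m (poly (pder (fs.vpoly n)) (fcoord i)) =
      of_int (n - m) * poly (pder (fs.vpoly (n + m))) (fcoord i)" for i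
    by (rule fs.vpoly_pder_commutator(2)[OF V V vir_field_f_ser vir_field_f_ser vir_field_fcoord vir_field_fcoord])
  have "vir_field k (vir_weight c X hx hy l) = fr (c / 12) * vir_field k (S l)
      + (\<Sum>i\<in>UNIV. u i * vir_field k (poly (pder (fs.vpoly l)) (fcoord i)))" for k l
    unfolding vir_weight_def u_def[symmetric] S_def[symmetric]
    by (simp add: derivation_add[OF V] derivation_mult[OF V] derivation_sum[OF V] u_def vir_field_fconst)
  then have "vir_field n (vir_weight c X hx hy m) - vir_field m (vir_weight c X hx hy n) =
      fr (c / 12) * (vir_field n (S m) - vir_field m (S n))
      + (\<Sum>i\<in>UNIV. u i * (vir_field n (poly (pder (fs.vpoly m)) (fcoord i)) - vir_field m (poly (pder (fs.vpoly n)) (fcoord i))))"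
    by (simp add: right_diff_distrib sum_subtractf)
  also have "\<dots> = of_int (n - m) * (fr (c / 12) * S (n + m) + (\<Sum>i\<in>UNIV. u i * poly (pder (fs.vpoly (n + m))) (fcoord i)))
      + fr (c / 12) * (if n + m = 0 then of_int (n ^ 3 - n) else 0)"
    unfolding S p by (simp only: distrib_left sum_distrib_left mult_ac) (simp only: add_ac)
  finally show ?thesis
    unfolding vir_weight_def u_def[symmetric] S_def[symmetric] by (simp only: if_distrib mult_zero_right)
qed

lemma vir_op_commutator:
  "vir_op c X hx hy n (vir_op c X hx hy m P) - vir_op c X hx hy m (vir_op c X hx hy n P) =
    of_int (n - m) * vir_op c X hx hy (n + m) P + (if n + m = 0 then fr (c / 12) * of_int (n ^ 3 - n) * P else 0)"
proof -
  note V = derivation_vir_field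
  have "vir_op c X hx hy n (vir_op c X hx hy m P) - vir_op c X hx hy m (vir_op c X hx hy n P) =
      (vir_field n (vir_field m P) - vir_field m (vir_field n P))
      + (vir_field n (vir_weight c X hx hy m) - vir_field m (vir_weight c X hx hy n)) * P"
    unfolding vir_op_eq by (simp add: derivation_add[OF V] derivation_mult[OF V] algebra_simps)
  then show ?thesis
    unfolding vir_field_commutator vir_weight_commutator vir_op_eq
    by (simp only: distrib_left distrib_right if_distrib[of "\<lambda>x. x * P"] mult_zero_left mult.assoc add.assoc)
qed

lemma vir_op_add: "vir_op c X hx hy n (P + Q) = vir_op c X hx hy n P + vir_op c X hx hy n Q"
  by (simp add: vir_op_eq derivation_add[OF derivation_vir_field] algebra_simps)

lemma vir_op_fscale: "vir_op c X hx hy n (fscale a P) = fscale a (vir_op c X hx hy n P)"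
  by (simp add: vir_op_eq fscale_def derivation_mult[OF derivation_vir_field] vir_field_fconst algebra_simps)

lemma virasoro_module_vir_op:
  fixes X :: "'i::{finite,linorder} set"
  shows "virasoro_module c (vir_op c X hx hy) UNIV"
  unfolding virasoro_module_def
proof (intro conjI allI ballI)
  fix n m :: int and v :: "'i fock"
  have "fscale (of_real c / 12 * of_int (n ^ 3 - n)) v = fr (c / 12) * of_int (n ^ 3 - n) * v"
    by (simp only: fscale_def fconst_hom fconst_of_int of_real_divide of_real_numeral)
  then show "vir_op c X hx hy n (vir_op c X hx hy m v) - vir_op c X hx hy m (vir_op c X hx hy n v) =
      fscale (of_int (n - m)) (vir_op c X hx hy (n + m) v) +
      (if n + m = 0 then fscale (of_real c / 12 * of_int (n ^ 3 - n)) v else 0)"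
    unfolding vir_op_commutator by (simp add: fscale_def fconst_of_int del: of_int_diff of_int_power)
qed (simp_all add: vir_op_add vir_op_fscale fock.subspace_UNIV)

section \<open>The null vector operators\<close>

text \<open>The driving point x_i is left fixed; A_I differentiates in x_i only through its
  second-order term.\<close>

definition loewner_field :: "'i \<Rightarrow> 'i::{finite,linorder} fock \<Rightarrow> 'i fock" where
  "loewner_field i = vfield (\<lambda>k. 2 * p_poly k i) (\<lambda>j. if j = i then 0 else 2 * finv_diff j i)"

text \<open>Since (kap j - 6)/kap j = -2 \<open>h_x kap j\<close>, the other x's and the y's enter
  in the same way, each through its weight.\<close>

definition null_potential ::
  "'i set \<Rightarrow> ('i \<Rightarrow> real) \<Rightarrow> ('i \<Rightarrow> real) \<Rightarrow> 'i \<Rightarrow> 'i::{finite,linorder} fock" where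
  "null_potential X hx hy i = (\<Sum>j\<in>- {i}. - 2 * fr (if j \<in> X then hx j else hy j) * finv_diff j i ^ 2)"

lemma derivation_loewner_field: "derivation (loewner_field i)"
  by (simp add: loewner_field_def derivation_vfield)

lemma loewner_field_fconst: "loewner_field i (fconst a) = 0"
  by (simp add: loewner_field_def vfield_fconst)

lemma loewner_field_fcoord: "loewner_field i (fcoord j) = (if j = i then 0 else 2 * finv_diff j i)"
  by (simp add: loewner_field_def vfield_fcoord)

lemma p_poly_eq: "p_poly k i = fls_nth (linv (f_ser - fls_const (fcoord i))) (int k + 1)"
  unfolding p_poly_def fs.expand_recip_0 by (simp add: Res_def zpow_mult_nth add.commute)

lemma loewner_field_f_ser: "fls_map (loewner_field i) f_ser = 2 * linv (f_ser - fls_const (fcoord i))"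
  unfolding loewner_field_def
proof (rule fls_map_vfield_f_ser)
  show "vanishes_below 1 (2 * linv (f_ser - fls_const (fcoord i)))"
    using fs.recip_leading(2)[of "fcoord i"] by (simp add: vanishes_below_def)
qed (simp add: p_poly_eq)

lemma A_op_eq:
  fixes P :: "'i::{finite,linorder} fock"
  assumes "i \<in> X"
  shows "A_op X kap hy i P = fr (kap i / 2) * pderiv_coord i (pderiv_coord i P) + loewner_field i P
    + null_potential X (h_x kap) hy i * P"
proof -
  define t where "t j = 2 * finv_diff j i * pderiv_coord j P
      + (- 2 * fr (if j \<in> X then h_x kap j else hy j)) * finv_diff j i ^ 2 * P" for j
  have "fr ((kap j - 6) / kap j) = (- 2 * fr (h_x kap j) :: 'i fock)" for j
  proof -
    \<comment> \<open>For \<open>kap j = 0\<close> both sides are 0 by the convention on division by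
      zero.\<close>
    have "(kap j - 6) / kap j = - 2 * h_x kap j"
      by (cases "kap j = 0") (simp_all add: h_x_def field_simps)
    then have "fr ((kap j - 6) / kap j) = (fr (- 2 * h_x kap j) :: 'i fock)"
      by simp
    also have "\<dots> = - 2 * fr (h_x kap j)"
      by (simp only: fr_hom)
    finally show ?thesis .
  qed
  moreover have "fr (2 * hy j) = (2 * fr (hy j) :: 'i fock)" for j
    by (simp only: fr_hom)
  ultimately have "null_op X kap hy i P = fr (kap i / 2) * pderiv_coord i (pderiv_coord i P)
      + ((\<Sum>j\<in>X - {i}. t j) + (\<Sum>j\<in>- X. t j))"
    unfolding null_op_def t_def
    by (simp del: of_real_divide of_real_diff of_real_mult add: add.assoc)
  also have "(\<Sum>j\<in>X - {i}. t j) + (\<Sum>j\<in>- X. t j) = (\<Sum>j\<in>- {i}. t j)"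
  proof -
    have "(X - {i}) \<union> - X = - {i}" "(X - {i}) \<inter> - X = {}"
      using assms by auto
    then show ?thesis
      by (metis sum.union_disjoint finite)
  qed
  finally have null: "null_op X kap hy i P = fr (kap i / 2) * pderiv_coord i (pderiv_coord i P) + (\<Sum>j\<in>- {i}. t j)" .
  have "(\<Sum>j\<in>UNIV. (if j = i then 0 else 2 * finv_diff j i) * pderiv_coord j P) =
      (\<Sum>j\<in>- {i}. 2 * finv_diff j i * pderiv_coord j P)"
    by (rule sum.mono_neutral_cong_right) auto
  moreover have "2 * Sum_any (\<lambda>k. p_poly k i * pderiv_var k P) = Sum_any (\<lambda>k. 2 * p_poly k i * pderiv_var k P)"
  proof -
    have fin: "finite {k. p_poly k i * pderiv_var k P \<noteq> 0}"
      by (rule finite_subset[OF _ finite_pderiv_var[of P]]) auto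
    show ?thesis
      by (subst Sum_any_right_distrib[OF fin]) (simp only: mult.assoc)
  qed
  ultimately show ?thesis
    unfolding A_op_def null loewner_field_def vfield_def null_potential_def
    by (simp only: t_def[abs_def] sum.distrib sum_distrib_right add_ac)
qed

lemma fcoord_diff_finv_diff:
  assumes "j \<noteq> i"
  shows "(fcoord j - fcoord i) * finv_diff j i = 1"
proof -
  have "coord_smooth j * inv_diff_smooth j i = coord_smooth i * inv_diff_smooth j i + 1"
  proof (rule smooth_fun_eqI)
    fix p :: "(real, 'a) vec" assume p: "p \<in> chamber"
    then have "complex_of_real (p $ j - p $ i) \<noteq> 0"
      using chamber_distinct[OF p assms] by (simp only: of_real_eq_0_iff)
    then show "Rep_smooth_fun (coord_smooth j * inv_diff_smooth j i) p =
        Rep_smooth_fun (coord_smooth i * inv_diff_smooth j i + 1) p"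
      using p by (simp add: times_smooth_fun.rep_eq plus_smooth_fun.rep_eq one_smooth_fun.rep_eq
          Rep_coord_smooth Rep_inv_diff_smooth[OF assms] field_simps)
  qed
  from arg_cong[OF this, of fcoeff] show ?thesis
    by (simp add: fcoeff_hom left_diff_distrib)
qed

lemma pderiv_coord_fcoord: "pderiv_coord i (fcoord j) = (if i = j then 1 else 0)"
  by (simp add: pderiv_coord_fcoeff pderiv_smooth_coord fcoeff_hom)

lemma pderiv_coord_fconst: "pderiv_coord i (fconst a) = 0"
  by (simp add: pderiv_coord_fcoeff pderiv_smooth_const fcoeff_hom)

lemma pderiv_coord_f_ser: "fls_map (pderiv_coord i) f_ser = 0"
proof -
  have "fls_map (vfield (\<lambda>_. 0) (\<lambda>j. if j = i then 1 else 0)) f_ser = (0 :: 'a fock fls)"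
    by (rule fls_map_vfield_f_ser) simp_all
  then show ?thesis
    unfolding pderiv_coord_eq_vfield[abs_def] .
qed

context
  fixes i :: "'i::{finite,linorder}" and n :: int
begin

private abbreviation x where "x \<equiv> fcoord i"
private abbreviation D where "D \<equiv> pderiv_coord i"
private abbreviation B where "B \<equiv> loewner_field i"
private abbreviation V :: "'i fock \<Rightarrow> 'i fock" where "V \<equiv> vir_field n"
private abbreviation v where "v \<equiv> fs.vpoly n"
private abbreviation v1 where "v1 \<equiv> pder v"
private abbreviation v2 where "v2 \<equiv> pder v1"
private abbreviation v3 where "v3 \<equiv> pder v2"

private lemmas dD = derivation_pderiv_coord[of i]
private lemmas dB = derivation_loewner_field[of i]
private lemmas dV = derivation_vir_field[of n]

lemma pderiv_coord_poly_vpoly: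
  "D (poly v (fcoord j)) = (if i = j then poly v1 x else 0)"
  "D (poly v1 (fcoord j)) = (if i = j then poly v2 x else 0)"
  "D (poly v2 (fcoord j)) = (if i = j then poly v3 x else 0)"
proof -
  have 0: "map_poly D v = 0"
    by (rule fs.fls_map_eq_0(1)[OF dD pderiv_coord_f_ser])
  show "D (poly v (fcoord j)) = (if i = j then poly v1 x else 0)"
    "D (poly v1 (fcoord j)) = (if i = j then poly v2 x else 0)"
    "D (poly v2 (fcoord j)) = (if i = j then poly v3 x else 0)"
    by (simp_all add: derivation_poly[OF dD] map_poly_pder[OF dD] 0 pderiv_coord_fcoord)
qed

text \<open>The only coefficient of V_n that depends on x_i is v_n(x_i); its derivative is the whole
  commutator.\<close>

lemma pderiv_coord_vir_field: "D (V P) = V (D P) + poly v1 x * D P"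
proof -
  have rem: "D (fls_nth (fs.rem n) k) = 0" for k
    using arg_cong[OF fs.fls_map_eq_0(2)[OF dD pderiv_coord_f_ser], of "\<lambda>g. fls_nth g k" n]
    by (simp add: fls_map_nth derivation_0[OF dD])
  have "D (V P) - V (D P) = vfield (\<lambda>k. D (fls_nth (fs.rem n) (int k + 1)) - V 0)
      (\<lambda>j. D (poly v (fcoord j)) - V (if j = i then 1 else 0)) P"
    unfolding pderiv_coord_eq_vfield[abs_def] vir_field_def by (rule vfield_commutator)
  also have "\<dots> = vfield (\<lambda>k. poly v1 x * 0) (\<lambda>j. poly v1 x * (if j = i then 1 else 0)) P"
    by (intro arg_cong[of _ _ "\<lambda>b. vfield _ b P"] arg_cong2[of _ _ _ _ "\<lambda>a b. vfield a b P"] ext)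
       (simp_all add: rem derivation_0[OF dV] derivation_1[OF dV] pderiv_coord_poly_vpoly)
  also have "\<dots> = poly v1 x * D P"
    by (simp only: pderiv_coord_eq_vfield vfield_scale)
  finally show ?thesis
    by (simp add: algebra_simps)
qed

lemma pderiv_coord_vir_weight:
  "D (vir_weight c X hx hy n) = fr (if i \<in> X then hx i else hy i) * poly v2 x"
proof -
  have "D (Res (zpow (1 - n) * schwarzian)) = 0"
    unfolding schwarzian_eq by (rule fs.fls_map_eq_0(3)[OF dD pderiv_coord_f_ser two_fr_three_halves])
  then have "D (vir_weight c X hx hy n) =
      (\<Sum>j\<in>UNIV. fr (if j \<in> X then hx j else hy j) * (if i = j then poly v2 x else 0))"
    unfolding vir_weight_def
    by (simp add: derivation_add[OF dD] derivation_mult[OF dD] derivation_sum[OF dD] pderiv_coord_fconst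
        pderiv_coord_poly_vpoly)
  also have "\<dots> = (\<Sum>j\<in>UNIV. if i = j then fr (if j \<in> X then hx j else hy j) * poly v2 x else 0)"
    by (intro sum.cong) auto
  finally show ?thesis by simp
qed

lemma vpoly_loewner_at:
  "poly (map_poly B v) x = - 3 * poly v2 x" "3 * poly (pder (map_poly B v)) x = - 4 * poly v3 x"
  by (rule fs.poly_vpoly_loewner_at[OF dB loewner_field_f_ser] fs.poly_pder_vpoly_loewner_at[OF dB loewner_field_f_ser])+

text \<open>The Loewner identities at w = y, divided by (y - x)^2 through multiplication with q^2.
  The second is the divided derivative identity minus 2q times the first, which eliminates
  v'(y).\<close>

lemma vpoly_loewner_off:
  assumes "j \<noteq> i"
  defines "q \<equiv> finv_diff j i" and "y \<equiv> fcoord j"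
  shows "poly (map_poly B v) y + 2 * q * poly v1 y + 2 * q ^ 2 * (poly v y - poly v x) = 4 * q * poly v1 x"
    and "poly (pder (map_poly B v)) y + 2 * q * poly v2 y - 4 * q ^ 3 * (poly v y - poly v x) = - 4 * q ^ 2 * poly v1 x"
proof -
  define w where "w = y - x"
  have wq: "w * q = 1"
    unfolding w_def y_def q_def by (rule fcoord_diff_finv_diff[OF assms(1)])
  have c: "w * (q * z) = z" for z
    by (simp add: wq flip: mult.assoc)
  define a a' b b1 b1x bx b2 where "a = poly (map_poly B v) y" and "a' = poly (pder (map_poly B v)) y"
    and "b = poly v y" and "b1 = poly v1 y" and "b1x = poly v1 x" and "bx = poly v x" and "b2 = poly v2 y"
  have 1: "a * w ^ 2 + 2 * b1 * w + 2 * b = 2 * bx + 4 * b1x * w"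
    unfolding w_def a_def b_def b1_def b1x_def bx_def
    by (rule fs.poly_vpoly_loewner[OF dB loewner_field_f_ser])
  have 2: "a' * w ^ 2 + 2 * (a * w) + 2 * (b2 * w) + 4 * b1 = 4 * b1x"
    unfolding w_def a_def a'_def b2_def b1_def b1x_def
    by (rule fs.poly_pder_vpoly_loewner[OF dB loewner_field_f_ser])
  have "q * q * (a * w ^ 2 + 2 * b1 * w + 2 * b) =
      w * (q * (w * (q * a))) + w * (q * (2 * q * b1)) + 2 * q ^ 2 * b"
    by (simp only: power2_eq_square distrib_left mult_ac)
  moreover have "q * q * (2 * bx + 4 * b1x * w) = 2 * q ^ 2 * bx + w * (q * (4 * q * b1x))"
    by (simp only: power2_eq_square distrib_left mult_ac)
  ultimately have 3: "a + 2 * q * b1 + 2 * q ^ 2 * b = 2 * q ^ 2 * bx + 4 * q * b1x"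
    unfolding 1 c by simp
  have "q * q * (a' * w ^ 2 + 2 * (a * w) + 2 * (b2 * w) + 4 * b1) =
      w * (q * (w * (q * a'))) + w * (q * (2 * q * a)) + w * (q * (2 * q * b2)) + 4 * q ^ 2 * b1"
    by (simp only: power2_eq_square distrib_left mult_ac)
  then have 4: "a' + 2 * q * a + 2 * q * b2 + 4 * q ^ 2 * b1 = 4 * q ^ 2 * b1x"
    unfolding 2 c by (simp add: power2_eq_square mult_ac)
  show "poly (map_poly B v) y + 2 * q * poly v1 y + 2 * q ^ 2 * (poly v y - poly v x) = 4 * q * poly v1 x"
    using 3 by (simp add: algebra_simps flip: a_def b_def b1_def b1x_def bx_def)
  have "a' + 2 * q * b2 - 4 * q ^ 3 * (b - bx) = (a' + 2 * q * a + 2 * q * b2 + 4 * q ^ 2 * b1)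
      - 2 * q * (a + 2 * q * b1 + 2 * q ^ 2 * b) + 4 * q ^ 3 * bx"
    by (simp add: power2_eq_square power3_eq_cube algebra_simps)
  also have "\<dots> = - 4 * q ^ 2 * b1x"
    unfolding 3 4 by (simp add: power2_eq_square power3_eq_cube algebra_simps)
  finally have "a' + 2 * q * b2 - 4 * q ^ 3 * (b - bx) = - 4 * q ^ 2 * b1x" .
  then show "poly (pder (map_poly B v)) y + 2 * q * poly v2 y - 4 * q ^ 3 * (poly v y - poly v x) = - 4 * q ^ 2 * poly v1 x"
    by (simp only: a'_def b_def b1x_def bx_def b2_def)
qed

lemma vir_field_finv_diff:
  assumes "j \<noteq> i"
  shows "V (finv_diff j i) = - (finv_diff j i ^ 2) * (poly v (fcoord j) - poly v x)"
  by (simp add: derivation_inverse[OF dV fcoord_diff_finv_diff[OF assms]] derivation_diff[OF dV] vir_field_fcoord)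

text \<open>The extra D arises because V_n moves x_i with velocity v_n(x_i): B fixes x_i but varies
  the coefficients of v_n, which changes this velocity by -3 v''(x_i).\<close>

lemma loewner_vir_field_commutator:
  "B (V P) - V (B P) = 2 * poly v1 x * B P - 3 * poly v2 x * D P"
proof -
  have "fls_nth (fls_map B (fs.rem n) - fls_map V (2 * linv (f_ser - fls_const x))) (int k + 1) =
      fls_nth (fls_const (4 * poly v1 x) * linv (f_ser - fls_const x)) (int k + 1)" for k
    by (subst fs.rem_loewner_commutator[OF dB loewner_field_f_ser dV vir_field_f_ser vir_field_fcoord]) rule
  then have var: "B (fls_nth (fs.rem n) (int k + 1)) - V (2 * p_poly k i) =
      2 * poly v1 x * (2 * p_poly k i) + - 3 * poly v2 x * 0" for k
    by (simp add: fls_map_nth derivation_0[OF dB] derivation_0[OF dV] p_poly_eq)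
  have coord: "B (poly v (fcoord j)) - V (if j = i then 0 else 2 * finv_diff j i) =
      2 * poly v1 x * (if j = i then 0 else 2 * finv_diff j i) + - 3 * poly v2 x * (if j = i then 1 else 0)" for j
  proof (cases "j = i")
    case True
    then show ?thesis
      by (simp add: derivation_poly[OF dB] loewner_field_fcoord vpoly_loewner_at derivation_0[OF dV])
  next
    case False
    then show ?thesis
      using vpoly_loewner_off(1)[OF False]
      by (simp add: derivation_poly[OF dB] loewner_field_fcoord derivation_mult[OF dV] derivation_numeral[OF dV]
          vir_field_finv_diff mult_ac)
  qed
  have "B (V P) - V (B P) = vfield (\<lambda>k. B (fls_nth (fs.rem n) (int k + 1)) - V (2 * p_poly k i))
      (\<lambda>j. B (poly v (fcoord j)) - V (if j = i then 0 else 2 * finv_diff j i)) P"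
    unfolding loewner_field_def vir_field_def by (rule vfield_commutator)
  also have "\<dots> = vfield (\<lambda>k. 2 * poly v1 x * (2 * p_poly k i) + - 3 * poly v2 x * 0)
      (\<lambda>j. 2 * poly v1 x * (if j = i then 0 else 2 * finv_diff j i) + - 3 * poly v2 x * (if j = i then 1 else 0)) P"
    by (simp only: var coord)
  also have "\<dots> = 2 * poly v1 x * B P + - 3 * poly v2 x * D P"
    by (simp only: loewner_field_def pderiv_coord_eq_vfield vfield_scale vfield_add)
  finally show ?thesis by simp
qed

text \<open>Every other point cancels separately, whatever its weight, by
  \<open>vpoly_loewner_off\<close>. At x_i the Schwarzian gives -(c/6) v''' and the weight -(4/3) h
  v'''; the factor 3 clears the denominators.\<close>

lemma loewner_vir_weight:
  assumes i: "i \<in> X"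
  shows "3 * (B (vir_weight c X hx hy n) - V (null_potential X hx hy i)
      - 2 * poly v1 x * null_potential X hx hy i) = - fr (c / 2 + 4 * hx i) * poly v3 x"
proof -
  define u :: "'i \<Rightarrow> 'i fock" where "u j = fr (if j \<in> X then hx j else hy j)" for j
  let ?q = "\<lambda>j. finv_diff j i"
  have schw: "B (Res (zpow (1 - n) * schwarzian)) = - 2 * poly v3 x"
    unfolding schwarzian_eq by (rule fs.Res_schw_loewner[OF dB loewner_field_f_ser two_fr_three_halves])
  have uc: "B (u j) = 0" "V (u j) = 0" for j
    by (simp_all add: u_def loewner_field_fconst vir_field_fconst)
  have "B (vir_weight c X hx hy n) = fr (c / 12) * (- 2 * poly v3 x) + (\<Sum>j\<in>UNIV. u j * B (poly v1 (fcoord j)))"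
    unfolding vir_weight_def u_def[symmetric]
    by (simp add: derivation_add[OF dB] derivation_mult[OF dB] derivation_sum[OF dB] loewner_field_fconst uc schw)
  also have "(\<Sum>j\<in>UNIV. u j * B (poly v1 (fcoord j))) = u i * B (poly v1 x) + (\<Sum>j\<in>- {i}. u j * B (poly v1 (fcoord j)))"
    by (subst sum.remove[of _ i]) (simp_all add: Compl_eq_Diff_UNIV)
  finally have Bw: "B (vir_weight c X hx hy n) = fr (c / 12) * (- 2 * poly v3 x) + u i * poly (pder (map_poly B v)) x
      + (\<Sum>j\<in>- {i}. u j * B (poly v1 (fcoord j)))"
    by (simp add: derivation_poly[OF dB] loewner_field_fcoord map_poly_pder[OF dB])
  have off: "u j * B (poly v1 (fcoord j)) - V (- 2 * u j * ?q j ^ 2) - 2 * poly v1 x * (- 2 * u j * ?q j ^ 2) = 0"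
    if j: "j \<in> - {i}" for j
  proof -
    have ji: "j \<noteq> i" using j by simp
    have "B (poly v1 (fcoord j)) = poly (pder (map_poly B v)) (fcoord j) + 2 * ?q j * poly v2 (fcoord j)"
      using ji by (simp add: derivation_poly[OF dB] loewner_field_fcoord map_poly_pder[OF dB] mult_ac)
    also have "\<dots> = - 4 * ?q j ^ 2 * poly v1 x + 4 * ?q j ^ 3 * (poly v (fcoord j) - poly v x)"
      using vpoly_loewner_off(2)[OF ji] by (simp only: diff_eq_eq)
    finally have 1: "B (poly v1 (fcoord j)) = - 4 * ?q j ^ 2 * poly v1 x + 4 * ?q j ^ 3 * (poly v (fcoord j) - poly v x)" .
    have 2: "V (- 2 * u j * ?q j ^ 2) = 4 * u j * ?q j ^ 3 * (poly v (fcoord j) - poly v x)"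
      by (simp add: derivation_mult[OF dV] derivation_minus[OF dV] derivation_numeral[OF dV] uc
          vir_field_finv_diff[OF ji] power2_eq_square power3_eq_cube)
    show ?thesis
      unfolding 1 2 by (simp add: algebra_simps)
  qed
  have "B (vir_weight c X hx hy n) - V (null_potential X hx hy i) - 2 * poly v1 x * null_potential X hx hy i =
      fr (c / 12) * (- 2 * poly v3 x) + u i * poly (pder (map_poly B v)) x +
      (\<Sum>j\<in>- {i}. u j * B (poly v1 (fcoord j)) - V (- 2 * u j * ?q j ^ 2) - 2 * poly v1 x * (- 2 * u j * ?q j ^ 2))"
    unfolding Bw null_potential_def u_def[symmetric] derivation_sum[OF dV] sum_distrib_left sum_subtractf
    by simp
  also have "\<dots> = fr (c / 12) * (- 2 * poly v3 x) + u i * poly (pder (map_poly B v)) x"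
    using off by simp
  finally have "3 * (B (vir_weight c X hx hy n) - V (null_potential X hx hy i)
      - 2 * poly v1 x * null_potential X hx hy i) =
      3 * (fr (c / 12) * (- 2 * poly v3 x) + u i * poly (pder (map_poly B v)) x)"
    by (rule arg_cong)
  also have "\<dots> = - (6 * fr (c / 12)) * poly v3 x + u i * (3 * poly (pder (map_poly B v)) x)"
    by (simp add: algebra_simps)
  also have "\<dots> = - (6 * fr (c / 12) + 4 * u i) * poly v3 x"
    by (simp add: vpoly_loewner_at algebra_simps)
  also have "6 * fr (c / 12) + 4 * u i = fr (c / 2 + 4 * hx i)"
  proof -
    have "fr (6 * (c / 12)) = (6 * fr (c / 12) :: 'i fock)"
      by (simp only: fr_hom)
    then have "6 * fr (c / 12) = (fr (c / 2) :: 'i fock)"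
      by simp
    moreover have "4 * u i = fr (4 * hx i)"
      using i by (simp only: u_def if_True fr_hom)
    ultimately show ?thesis
      by (simp only: fr_hom(1))
  qed
  finally show ?thesis .
qed

end

text \<open>The second-order part, the Loewner field and the potential all acquire the same factor 2
  v'(x_i); the obstructions to proportionality are terms with v'' and v'''.\<close>

lemma A_op_vir_op_commutator:
  fixes P :: "'i::{finite,linorder} fock"
  assumes i: "i \<in> X" and kap: "kap i \<noteq> 0"
    and c: "c = (6 - kap i) * (3 * kap i - 8) / (2 * kap i)"
  shows "A_op X kap hy i (vir_op c X (h_x kap) hy n P) =
    vir_op c X (h_x kap) hy n (A_op X kap hy i P) + 2 * poly (pder (fs.vpoly n)) (fcoord i) * A_op X kap hy i P"
proof -
  note D = derivation_pderiv_coord[of i] and B = derivation_loewner_field[of i] and V = derivation_vir_field[of n]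
  define h where "h = h_x kap i"
  define k :: "'i fock" where "k = fr (kap i / 2)"
  define \<phi> where "\<phi> = vir_weight c X (h_x kap) hy n"
  define \<psi> where "\<psi> = null_potential X (h_x kap) hy i"
  define v1 v2 v3 where "v1 = poly (pder (fs.vpoly n)) (fcoord i)"
    and "v2 = poly (pder (pder (fs.vpoly n))) (fcoord i)" and "v3 = poly (pder (pder (pder (fs.vpoly n)))) (fcoord i)"
  have D\<phi>: "pderiv_coord i \<phi> = fr h * v2"
    using i by (simp add: \<phi>_def pderiv_coord_vir_weight v2_def h_def)
  have Dv: "pderiv_coord i v1 = v2" "pderiv_coord i v2 = v3"
    by (simp_all add: v1_def v2_def v3_def pderiv_coord_poly_vpoly)
  have DV: "pderiv_coord i (vir_field n Q) = vir_field n (pderiv_coord i Q) + v1 * pderiv_coord i Q" for Q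
    unfolding v1_def by (rule pderiv_coord_vir_field)
  have BV: "loewner_field i (vir_field n P) = vir_field n (loewner_field i P) + 2 * v1 * loewner_field i P - 3 * v2 * pderiv_coord i P"
    using loewner_vir_field_commutator[of i n P] by (simp add: v1_def v2_def algebra_simps)
  \<comment> \<open>Coefficients of v'' times the first derivative: kap/2 from commuting the second
    derivative with V_n, kap h from differentiating the weight, against 3 from the Loewner
    field.\<close>
  have k1: "k + 2 * (k * fr h) = 3"
  proof -
    have "kap i / 2 + 2 * (kap i / 2 * h) = 3"
      using kap by (simp add: h_def h_x_def field_simps)
    then have "fr (kap i / 2 + 2 * (kap i / 2 * h)) = (fr 3 :: 'i fock)"
      by (rule arg_cong)
    then show ?thesis
      by (simp only: fr_hom k_def)
  qed
  have B\<phi>: "loewner_field i \<phi> = vir_field n \<psi> + 2 * v1 * \<psi> - k * fr h * v3"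
  proof -
    \<comment> \<open>The relation c = h (3 kap - 8). It lets the v''' term of the weight, with
      coefficient (kap/2) h, balance a third of c/2 + 4h.\<close>
    have "c / 2 + 4 * h = 3 * (kap i / 2 * h)"
      using kap by (simp add: c h_def h_x_def field_simps)
    then have "fr (c / 2 + 4 * h) = (fr (3 * (kap i / 2 * h)) :: 'i fock)"
      by (rule arg_cong)
    then have "fr (c / 2 + 4 * h) = 3 * (k * fr h)"
      by (simp only: fr_hom k_def)
    then have "3 * (loewner_field i \<phi> - vir_field n \<psi> - 2 * v1 * \<psi>) = - (3 * (k * fr h)) * v3"
      using loewner_vir_weight[OF i, of c "h_x kap" hy n]
      by (simp only: \<phi>_def \<psi>_def v1_def v3_def h_def)
    then have "of_nat (Suc 2) * (loewner_field i \<phi> - vir_field n \<psi> - 2 * v1 * \<psi> + k * fr h * v3) = 0"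
      by (simp add: algebra_simps)
    then have "loewner_field i \<phi> - vir_field n \<psi> - 2 * v1 * \<psi> + k * fr h * v3 = 0"
      by (rule fock_torsion_free)
    then show ?thesis
      by (simp add: algebra_simps eq_neg_iff_add_eq_0)
  qed
  have Dh: "pderiv_coord i (fr h) = 0"
    by (rule pderiv_coord_fconst)
  have Vk: "vir_field n k = 0"
    by (simp add: k_def vir_field_fconst)
  define P1 P2 where "P1 = pderiv_coord i P" and "P2 = pderiv_coord i P1"
  have D2: "pderiv_coord i (pderiv_coord i (vir_field n P + \<phi> * P)) =
      vir_field n P2 + 2 * v1 * P2 + v2 * P1 + fr h * v3 * P + 2 * (fr h * v2 * P1) + \<phi> * P2"
    by (simp add: derivation_add[OF D] derivation_mult[OF D] DV D\<phi> Dv Dh P2_def P1_def algebra_simps)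
  have "A_op X kap hy i (vir_op c X (h_x kap) hy n P) =
      k * vir_field n P2 + 2 * v1 * (k * P2) + (k + 2 * (k * fr h) - 3) * (v2 * P1) + \<phi> * (k * P2)
      + vir_field n (loewner_field i P) + 2 * v1 * loewner_field i P
      + vir_field n \<psi> * P + 2 * v1 * (\<psi> * P) + \<phi> * loewner_field i P + \<psi> * vir_field n P + \<phi> * (\<psi> * P)"
    unfolding A_op_eq[OF i] vir_op_eq k_def[symmetric] \<phi>_def[symmetric] \<psi>_def[symmetric] D2
    by (simp add: derivation_add[OF B] derivation_mult[OF B] BV B\<phi> P1_def[symmetric] algebra_simps)
  also have "\<dots> = vir_field n (k * P2 + loewner_field i P + \<psi> * P) + \<phi> * (k * P2 + loewner_field i P + \<psi> * P)
      + 2 * v1 * (k * P2 + loewner_field i P + \<psi> * P)"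
    unfolding k1 diff_self by (simp add: derivation_add[OF V] derivation_mult[OF V] Vk algebra_simps)
  finally show ?thesis
    unfolding A_op_eq[OF i] vir_op_eq k_def[symmetric] \<phi>_def[symmetric] \<psi>_def[symmetric]
      v1_def[symmetric] P1_def[symmetric] P2_def[symmetric] .
qed

section \<open>Spanning words\<close>

context
  fixes c :: real and L :: "int \<Rightarrow> 'i::{finite,linorder} fock \<Rightarrow> 'i fock"
  assumes module: "virasoro_module c L UNIV"
begin

lemma vir_add: "L n (v + w) = L n v + L n w"
  and vir_scale: "L n (fscale a v) = fscale a (L n v)"
  using module by (simp_all add: virasoro_module_def)

lemma vir_zero: "L n 0 = 0"
  using vir_add[of n 0 0] by simp

lemma vir_diff: "L n (v - w) = L n v - L n w"
  using vir_add[of n "v - w" w] by simp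

lemma vir_commute:
  "L n (L m v) = L m (L n v) + (fscale (of_int (n - m)) (L (n + m) v)
    + (if n + m = 0 then fscale (of_real c / 12 * of_int (n ^ 3 - n)) v else 0))"
proof -
  have "L n (L m v) - L m (L n v) = fscale (of_int (n - m)) (L (n + m) v)
      + (if n + m = 0 then fscale (of_real c / 12 * of_int (n ^ 3 - n)) v else 0)"
    using module unfolding virasoro_module_def by blast
  then show ?thesis
    by (simp only: diff_eq_eq add.commute)
qed

lemma vir_span:
  assumes "\<And>v. v \<in> S \<Longrightarrow> L n v \<in> U" "fock.subspace U" "v \<in> fock.span S"
  shows "L n v \<in> U"
  using assms(3)
proof (induction rule: fock.span_induct_alt)
  case base
  then show ?case
    using assms(2) by (simp add: vir_zero fock.subspace_0)
next
  case (step a x y)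
  then show ?case
    using assms(1,2) by (simp add: vir_add vir_scale fock.subspace_add fock.subspace_scale)
qed

lemma vir_invariant_generated: "vir_invariant L (vir_generated L z)"
  unfolding vir_generated_def
  by (rule hull_in) (auto simp: vir_invariant_def intro!: fock.subspace_Inter)

lemma vir_invariantD:
  "vir_invariant L W \<Longrightarrow> v \<in> W \<Longrightarrow> L n v \<in> W"
  "vir_invariant L W \<Longrightarrow> fock.subspace W"
  by (simp_all add: vir_invariant_def)

context
  fixes z :: "'i fock"
begin

text \<open>Filtration by word length: a commutator replaces two letters by at most one and so drops
  to a lower level.\<close>

definition words :: "nat \<Rightarrow> 'i fock set" where
  "words k = fock.span {foldr L ns z | ns. length ns \<le> k}"

definition sorted_words :: "nat \<Rightarrow> 'i fock set" where
  "sorted_words k = fock.span {foldr L ns z | ns. sorted ns \<and> length ns \<le> k}"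

lemma foldr_in_words: "length ns \<le> k \<Longrightarrow> foldr L ns z \<in> words k"
  unfolding words_def by (rule fock.span_base) blast

lemma words_mono: "k \<le> l \<Longrightarrow> words k \<subseteq> words l"
  unfolding words_def by (rule fock.span_mono) auto

lemma vir_words: "v \<in> words k \<Longrightarrow> L n v \<in> words (Suc k)"
proof (rule vir_span)
  show "v \<in> words k \<Longrightarrow> v \<in> fock.span {foldr L ns z | ns. length ns \<le> k}"
    by (simp add: words_def)
  show "fock.subspace (words (Suc k))"
    by (simp add: words_def)
  fix v assume "v \<in> {foldr L ns z | ns. length ns \<le> k}"
  then obtain ns where "v = foldr L ns z" "length ns \<le> k" by blast
  then show "L n v \<in> words (Suc k)"
    using foldr_in_words[of "n # ns" "Suc k"] by simp
qed

text \<open>Moving L_a past each smaller letter costs only commutator terms, which are shorter than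
  the full word.\<close>

lemma insort_word: "L a (foldr L ns z) - foldr L (insort a ns) z \<in> words (length ns)"
proof (induction ns)
  case Nil
  then show ?case by (simp add: words_def fock.span_zero)
next
  case (Cons b ns)
  show ?case
  proof (cases "a \<le> b")
    case True
    then show ?thesis by (simp add: words_def fock.span_zero)
  next
    case False
    let ?w = "foldr L ns z"
    let ?k = "length (b # ns)"
    have "L b (L a ?w - foldr L (insort a ns) z) \<in> words ?k"
      using vir_words[OF Cons.IH] by simp
    moreover have "fscale (of_int (a - b)) (L (a + b) ?w) \<in> words ?k"
      using foldr_in_words[of "(a + b) # ns" ?k] by (simp add: words_def fock.span_scale)
    moreover have "(if a + b = 0 then fscale (of_real c / 12 * of_int (a ^ 3 - a)) ?w else 0) \<in> words ?k"
      using foldr_in_words[of ns ?k] by (simp add: words_def fock.span_scale fock.span_zero)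
    ultimately have "L b (L a ?w - foldr L (insort a ns) z) + (fscale (of_int (a - b)) (L (a + b) ?w)
        + (if a + b = 0 then fscale (of_real c / 12 * of_int (a ^ 3 - a)) ?w else 0)) \<in> words ?k"
      unfolding words_def by (intro fock.span_add)
    moreover have "L a (foldr L (b # ns) z) - foldr L (insort a (b # ns)) z =
        L b (L a ?w - foldr L (insort a ns) z) + (fscale (of_int (a - b)) (L (a + b) ?w)
        + (if a + b = 0 then fscale (of_real c / 12 * of_int (a ^ 3 - a)) ?w else 0))"
    proof -
      have "foldr L (insort a (b # ns)) z = L b (foldr L (insort a ns) z)"
        using False by simp
      moreover have "L a (foldr L (b # ns) z) = L a (L b ?w)" by simp
      ultimately show ?thesis
        unfolding vir_diff vir_commute[of a b] by (simp only: add_diff_eq diff_add_eq)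
    qed
    ultimately show ?thesis by (simp only:)
  qed
qed

text \<open>The spanning half of Poincare-Birkhoff-Witt: insertion sort is correct up to shorter
  words, which are sorted by induction.\<close>

lemma words_subset_sorted_words: "words k \<subseteq> sorted_words k"
proof (induction k)
  case 0
  show ?case
    unfolding words_def sorted_words_def by (rule fock.span_mono) auto
next
  case (Suc k)
  have sub: "fock.subspace (sorted_words (Suc k))"
    by (simp add: sorted_words_def)
  have mono: "sorted_words k \<subseteq> sorted_words (Suc k)"
    unfolding sorted_words_def by (rule fock.span_mono) auto
  have L: "L a v \<in> sorted_words (Suc k)" if v: "v \<in> sorted_words k" for a v
  proof (rule vir_span[OF _ sub v[unfolded sorted_words_def]])
    fix u assume "u \<in> {foldr L ns z | ns. sorted ns \<and> length ns \<le> k}"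
    then obtain ns where u: "u = foldr L ns z" and ns: "sorted ns" "length ns \<le> k" by blast
    have "foldr L (insort a ns) z \<in> sorted_words (Suc k)"
      unfolding sorted_words_def using ns
      by (intro fock.span_base CollectI exI[of _ "insort a ns"]) (simp add: sorted_insort)
    moreover have "L a u - foldr L (insort a ns) z \<in> sorted_words (Suc k)"
      using insort_word[of a ns] words_mono[OF ns(2)] Suc.IH mono unfolding u by blast
    ultimately show "L a u \<in> sorted_words (Suc k)"
      using fock.subspace_add[OF sub] by fastforce
  qed
  show ?case
    unfolding words_def
  proof (rule fock.span_minimal[OF _ sub], safe)
    fix ns :: "int list" assume ns: "length ns \<le> Suc k"
    show "foldr L ns z \<in> sorted_words (Suc k)"
    proof (cases "length ns \<le> k")
      case True
      then show ?thesis
        using foldr_in_words Suc.IH mono by blast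
    next
      case False
      then obtain a ms where ms: "ns = a # ms" "length ms \<le> k"
        using ns by (cases ns) auto
      then have "foldr L ms z \<in> sorted_words k"
        using foldr_in_words Suc.IH by blast
      then show ?thesis
        using L ms(1) by simp
    qed
  qed
qed

section \<open>Ordered monomials and the generated submodule\<close>

lemma foldr_upto_skip:
  assumes "lo \<le> a" "\<And>j. j \<in> set ns \<Longrightarrow> a \<le> j" "a \<le> hi"
  shows "foldr (\<lambda>j. L j ^^ count_list ns j) [lo..hi] v = foldr (\<lambda>j. L j ^^ count_list ns j) [a..hi] v"
proof -
  have skip: "foldr (\<lambda>j. L j ^^ count_list ns j) js v = v" if "\<And>j. j \<in> set js \<Longrightarrow> j < a" for js v
    using that
  proof (induction js)
    case (Cons j js)
    then have "j \<notin> set ns" using assms(2) by fastforce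
    then show ?case using Cons by (simp add: count_list_0_iff)
  qed simp
  have "[lo..hi] = [lo..a - 1] @ [a..hi]"
    using assms by (intro upto_split1)
  then show ?thesis
    by (simp only: foldr_append comp_apply) (rule skip, simp)
qed

text \<open>Equal letters of a sorted word are adjacent, so multiplicities serve as exponents.
  \<open>lo\<close> is free because the induction restarts at the first letter.\<close>

lemma foldr_sorted_eq:
  assumes "sorted ns" "set ns \<subseteq> {lo..hi}"
  shows "foldr L ns v = foldr (\<lambda>j. L j ^^ count_list ns j) [lo..hi] v"
  using assms
proof (induction ns arbitrary: lo)
  case Nil
  have "foldr (\<lambda>j. L j ^^ count_list [] j) js v = v" for js
    by (induction js) simp_all
  then show ?case by (simp only: foldr_Nil id_apply)
next
  case (Cons a ns)
  have a: "lo \<le> a" "a \<le> hi" "\<And>j. j \<in> set ns \<Longrightarrow> a \<le> j" "set ns \<subseteq> {a..hi}"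
    using Cons.prems by auto
  have upto: "[a..hi] = a # [a + 1..hi]"
    using a(2) by (rule upto_rec1)
  have cong: "foldr (\<lambda>j. L j ^^ count_list (a # ns) j) [a + 1..hi] v = foldr (\<lambda>j. L j ^^ count_list ns j) [a + 1..hi] v"
    by (rule foldr_cong) auto
  have "foldr (\<lambda>j. L j ^^ count_list (a # ns) j) [lo..hi] v = foldr (\<lambda>j. L j ^^ count_list (a # ns) j) [a..hi] v"
    using a by (intro foldr_upto_skip) auto
  also have "\<dots> = (L a ^^ Suc (count_list ns a)) (foldr (\<lambda>j. L j ^^ count_list ns j) [a + 1..hi] v)"
    unfolding upto using cong by simp
  also have "\<dots> = L a (foldr (\<lambda>j. L j ^^ count_list ns j) [a..hi] v)"
    unfolding upto by simp
  also have "\<dots> = L a (foldr L ns v)"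
    using Cons.IH[OF _ a(4)] Cons.prems(1) by simp
  finally show ?case by simp
qed

lemma foldr_zero: "foldr L ns 0 = 0"
  by (induction ns) (simp_all add: vir_zero)

lemma vir_generated_eq_span_ordered_words:
  assumes z: "\<And>n. n \<ge> 2 \<Longrightarrow> L n z = 0"
  shows "vir_generated L z = fock.span {ordered_word L m e z | m e. m \<ge> - 1}" (is "_ = ?S")
proof
  note inv = vir_invariantD[OF vir_invariant_generated[of z]]
  have base: "z \<in> vir_generated L z"
    unfolding vir_generated_def by (rule hull_inc) simp
  have pow: "(L j ^^ k) v \<in> vir_generated L z" if "v \<in> vir_generated L z" for j k v
    using that by (induction k) (simp_all add: inv)
  have "foldr (\<lambda>j. L j ^^ e j) js z \<in> vir_generated L z" for e js
    by (induction js) (simp_all add: base pow)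
  then show "?S \<subseteq> vir_generated L z"
    by (intro fock.span_minimal inv(2)) (auto simp: ordered_word_def)
  have sorted: "foldr L ns z \<in> ?S" if ns: "sorted ns" for ns
  \<comment> \<open>In a sorted word an index of at least 2 forces the last letter, which acts
    first, to be at least 2; it kills z.\<close>
  proof (cases "\<exists>j\<in>set ns. j \<ge> 2")
    case True
    then have ne: "ns \<noteq> []" by auto
    have eq: "ns = butlast ns @ [last ns]"
      using ne by simp
    have "\<forall>j\<in>set (butlast ns). j \<le> last ns"
      using ns by (subst (asm) eq) (simp add: sorted_append)
    moreover have "set ns = insert (last ns) (set (butlast ns))"
      by (subst eq) simp
    ultimately have "last ns \<ge> 2"
      using True by fastforce
    then have "L (last ns) z = 0"
      by (rule z)
    then have "foldr L ns z = 0"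
      by (subst eq) (simp add: foldr_zero)
    then show ?thesis
      by (simp add: fock.span_zero)
  next
    case False
    \<comment> \<open>The inserted -1 keeps the set nonempty for the empty word.\<close>
    define m where "m = Max (insert (- 1) (uminus ` set ns))"
    have "m \<ge> - 1" "\<And>j. j \<in> set ns \<Longrightarrow> - j \<le> m"
      by (simp_all add: m_def)
    moreover from this have "set ns \<subseteq> {- m..1}"
      using False by fastforce
    then have "foldr L ns z = ordered_word L m (count_list ns) z"
      unfolding ordered_word_def by (rule foldr_sorted_eq[OF ns])
    ultimately show ?thesis
      by (intro fock.span_base) blast
  qed
  have "foldr L ns z \<in> ?S" for ns
  proof -
    have "foldr L ns z \<in> sorted_words (length ns)"
      using foldr_in_words words_subset_sorted_words by blast
    moreover have "sorted_words (length ns) \<subseteq> ?S"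
      unfolding sorted_words_def using sorted by (intro fock.span_minimal fock.subspace_span) blast
    ultimately show ?thesis by blast
  qed
  then show "vir_generated L z \<subseteq> ?S"
    unfolding vir_generated_eq_span_words[OF vir_add vir_scale]
    by (intro fock.span_minimal fock.subspace_span) blast
qed

end

end


section \<open>Partition functions\<close>

lemma vir_op_fcoeff:
  "vir_op c X hx hy n (fcoeff g) = (\<Sum>i\<in>UNIV. poly (fs.vpoly n) (fcoord i) * fcoeff (pderiv_smooth i g))
    + vir_weight c X hx hy n * fcoeff g"
  by (simp add: vir_op_eq vir_field_def vfield_fcoeff)

lemma Res_schwarzian_eq_0: "n \<ge> - 1 \<Longrightarrow> Res (zpow (1 - n) * schwarzian) = 0"
  unfolding schwarzian_eq by (rule fs.Res_eps_schw)

lemma vir_op_ge_2_fcoeff: "n \<ge> 2 \<Longrightarrow> vir_op c X hx hy n (fcoeff g) = 0"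
  by (simp add: vir_op_fcoeff vir_weight_def Res_schwarzian_eq_0 fs.vpoly_ge_2)

lemma vir_op_1_fcoeff: "vir_op c X hx hy 1 (fcoeff g) = fcoeff (\<Sum>i\<in>UNIV. pderiv_smooth i g)"
  using Res_schwarzian_eq_0[of 1, where 'a = 'a]
  by (simp add: vir_op_fcoeff vir_weight_def fs.vpoly_1 fcoeff_sum derivation_1[OF derivation_pder])

lemma vir_op_0_fcoeff:
  "vir_op c X hx hy 0 (fcoeff g) = fcoeff (\<Sum>i\<in>UNIV. coord_smooth i * pderiv_smooth i g)
    + fr ((\<Sum>i\<in>X. hx i) + (\<Sum>i\<in>- X. hy i)) * fcoeff g"
proof -
  have fr_sum: "fr (\<Sum>i\<in>I. u i) = (\<Sum>i\<in>I. fr (u i) :: 'a fock)" for I and u :: "'a \<Rightarrow> real"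
    by (induction I rule: infinite_finite_induct) (simp_all add: fr_hom[simplified] fconst_hom)
  have "(\<Sum>i\<in>UNIV. fr (if i \<in> X then hx i else hy i)) =
      (\<Sum>i\<in>X. fr (hx i)) + (\<Sum>i\<in>- X. fr (hy i) :: 'a fock)"
    using sum.union_disjoint[of X "- X" "\<lambda>i. fr (if i \<in> X then hx i else hy i) :: 'a fock"]
    by (simp add: Compl_partition)
  also have "\<dots> = fr ((\<Sum>i\<in>X. hx i) + (\<Sum>i\<in>- X. hy i))"
    by (simp only: fr_hom fr_sum)
  finally have "(\<Sum>i\<in>UNIV. fr (if i \<in> X then hx i else hy i)) = (fr ((\<Sum>i\<in>X. hx i) + (\<Sum>i\<in>- X. hy i)) :: 'a fock)" .
  then show ?thesis
    using Res_schwarzian_eq_0[of 0, where 'a = 'a]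
    by (simp add: vir_op_fcoeff vir_weight_def fs.vpoly_0 fcoeff_sum fcoeff_hom pder_pCons del: of_real_add)
qed

lemma sum_pderiv_smooth_translation_invariant:
  fixes Z :: "real ^ 'i::{finite,linorder} \<Rightarrow> real"
  assumes Z: "smooth_on chamber Z"
    and inv: "\<And>\<sigma> p. p \<in> chamber \<Longrightarrow> Z (\<chi> i. p $ i + \<sigma>) = Z p"
  shows "(\<Sum>i\<in>UNIV. pderiv_smooth i (smooth_fun_of (\<lambda>p. complex_of_real (Z p)))) = 0"
proof (rule smooth_fun_eqI)
  fix p :: "(real, 'i) vec" assume p: "p \<in> chamber"
  let ?g = "smooth_fun_of (\<lambda>p. complex_of_real (Z p))"
  let ?D = "frechet_derivative (Rep_smooth_fun ?g) (at p)"
  \<comment> \<open>Invariance is differentiated along the diagonal (1, ..., 1); translations never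
    leave the chamber.\<close>
  define e :: "(real, 'i) vec" where "e = (\<chi> i. 1)"
  have e: "(\<Sum>i\<in>UNIV. axis i 1) = e"
    by (simp add: e_def vec_eq_iff axis_def)
  have D: "(Rep_smooth_fun ?g has_derivative ?D) (at p)"
    by (rule Rep_smooth_fun_has_derivative[OF p])
  have "((\<lambda>\<sigma>. p + \<sigma> *\<^sub>R e) has_derivative (\<lambda>y. y *\<^sub>R e)) (at 0)"
    by (auto intro!: derivative_eq_intros)
  then have "((\<lambda>\<sigma>. Rep_smooth_fun ?g (p + \<sigma> *\<^sub>R e)) has_derivative (\<lambda>y. ?D (y *\<^sub>R e))) (at 0)"
    using diff_chain_at[of "\<lambda>\<sigma>. p + \<sigma> *\<^sub>R e" _ 0 "Rep_smooth_fun ?g" ?D] D by (simp add: o_def)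
  moreover have "Rep_smooth_fun ?g (p + \<sigma> *\<^sub>R e) = Rep_smooth_fun ?g p" for \<sigma>
  proof -
    have "p + \<sigma> *\<^sub>R e = (\<chi> i. p $ i + \<sigma>)"
      by (simp add: e_def vec_eq_iff)
    moreover have "(\<chi> i. p $ i + \<sigma>) \<in> chamber"
      using p by (simp add: chamber_def)
    ultimately show ?thesis
      using p inv[OF p] by (simp add: Rep_smooth_fun_of smooth_on_of_real Z)
  qed
  ultimately have "((\<lambda>\<sigma>. Rep_smooth_fun ?g p) has_derivative (\<lambda>y. ?D (y *\<^sub>R e))) (at (0::real))"
    by simp
  from has_derivative_unique[OF this has_derivative_const] have "?D (1 *\<^sub>R e) = 0"
    by meson
  then have "?D e = 0" by simp
  then have "(\<Sum>i\<in>UNIV. ?D (axis i 1)) = 0"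
    using linear_sum[OF has_derivative_linear[OF D], of "\<lambda>i. axis i 1" UNIV] by (simp add: e)
  then show "Rep_smooth_fun (\<Sum>i\<in>UNIV. pderiv_smooth i ?g) p = Rep_smooth_fun 0 p"
    using p by (simp add: Rep_smooth_fun_sum pderiv_smooth.rep_eq zero_smooth_fun.rep_eq)
qed

lemma euler_homogeneous:
  fixes Z :: "real ^ 'i::{finite,linorder} \<Rightarrow> real"
  assumes Z: "smooth_on chamber Z"
    and hom: "\<And>t p. t > 0 \<Longrightarrow> p \<in> chamber \<Longrightarrow> Z (t *\<^sub>R p) = t powr \<Delta> * Z p"
  shows "(\<Sum>i\<in>UNIV. coord_smooth i * pderiv_smooth i (smooth_fun_of (\<lambda>p. complex_of_real (Z p)))) =
    const_smooth (of_real \<Delta>) * smooth_fun_of (\<lambda>p. complex_of_real (Z p))"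
proof (rule smooth_fun_eqI)
  fix p :: "(real, 'i) vec" assume p: "p \<in> chamber"
  let ?g = "smooth_fun_of (\<lambda>p. complex_of_real (Z p))"
  let ?D = "frechet_derivative (Rep_smooth_fun ?g) (at p)"
  have D: "(Rep_smooth_fun ?g has_derivative ?D) (at (1 *\<^sub>R p))"
    using Rep_smooth_fun_has_derivative[OF p] by simp
  have "((\<lambda>t. t *\<^sub>R p) has_derivative (\<lambda>y. y *\<^sub>R p)) (at 1)"
    by (auto intro!: derivative_eq_intros)
  then have 1: "((\<lambda>t. Rep_smooth_fun ?g (t *\<^sub>R p)) has_derivative (\<lambda>y. ?D (y *\<^sub>R p))) (at 1)"
    using diff_chain_at[of "\<lambda>t. t *\<^sub>R p" _ 1 "Rep_smooth_fun ?g" ?D] D by (simp add: o_def)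
  have 2: "((\<lambda>t. Rep_smooth_fun ?g (t *\<^sub>R p)) has_derivative
      (\<lambda>y. complex_of_real (y * (\<Delta> * Z p)))) (at 1)"
  \<comment> \<open>The point t p is known to stay in the chamber for t > 0, so the functions are
    compared on this open half-line around 1.\<close>
  proof (rule has_derivative_transform_within_open[of _ _ 1 UNIV "{0<..}"])
    have "((\<lambda>t. t powr \<Delta> * Z p) has_real_derivative \<Delta> * Z p) (at 1)"
      by (auto intro!: derivative_eq_intros)
    then have "((\<lambda>t. t powr \<Delta> * Z p) has_derivative (\<lambda>y. y * (\<Delta> * Z p))) (at 1)"
      by (simp add: has_field_derivative_def mult_commute_abs)
    then show "((\<lambda>t. complex_of_real (t powr \<Delta> * Z p)) has_derivative (\<lambda>y. complex_of_real (y * (\<Delta> * Z p)))) (at 1)"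
      by (rule bounded_linear.has_derivative[OF bounded_linear_of_real])
    fix t :: real assume t: "t \<in> {0<..}"
    then have "t *\<^sub>R p \<in> chamber"
      using p by (simp add: chamber_def)
    then show "complex_of_real (t powr \<Delta> * Z p) = Rep_smooth_fun ?g (t *\<^sub>R p)"
      using t hom[of t p] p by (simp add: Rep_smooth_fun_of smooth_on_of_real Z)
  qed auto
  from fun_cong[OF has_derivative_unique[OF 1 2], of 1] have Dp: "?D p = complex_of_real (\<Delta> * Z p)" by simp
  have "(\<Sum>i\<in>UNIV. p $ i *\<^sub>R axis i 1) = p"
    using basis_expansion[of p] by (simp add: scalar_mult_eq_scaleR)
  then have "?D p = (\<Sum>i\<in>UNIV. p $ i *\<^sub>R ?D (axis i 1))"
    using linear_sum[OF has_derivative_linear[OF D], of "\<lambda>i. p $ i *\<^sub>R axis i 1" UNIV]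
    by (simp add: linear_scale[OF has_derivative_linear[OF D]])
  with Dp have "(\<Sum>i\<in>UNIV. complex_of_real (p $ i) * ?D (axis i 1)) = complex_of_real (\<Delta> * Z p)"
    by (simp add: scaleR_conv_of_real)
  then show "Rep_smooth_fun (\<Sum>i\<in>UNIV. coord_smooth i * pderiv_smooth i ?g) p =
      Rep_smooth_fun (const_smooth (of_real \<Delta>) * ?g) p"
    using p by (simp add: Rep_smooth_fun_sum times_smooth_fun.rep_eq pderiv_smooth.rep_eq Rep_coord_smooth Rep_const_smooth
        Rep_smooth_fun_of smooth_on_of_real Z)
qed

section \<open>Kernels of the null vector operators and the final assembly\<close>

lemma A_op_fcoeff: "A_op X kap hy i (fcoeff g) = null_op X kap hy i (fcoeff g)"
  by (simp add: A_op_def pderiv_var_fcoeff)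

lemma A_op_add: "i \<in> X \<Longrightarrow> A_op X kap hy i (P + Q) = A_op X kap hy i P + A_op X kap hy i Q"
  by (simp add: A_op_eq derivation_add[OF derivation_pderiv_coord] derivation_add[OF derivation_loewner_field]
      algebra_simps)

lemma A_op_fscale: "i \<in> X \<Longrightarrow> A_op X kap hy i (fscale a P) = fscale a (A_op X kap hy i P)"
  by (simp add: A_op_eq fscale_def derivation_mult[OF derivation_pderiv_coord]
      derivation_mult[OF derivation_loewner_field] pderiv_coord_fconst loewner_field_fconst algebra_simps)

lemma subspace_Ker_A_op:
  assumes "i \<in> X"
  shows "fock.subspace {P. A_op X kap hy i P = 0}"
  using A_op_add[OF assms, of kap hy 0 0]
  by (simp add: fock.subspace_def A_op_add[OF assms] A_op_fscale[OF assms])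

lemma vir_invariant_Ker_A_op:
  fixes X :: "'i::{finite,linorder} set"
  assumes kap: "\<And>i. i \<in> X \<Longrightarrow> kap i \<in> {\<kappa>, 16 / \<kappa>}" and \<kappa>: "\<kappa> > 0"
  shows "vir_invariant (vir_op (central_charge \<kappa>) X (h_x kap) hy) (\<Inter>i\<in>X. {P. A_op X kap hy i P = 0})"
  unfolding vir_invariant_def
proof (intro conjI allI ballI)
  show "fock.subspace (\<Inter>i\<in>X. {P. A_op X kap hy i P = 0})"
    by (rule fock.subspace_Inter) (auto simp: subspace_Ker_A_op)
  fix n P assume P: "P \<in> (\<Inter>i\<in>X. {P. A_op X kap hy i P = 0})"
  show "vir_op (central_charge \<kappa>) X (h_x kap) hy n P \<in> (\<Inter>i\<in>X. {P. A_op X kap hy i P = 0})"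
  proof safe
    fix i assume i: "i \<in> X"
    \<comment> \<open>The central charge is unchanged under \<kappa> -> 16/\<kappa>, so its relation
      to \<open>kap i\<close> holds for both admissible values.\<close>
    have "(6 - 16 / \<kappa>) * (3 * (16 / \<kappa>) - 8) / (2 * (16 / \<kappa>)) = central_charge \<kappa>"
      using \<kappa> by (simp add: central_charge_def field_simps)
    then have "kap i \<noteq> 0" "central_charge \<kappa> = (6 - kap i) * (3 * kap i - 8) / (2 * kap i)"
      using kap[OF i] \<kappa> by (auto simp: central_charge_def)
    from A_op_vir_op_commutator[of i X kap "central_charge \<kappa>" hy n P, OF i this] show "A_op X kap hy i (vir_op (central_charge \<kappa>) X (h_x kap) hy n P) = 0"
      using P i by (simp add: derivation_0[OF derivation_vir_field] vir_op_eq)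
  qed
qed

lemma virasoro_module_subspace:
  "virasoro_module c L UNIV \<Longrightarrow> vir_invariant L W \<Longrightarrow> virasoro_module c L W"
  by (simp add: virasoro_module_def vir_invariant_def)

theorem corollary4p6:
  fixes \<kappa> :: real
    and X :: "'i::{finite,linorder} set"
    and kap hy :: "'i \<Rightarrow> real"
    and Z :: "real ^ 'i::{finite,linorder} \<Rightarrow> real"
  assumes "\<kappa> > 0"
    and "X \<noteq> {}"
    and "\<And>i. i \<in> X \<Longrightarrow> kap i \<in> {\<kappa>, 16 / \<kappa>}"
    and "smooth_on chamber Z"
    and "\<And>p. p \<in> chamber \<Longrightarrow> Z p > 0"
    and "\<And>i. i \<in> X \<Longrightarrow> null_op X kap hy i (fock_of_real_fun Z) = 0"
  shows
    "let c = central_charge \<kappa>;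
         L = vir_op c X (h_x kap) hy;
         z = fock_of_real_fun Z;
         M = vir_generated L z;
         K = (\<Inter>i\<in>X. {P. A_op X kap hy i P = 0});
         h = (\<Sum>i\<in>X. h_x kap i) + (\<Sum>i\<in>- X. hy i);
         transl_inv = (\<forall>\<sigma>. \<forall>p\<in>chamber. Z (\<chi> i. p $ i + \<sigma>) = Z p);
         homog = (\<lambda>\<Delta>. \<forall>t>0. \<forall>p\<in>chamber. Z (t *\<^sub>R p) = t powr \<Delta> * Z p)
     in (virasoro_submodule c L M \<and> virasoro_submodule c L K \<and> M \<subseteq> K) \<and>
        ((\<forall>n\<ge>2. L n z = 0) \<and>
         M = fock.span {ordered_word L m e z | m e. m \<ge> - 1}) \<and>
        (transl_inv \<longrightarrow> L 1 z = 0) \<and>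
        (\<forall>\<Delta>. homog \<Delta> \<longrightarrow> L 0 z = fscale (of_real (\<Delta> + h)) z) \<and>
        (\<forall>\<Delta>. transl_inv \<and> homog \<Delta> \<longrightarrow> highest_weight_module c L M z (\<Delta> + h))"
proof -
  define c where "c = central_charge \<kappa>"
  define L where "L = vir_op c X (h_x kap) hy"
  define z where "z = fock_of_real_fun Z"
  define M where "M = vir_generated L z"
  define K where "K = (\<Inter>i\<in>X. {P. A_op X kap hy i P = 0})"
  define h where "h = (\<Sum>i\<in>X. h_x kap i) + (\<Sum>i\<in>- X. hy i)"
  define transl_inv where "transl_inv \<longleftrightarrow> (\<forall>\<sigma>. \<forall>p\<in>chamber. Z (\<chi> i. p $ i + \<sigma>) = Z p)"
  define homog where "homog = (\<lambda>\<Delta>. \<forall>t>0. \<forall>p\<in>chamber. Z (t *\<^sub>R p) = t powr \<Delta> * Z p)"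
  define g where "g = smooth_fun_of (\<lambda>p. complex_of_real (Z p))"
  have z: "z = fcoeff g"
    by (simp add: z_def g_def fock_of_real_fun_def)
  have module: "virasoro_module c L UNIV"
    unfolding L_def by (rule virasoro_module_vir_op)
  have invM: "vir_invariant L M"
    unfolding M_def by (rule vir_invariant_generated[OF module])
  have invK: "vir_invariant L K"
    unfolding L_def K_def c_def by (rule vir_invariant_Ker_A_op[OF assms(3,1)])
  \<comment> \<open>z contains no variables f_m, so A_I reduces on it to the null field
    operator.\<close>
  have "z \<in> K"
    using assms(6) by (simp add: K_def z A_op_fcoeff flip: z_def)
  then have MK: "M \<subseteq> K"
    unfolding M_def vir_generated_def by (intro hull_minimal invK) simp
  have ge2: "L n z = 0" if "n \<ge> 2" for n
    unfolding L_def z using that by (rule vir_op_ge_2_fcoeff)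
  have span: "M = fock.span {ordered_word L m e z | m e. m \<ge> - 1}"
    unfolding M_def by (rule vir_generated_eq_span_ordered_words[OF module ge2])
  have L1: "L 1 z = 0" if transl_inv
  proof -
    have "(\<Sum>i\<in>UNIV. pderiv_smooth i g) = 0"
      unfolding g_def using that
      by (intro sum_pderiv_smooth_translation_invariant assms(4)) (simp add: transl_inv_def)
    then show ?thesis
      by (simp add: L_def z vir_op_1_fcoeff fcoeff_hom)
  qed
  have L0: "L 0 z = fscale (of_real (\<Delta> + h)) z" if "homog \<Delta>" for \<Delta>
  proof -
    have "(\<Sum>i\<in>UNIV. coord_smooth i * pderiv_smooth i g) = const_smooth (of_real \<Delta>) * g"
      unfolding g_def using that
      by (intro euler_homogeneous assms(4)) (simp add: homog_def)
    then show ?thesis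
      by (simp add: L_def z vir_op_0_fcoeff fcoeff_hom fscale_def fconst_hom distrib_right flip: h_def)
  qed
  have hw: "highest_weight_module c L M z (\<Delta> + h)" if "transl_inv \<and> homog \<Delta>" for \<Delta>
  proof -
    have "L n z = 0" if "n > 0" for n
      using L1 ge2[of n] \<open>n > 0\<close> \<open>transl_inv \<and> homog \<Delta>\<close> by (cases "n = 1") auto
    then show ?thesis
      unfolding highest_weight_module_def
      using virasoro_module_subspace[OF module invM] L0 that M_def by blast
  qed
  have "(virasoro_submodule c L M \<and> virasoro_submodule c L K \<and> M \<subseteq> K) \<and>
        ((\<forall>n\<ge>2. L n z = 0) \<and>
         M = fock.span {ordered_word L m e z | m e. m \<ge> - 1}) \<and>
        (transl_inv \<longrightarrow> L 1 z = 0) \<and>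
        (\<forall>\<Delta>. homog \<Delta> \<longrightarrow> L 0 z = fscale (of_real (\<Delta> + h)) z) \<and>
        (\<forall>\<Delta>. transl_inv \<and> homog \<Delta> \<longrightarrow> highest_weight_module c L M z (\<Delta> + h))"
    using module invM invK MK ge2 span L1 L0 hw by (simp add: virasoro_submodule_def)
  then show ?thesis
    unfolding Let_def homog_def transl_inv_def h_def K_def M_def z_def L_def c_def .
qed

end
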